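(* Let $(X,\mu)$ be a standard non-atomic probability space. Let $G$ be a free group with at most countably many generators. Let $a \in A(G,X,\mu)$ be essentially free and let $[a]_{OE}$ be the set of all actions $b \in A(G,X,\mu)$ which are orbit-equivalent to $a$. Then $[a]_{OE}$ is dense in $A(G,X,\mu)$.
   Context: $\mathrm{Aut}(X,\mu)$ is the group of all measure-preserving automorphisms of $(X,\mu)$, two automorphisms being identified if they agree on a conull set. The weak topology on $\mathrm{Aut}(X,\mu)$ is the one induced by the metric $d_w(T,S)=\sum_{i\ge 1}2^{-i}\mu(TA_i \vartriangle SA_i)$, where $\{A_i\}_{i\ge 1}$ is any sequence of measurable sets dense in the measure algebra of $\mu$ for the distance $d(A,B)=\mu(A\vartriangle B)$ (the topology does not depend on the sequence). For a countable group $G$, an action of $G$ is a homomorphism $a:G\to \mathrm{Aut}(X,\mu)$, and $A(G,X,\mu)$ is the set of all such actions, with the subspace topology from $\mathrm{Aut}(X,\mu)^G$, which carries the product of the weak topologies. An action $a$ is essentially free if for a.e. $x\in X$, $\{g\in G: a(g)x=x\}=\{e_G\}$. Two actions $a,b\in A(G,X,\mu)$ are orbit-equivalent if there is $T\in \mathrm{Aut}(X,\mu)$ with $T(a(G)x)=b(G)T(x)$ for a.e. $x\in X$. *)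

theory Defs
  imports "HOL-Probability.Probability" "HOL-Algebra.Group"
begin

section \<open>Standard non-atomic probability spaces\<close>

definition standard_borel :: "'a measure \<Rightarrow> bool" where
  "standard_borel M \<longleftrightarrow>
     (\<exists>X. completely_metrizable_space X \<and> second_countable X \<and> topspace X = space M \<and>
          sets M = sigma_sets (space M) {U. openin X U})"

definition non_atomic :: "'a measure \<Rightarrow> bool" where
  "non_atomic M \<longleftrightarrow>
     (\<forall>A\<in>sets M. 0 < measure M A \<longrightarrow>
        (\<exists>B\<in>sets M. B \<subseteq> A \<and> 0 < measure M B \<and> measure M B < measure M A))"

section \<open>The group of automorphisms with the weak topology\<close>

definition mp_automorphisms :: "'a measure \<Rightarrow> ('a \<Rightarrow> 'a) set" where
  "mp_automorphisms M =
     {T. bij_betw T (space M) (space M) \<and> T \<in> measurable M M \<and>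
         the_inv_into (space M) T \<in> measurable M M \<and> distr M M T = M}"

text \<open>
  Elements of \<open>Aut(X,\<mu>)\<close> are classes of automorphisms modulo equality on a conull set.
  Everything below that is formulated with a representative \<open>aut_rep c\<close> of a class \<open>c\<close>
  does not depend on which representative is chosen.
\<close>

definition aut_rel :: "'a measure \<Rightarrow> (('a \<Rightarrow> 'a) \<times> ('a \<Rightarrow> 'a)) set" where
  "aut_rel M = {(S, T). S \<in> mp_automorphisms M \<and> T \<in> mp_automorphisms M \<and>
                        (AE x in M. S x = T x)}"

definition aut_rep :: "('a \<Rightarrow> 'a) set \<Rightarrow> 'a \<Rightarrow> 'a" where
  "aut_rep c = (SOME T. T \<in> c)"

definition Aut :: "'a measure \<Rightarrow> ('a \<Rightarrow> 'a) set monoid" where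
  "Aut M = \<lparr>carrier = mp_automorphisms M // aut_rel M,
            mult = \<lambda>c d. aut_rel M `` {aut_rep c \<circ> aut_rep d},
            one = aut_rel M `` {id}\<rparr>"

definition dense_sequence :: "'a measure \<Rightarrow> (nat \<Rightarrow> 'a set) \<Rightarrow> bool" where
  "dense_sequence M A \<longleftrightarrow>
     range A \<subseteq> sets M \<and>
     (\<forall>B\<in>sets M. \<forall>\<epsilon>>0. \<exists>i. measure M (sym_diff (A i) B) < \<epsilon>)"

text \<open>The sequence is indexed from 0 here, so the weight of \<open>A i\<close> is \<open>(1/2)\<^bsup>i+1\<^esup>\<close>.\<close>

definition weak_dist ::
    "'a measure \<Rightarrow> (nat \<Rightarrow> 'a set) \<Rightarrow> ('a \<Rightarrow> 'a) set \<Rightarrow> ('a \<Rightarrow> 'a) set \<Rightarrow> real" where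
  "weak_dist M A c d =
     (\<Sum>i. (1/2) ^ Suc i * measure M (sym_diff (aut_rep c ` A i) (aut_rep d ` A i)))"

definition weak_topology ::
    "'a measure \<Rightarrow> (nat \<Rightarrow> 'a set) \<Rightarrow> ('a \<Rightarrow> 'a) set topology" where
  "weak_topology M A = Metric_space.mtopology (carrier (Aut M)) (weak_dist M A)"

section \<open>Actions\<close>

text \<open>
  Homomorphisms are taken extensional (\<open>undefined\<close> off the carrier of \<open>G\<close>), as are the points
  of a \<^const>\<open>product_topology\<close>.
\<close>

definition actions ::
    "('g, 'm) monoid_scheme \<Rightarrow> 'a measure \<Rightarrow> ('g \<Rightarrow> ('a \<Rightarrow> 'a) set) set" where
  "actions G M = hom G (Aut M) \<inter> extensional (carrier G)"

definition action_topology ::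
    "('g, 'm) monoid_scheme \<Rightarrow> 'a measure \<Rightarrow> (nat \<Rightarrow> 'a set) \<Rightarrow>
     ('g \<Rightarrow> ('a \<Rightarrow> 'a) set) topology" where
  "action_topology G M A =
     subtopology (product_topology (\<lambda>_. weak_topology M A) (carrier G)) (actions G M)"

definition essentially_free ::
    "('g, 'm) monoid_scheme \<Rightarrow> 'a measure \<Rightarrow> ('g \<Rightarrow> ('a \<Rightarrow> 'a) set) \<Rightarrow> bool" where
  "essentially_free G M a \<longleftrightarrow>
     (AE x in M. {g \<in> carrier G. aut_rep (a g) x = x} = {\<one>\<^bsub>G\<^esub>})"

definition action_orbit ::
    "('g, 'm) monoid_scheme \<Rightarrow> ('g \<Rightarrow> ('a \<Rightarrow> 'a) set) \<Rightarrow> 'a \<Rightarrow> 'a set" where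
  "action_orbit G a x = (\<lambda>g. aut_rep (a g) x) ` carrier G"

definition orbit_equivalent ::
    "('g, 'm) monoid_scheme \<Rightarrow> 'a measure \<Rightarrow> ('g \<Rightarrow> ('a \<Rightarrow> 'a) set) \<Rightarrow>
     ('g \<Rightarrow> ('a \<Rightarrow> 'a) set) \<Rightarrow> bool" where
  "orbit_equivalent G M a b \<longleftrightarrow>
     (\<exists>c\<in>carrier (Aut M). AE x in M.
        aut_rep c ` action_orbit G a x = action_orbit G b (aut_rep c x))"

definition oe_class ::
    "('g, 'm) monoid_scheme \<Rightarrow> 'a measure \<Rightarrow> ('g \<Rightarrow> ('a \<Rightarrow> 'a) set) \<Rightarrow>
     ('g \<Rightarrow> ('a \<Rightarrow> 'a) set) set" where
  "oe_class G M a = {b \<in> actions G M. orbit_equivalent G M a b}"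

section \<open>Free groups\<close>

text \<open>
  A letter \<open>(s, True)\<close> stands for the generator \<open>s\<close> and \<open>(s, False)\<close> for its inverse.
  \<open>G\<close> is free on \<open>S\<close> if every element is the value of exactly one reduced word over \<open>S\<close>.
\<close>

definition letter_value :: "('g, 'm) monoid_scheme \<Rightarrow> 'g \<times> bool \<Rightarrow> 'g" where
  "letter_value G l = (if snd l then fst l else inv\<^bsub>G\<^esub> (fst l))"

definition word_value :: "('g, 'm) monoid_scheme \<Rightarrow> ('g \<times> bool) list \<Rightarrow> 'g" where
  "word_value G w = foldr (\<lambda>l h. letter_value G l \<otimes>\<^bsub>G\<^esub> h) w \<one>\<^bsub>G\<^esub>"

definition reduced_words :: "'g set \<Rightarrow> ('g \<times> bool) list set" where
  "reduced_words S =
     {w \<in> lists (S \<times> UNIV). successively (\<lambda>k l. fst k = fst l \<longrightarrow> snd k = snd l) w}"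

definition free_on :: "('g, 'm) monoid_scheme \<Rightarrow> 'g set \<Rightarrow> bool" where
  "free_on G S \<longleftrightarrow>
     group G \<and> S \<subseteq> carrier G \<and> bij_betw (word_value G) (reduced_words S) (carrier G)"

end

theory Submission
  imports Defs
begin

text \<open>
  Fix an essentially free action \<open>a\<close>, any action \<open>b\<close>, finitely many
  generators and finitely many measurable sets. A generator \<open>r\<close> acts by
  \<open>a\<close> as an aperiodic automorphism \<open>U\<close>. If every other generator
  \<open>V\<close> of \<open>a\<close> is replaced by \<open>\<psi> \<circ> V\<close>, where
  \<open>\<psi>\<close> moves each point inside its \<open>U\<close>-orbit, then the orbits of the
  group do not change, because \<open>U\<close> itself is still one of the generators
  (\<open>word_orbit_full_group\<close>). The group is free, so the new generators define an action,
  and so do their conjugates by any automorphism \<open>T\<close>; all these actions are orbit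
  equivalent to \<open>a\<close> (\<open>oe_classI\<close>). It remains to choose \<open>T\<close>
  and the maps \<open>\<psi>\<close> such that the conjugated generators move the given sets almost
  as \<open>b\<close> does (\<open>full_group_approximation\<close>).

  If \<open>U\<close> is ergodic, its full group is weakly dense in the group of all automorphisms,
  so suitable \<open>\<psi>\<close> exist for every \<open>T\<close>. In general a set must have
  almost the same density along almost every \<open>U\<close>-orbit before elements of the full
  group can move it freely, and randomness provides such sets. By a Rokhlin tower almost all of the
  space is cut into long pieces of \<open>U\<close>-orbits. Each piece is coloured by a piece of a
  random \<open>b(r)\<close>-orbit: its lowest point is sent to a random point
  \<open>\<omega>\<close>, and the point \<open>i\<close> steps above to \<open>b(r)\<^sup>i
  \<omega>\<close>. The resulting map \<open>\<Phi>\<close> satisfies \<open>\<Phi> \<circ> U = b(r)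
  \<circ> \<Phi>\<close> except outside the tower and on its top level. Every value \<open>\<Phi>
  y\<close> in the tower has distribution \<open>\<mu>\<close>, and values at points from different
  pieces are independent if the pieces get different samples. A second-moment estimate
  (\<open>random_map_second_moment\<close>) then gives a choice of the samples for which, along most
  \<open>U\<close>-columns of a much higher tower, the points \<open>\<Phi> (U\<^sup>t x)\<close> as
  well as \<open>\<Phi> (inv V (U\<^sup>t x))\<close> visit each of finitely many sets
  with almost the right frequency (\<open>sampled_map\<close>). Freeness enters here: the points
  \<open>inv V (U\<^sup>t x)\<close> lie in different \<open>U\<close>-orbits for
  different \<open>t\<close> (\<open>generator_separation\<close>).

  Since the frequencies almost agree in most columns, a permutation of the column matches most of
  the points whose image under \<open>\<Phi> \<circ> inv V\<close> lies in a cell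
  \<open>E\<close> with the points whose image under \<open>\<Phi>\<close> lies in the translate of
  \<open>E\<close> by \<open>b\<close>. These permutations together form \<open>\<psi>\<close>
  (\<open>matched_full_group_element\<close>). Finally \<open>\<Phi>\<close> is replaced by an
  automorphism \<open>T\<close> that puts almost every point into the same cell
  (\<open>realize_labels\<close>). Here the space has to be standard and non-atomic: both partitions
  into cells are laid out as partitions of \<open>[0,1]\<close> into intervals.

  Closeness on generators implies closeness on words (\<open>word_act_continuous\<close>), which
  gives density in the product of the weak topologies.
\<close>

section \<open>Measure-preserving automorphisms\<close>

abbreviation minv :: "'a measure \<Rightarrow> ('a \<Rightarrow> 'a) \<Rightarrow> 'a \<Rightarrow> 'a" where
  "minv M T \<equiv> the_inv_into (space M) T"

lemma mp_aut_bij: "T \<in> mp_automorphisms M \<Longrightarrow> bij_betw T (space M) (space M)"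
  and mp_aut_measurable: "T \<in> mp_automorphisms M \<Longrightarrow> T \<in> measurable M M"
  and mp_aut_minv_measurable: "T \<in> mp_automorphisms M \<Longrightarrow> minv M T \<in> measurable M M"
  and mp_aut_distr: "T \<in> mp_automorphisms M \<Longrightarrow> distr M M T = M"
  by (auto simp: mp_automorphisms_def)

lemma mp_aut_space: "T \<in> mp_automorphisms M \<Longrightarrow> x \<in> space M \<Longrightarrow> T x \<in> space M"
  by (rule measurable_space[OF mp_aut_measurable])

lemma mp_aut_inj: "T \<in> mp_automorphisms M \<Longrightarrow> x \<in> space M \<Longrightarrow> y \<in> space M \<Longrightarrow> T x = T y \<longleftrightarrow> x = y"
  using mp_aut_bij[of T M] by (auto simp: bij_betw_def inj_on_def)

lemma minv_left: "T \<in> mp_automorphisms M \<Longrightarrow> x \<in> space M \<Longrightarrow> minv M T (T x) = x"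
  using mp_aut_bij[of T M] by (auto simp: bij_betw_def the_inv_into_f_f)

lemma minv_right: "T \<in> mp_automorphisms M \<Longrightarrow> x \<in> space M \<Longrightarrow> T (minv M T x) = x"
  using mp_aut_bij[of T M] by (auto simp: bij_betw_def f_the_inv_into_f)

lemma minv_space: "T \<in> mp_automorphisms M \<Longrightarrow> x \<in> space M \<Longrightarrow> minv M T x \<in> space M"
  by (rule measurable_space[OF mp_aut_minv_measurable])

lemma mp_autI:
  assumes T: "T \<in> measurable M M" and R: "R \<in> measurable M M"
    and RT: "\<And>x. x \<in> space M \<Longrightarrow> R (T x) = x" and TR: "\<And>x. x \<in> space M \<Longrightarrow> T (R x) = x"
    and d: "distr M M T = M"
  shows "T \<in> mp_automorphisms M" "\<And>x. x \<in> space M \<Longrightarrow> minv M T x = R x"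
proof -
  have b: "bij_betw T (space M) (space M)"
    by (rule bij_betw_byWitness[where f' = R])
       (use measurable_space[OF T] measurable_space[OF R] RT TR in auto)
  show e: "\<And>x. x \<in> space M \<Longrightarrow> minv M T x = R x"
    using b measurable_space[OF R] TR by (metis bij_betw_def the_inv_into_f_f)
  have "minv M T \<in> measurable M M"
    using R e by (subst measurable_cong[of M _ R]) auto
  with b T d show "T \<in> mp_automorphisms M" by (auto simp: mp_automorphisms_def)
qed

lemma mp_aut_minv: assumes "T \<in> mp_automorphisms M" shows "minv M T \<in> mp_automorphisms M"
proof (rule mp_autI(1)[where R = T])
  have "distr M M (minv M T) = distr (distr M M T) M (minv M T)"
    using assms by (simp add: mp_aut_distr)
  also have "\<dots> = distr M M (minv M T \<circ> T)"
    using assms by (intro distr_distr mp_aut_minv_measurable mp_aut_measurable)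
  also have "\<dots> = distr M M (\<lambda>x. x)"
    using assms by (intro distr_cong) (auto simp: minv_left)
  finally show "distr M M (minv M T) = M" by simp
qed (use assms in \<open>auto simp: mp_aut_minv_measurable mp_aut_measurable minv_left minv_right\<close>)

lemma mp_aut_comp:
  assumes "S \<in> mp_automorphisms M" "T \<in> mp_automorphisms M"
  shows "S \<circ> T \<in> mp_automorphisms M"
    and "\<And>x. x \<in> space M \<Longrightarrow> minv M (S \<circ> T) x = minv M T (minv M S x)"
proof -
  have d: "distr M M (S \<circ> T) = M"
    using distr_distr[OF mp_aut_measurable[OF assms(1)] mp_aut_measurable[OF assms(2)]] assms
    by (simp add: mp_aut_distr)
  have m: "S \<circ> T \<in> measurable M M" "minv M T \<circ> minv M S \<in> measurable M M"
    by (rule measurable_comp[OF mp_aut_measurable[OF assms(2)] mp_aut_measurable[OF assms(1)]],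
        rule measurable_comp[OF mp_aut_minv_measurable[OF assms(1)] mp_aut_minv_measurable[OF assms(2)]])
  note r = mp_autI[OF m _ _ d]
  show "S \<circ> T \<in> mp_automorphisms M"
    using assms by (intro r(1)) (auto simp: minv_left minv_right minv_space mp_aut_space)
  show "\<And>x. x \<in> space M \<Longrightarrow> minv M (S \<circ> T) x = minv M T (minv M S x)"
    using assms by (subst r(2)) (auto simp: minv_left minv_right minv_space mp_aut_space)
qed

lemma mp_aut_id: "id \<in> mp_automorphisms M" "(\<lambda>x. x) \<in> mp_automorphisms M"
  by (rule mp_autI(1)[where R = "\<lambda>x. x"]; simp add: id_def)+

lemma mp_aut_funpow: "U \<in> mp_automorphisms M \<Longrightarrow> (U ^^ n) \<in> mp_automorphisms M"
  by (induction n) (auto intro: mp_aut_id mp_aut_comp(1))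

lemma mp_aut_image:
  assumes "T \<in> mp_automorphisms M" "A \<subseteq> space M"
  shows "T ` A = minv M T -` A \<inter> space M"
  using assms by (auto simp: minv_left mp_aut_space image_iff subset_iff) (metis minv_right)

lemma mp_aut_vimage_measure:
  assumes "T \<in> mp_automorphisms M" "A \<in> sets M"
  shows "measure M (T -` A \<inter> space M) = measure M A"
  using measure_distr[OF mp_aut_measurable, of T M A] assms by (simp add: mp_aut_distr)

lemma mp_aut_image_sets:
  assumes "T \<in> mp_automorphisms M" "A \<in> sets M"
  shows "T ` A \<in> sets M" "measure M (T ` A) = measure M A"
  using mp_aut_vimage_measure[OF mp_aut_minv, of T M A]
    mp_aut_image[of T M A] assms sets.sets_into_space[of A M]
    measurable_sets[OF mp_aut_minv_measurable, of T M A] by auto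

lemma AE_mp_aut:
  assumes "T \<in> mp_automorphisms M" "AE x in M. P x" shows "AE x in M. P (T x)"
proof -
  have "AE x in distr M M T. P x" using assms(2) unfolding mp_aut_distr[OF assms(1)] .
  then show ?thesis by (rule AE_distrD[OF mp_aut_measurable[OF assms(1)]])
qed

lemma measure_mp_subst:
  assumes "T \<in> mp_automorphisms M" "{x\<in>space M. P x} \<in> sets M"
  shows "measure M {x\<in>space M. P (T x)} = measure M {x\<in>space M. P x}"
proof -
  have "{x\<in>space M. P (T x)} = T -` {x\<in>space M. P x} \<inter> space M"
    using assms by (auto simp: mp_aut_space)
  then show ?thesis using mp_aut_vimage_measure[OF assms] by simp
qed

text \<open>
  The images of the pieces \<open>{x. k x = i}\<close> are disjoint because the whole map is
  injective, so each piece contributes exactly its measure, and on the image of a piece the inverse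
  is the inverse of one \<open>W i\<close>.
\<close>

lemma mp_aut_piecewise:
  fixes k :: "'a \<Rightarrow> 'i::countable"
  assumes k: "k \<in> measurable M (count_space UNIV)"
    and W: "\<And>i. W i \<in> mp_automorphisms M"
    and b: "bij_betw (\<lambda>x. W (k x) x) (space M) (space M)"
  shows "(\<lambda>x. W (k x) x) \<in> mp_automorphisms M"
proof -
  let ?T = "\<lambda>x. W (k x) x"
  have m: "?T \<in> measurable M M"
    by (rule measurable_compose_countable[OF _ k]) (rule mp_aut_measurable[OF W])
  define E where "E i = k -` {i} \<inter> space M" for i
  have E: "E i \<in> sets M" for i unfolding E_def using k by (auto intro: measurable_sets)
  have WE: "W i ` E i \<in> sets M" for i using mp_aut_image_sets(1)[OF W E] .
  have inj: "inj_on ?T (space M)" and sur: "?T ` space M = space M" using b by (auto simp: bij_betw_def)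
  have Esp: "E i \<subseteq> space M" for i unfolding E_def by auto
  define R where "R = minv M ?T"
  define l where "l y = k (R y)" for y
  have Rsp: "R y \<in> space M" and TR: "?T (R y) = y" if "y \<in> space M" for y
    using that b the_inv_into_into[OF inj, of y "space M"] f_the_inv_into_f[OF inj, of y] sur
    unfolding R_def by auto
  have RT: "R (?T x) = x" if "x \<in> space M" for x
    using the_inv_into_f_f[OF inj that] unfolding R_def .
  have lE: "l -` {i} \<inter> space M = W i ` E i" for i
  proof (rule Set.set_eqI, rule iffI)
    fix y assume "y \<in> l -` {i} \<inter> space M"
    then have "R y \<in> E i" "y = W i (R y)" using Rsp[of y] TR[of y] by (auto simp: l_def E_def)
    then show "y \<in> W i ` E i" by blast
  next
    fix y assume "y \<in> W i ` E i"
    then obtain x where x: "x \<in> space M" "k x = i" "y = W i x" by (auto simp: E_def)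
    then have "R y = x" using RT[of x] by simp
    with x show "y \<in> l -` {i} \<inter> space M" using mp_aut_space[OF W] by (auto simp: l_def)
  qed
  have lm: "l \<in> measurable M (count_space UNIV)"
    unfolding measurable_count_space_eq2_countable by (auto simp: lE WE)
  have "R \<in> measurable M M"
  proof (subst measurable_cong)
    fix y assume y: "y \<in> space M"
    show "R y = minv M (W (l y)) y"
      using TR[OF y] minv_left[OF W, of "R y" "l y"] Rsp[OF y] by (simp add: l_def)
  next
    show "(\<lambda>y. minv M (W (l y)) y) \<in> measurable M M"
      by (rule measurable_compose_countable[OF _ lm]) (rule mp_aut_minv_measurable[OF W])
  qed
  moreover have "distr M M ?T = M"
  proof (rule measure_eqI)
    fix A assume "A \<in> sets (distr M M ?T)"
    then have A: "A \<in> sets M" by simp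
    have 1: "A = (\<Union>i. W i ` (W i -` A \<inter> E i))"
    proof (rule Set.set_eqI, rule iffI)
      fix y assume y: "y \<in> A"
      then have ys: "y \<in> space M" using sets.sets_into_space[OF A] by auto
      have "R y \<in> W (k (R y)) -` A \<inter> E (k (R y))" using Rsp[OF ys] TR[OF ys] y by (auto simp: E_def)
      then show "y \<in> (\<Union>i. W i ` (W i -` A \<inter> E i))" using TR[OF ys] by (metis UNIV_I UN_I imageI)
    qed auto
    have 2: "?T -` A \<inter> space M = (\<Union>i. W i -` A \<inter> E i)" by (auto simp: E_def)
    have mE: "W i -` A \<inter> E i \<in> sets M" for i
    proof -
      have "W i -` A \<inter> E i = (W i -` A \<inter> space M) \<inter> E i" using Esp[of i] by auto
      then show ?thesis using measurable_sets[OF mp_aut_measurable[OF W] A, of i] E[of i] by auto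
    qed
    have dj: "disjoint_family (\<lambda>i. W i ` (W i -` A \<inter> E i))"
      unfolding disjoint_family_on_def
    proof safe
      fix i j x y assume ij: "i \<noteq> j" and x: "W i x \<in> A" "x \<in> E i" and y: "W j y \<in> A" "y \<in> E j" and e: "W i x = W j y"
      then have "?T x = ?T y" "x \<in> space M" "y \<in> space M" by (auto simp: E_def)
      then have "x = y" using inj by (auto simp: inj_on_def)
      with x y ij show "W i x \<in> {}" by (auto simp: E_def)
    qed
    have em: "emeasure M (W i ` B) = emeasure M B" if "B \<in> sets M" for i B
    proof -
      have "emeasure M (W i ` B) = emeasure (distr M M (W i)) (W i ` B)" by (simp add: mp_aut_distr[OF W])
      also have "\<dots> = emeasure M (W i -` (W i ` B) \<inter> space M)"
        by (rule emeasure_distr[OF mp_aut_measurable[OF W] mp_aut_image_sets(1)[OF W that]])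
      also have "W i -` (W i ` B) \<inter> space M = B"
        using sets.sets_into_space[OF that] mp_aut_inj[OF W, of _ _ i] by auto
      finally show ?thesis .
    qed
    have "emeasure (distr M M ?T) A = emeasure M (?T -` A \<inter> space M)"
      using m A by (simp add: emeasure_distr)
    also have "\<dots> = (\<integral>\<^sup>+i. emeasure M (W i -` A \<inter> E i) \<partial>count_space UNIV)"
      unfolding 2 by (rule emeasure_UN_countable) (use mE in \<open>auto simp: disjoint_family_on_def E_def\<close>)
    also have "\<dots> = (\<integral>\<^sup>+i. emeasure M (W i ` (W i -` A \<inter> E i)) \<partial>count_space UNIV)"
      using em mE by simp
    also have "\<dots> = emeasure M (\<Union>i. W i ` (W i -` A \<inter> E i))"
      by (rule emeasure_UN_countable[symmetric]) (use mE mp_aut_image_sets(1)[OF W] dj in auto)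
    finally show "emeasure (distr M M ?T) A = emeasure M A" using 1 by simp
  qed simp
  ultimately show ?thesis using b m by (auto simp: mp_automorphisms_def R_def)
qed

section \<open>Coding a standard Borel space by real numbers\<close>

text \<open>
  Expansion in base 3 with digits 0 and 1 only. The gaps between the values make the digits readable
  from any sufficiently good approximation, which base 2 would not give.
\<close>

definition ternary :: "(nat \<Rightarrow> bool) \<Rightarrow> real" where
  "ternary f = (\<Sum>n. of_bool (f n) / 3 ^ Suc n)"

lemma ternary_tail:
  fixes u :: "nat \<Rightarrow> real"
  assumes u: "\<And>n. \<bar>u n\<bar> \<le> 1" and z: "\<And>k. k < m \<Longrightarrow> u k = 0"
  shows "summable (\<lambda>n. u n / 3 ^ Suc n)" "\<bar>\<Sum>n. u n / 3 ^ Suc n\<bar> \<le> 1 / (2 * 3 ^ m)"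
proof -
  have geo: "(\<lambda>n. (1/3) ^ n * (1 / 3 ^ Suc m) :: real) sums (1 / (1 - 1/3) * (1 / 3 ^ Suc m))"
    by (intro sums_mult2 geometric_sums) auto
  have bd: "norm (u (n + m) / 3 ^ Suc (n + m)) \<le> (1/3) ^ n * (1 / 3 ^ Suc m)" for n
    using u[of "n + m"] by (simp add: power_add field_simps abs_mult)
  have s1: "summable (\<lambda>n. u (n + m) / 3 ^ Suc (n + m))"
    by (rule summable_comparison_test'[OF sums_summable[OF geo]]) (use bd in auto)
  then show s: "summable (\<lambda>n. u n / 3 ^ Suc n)"
    by (subst (asm) summable_iff_shift[of "\<lambda>n. u n / 3 ^ Suc n"])
  have "(\<Sum>n. u n / 3 ^ Suc n) = (\<Sum>n. u (n + m) / 3 ^ Suc (n + m))"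
    using suminf_split_initial_segment[OF s, of m] z by simp
  moreover have "norm (\<Sum>n. u (n + m) / 3 ^ Suc (n + m)) \<le> (\<Sum>n. (1/3) ^ n * (1 / 3 ^ Suc m))"
    by (rule norm_suminf_le) (use bd sums_summable[OF geo] in auto)
  moreover have "(\<Sum>n. (1/3) ^ n * (1 / 3 ^ Suc m) :: real) = 1 / (2 * 3 ^ m)"
    using sums_unique[OF geo] by simp
  ultimately show "\<bar>\<Sum>n. u n / 3 ^ Suc n\<bar> \<le> 1 / (2 * 3 ^ m)" by simp
qed

lemma ternary_summable: "summable (\<lambda>n. of_bool (f n) / 3 ^ Suc n :: real)"
  by (rule ternary_tail(1)[where m = 0]) auto

lemma ternary_diff:
  "ternary f - ternary h = (\<Sum>n. (of_bool (f n) - of_bool (h n)) / 3 ^ Suc n)"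
  unfolding ternary_def
  using suminf_diff[OF ternary_summable[of f] ternary_summable[of h]]
  by (simp add: diff_divide_distrib del: power_Suc)

lemma ternary_close:
  assumes "\<And>k. k < m \<Longrightarrow> f k = h k" shows "\<bar>ternary f - ternary h\<bar> \<le> 1 / (2 * 3 ^ m)"
  unfolding ternary_diff by (rule ternary_tail(2)) (use assms in auto)

text \<open>
  At the first digit where the two sequences differ, the values differ by \<open>1 / 3 ^ Suc
  m\<close>, and all later digits together can compensate at most half of this.
\<close>

lemma ternary_digit:
  assumes "\<bar>ternary f - ternary h\<bar> < 1 / (2 * 3 ^ Suc n)" shows "f n = h n"
proof (rule ccontr)
  assume ne: "f n \<noteq> h n"
  obtain m where m: "f m \<noteq> h m" "\<And>k. k < m \<Longrightarrow> f k = h k" "m \<le> n"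
    using ne exists_least_iff[of "\<lambda>k. f k \<noteq> h k"] by (metis not_less)
  define h' where "h' = h(m := f m)"
  have "\<bar>ternary f - ternary h'\<bar> \<le> 1 / (2 * 3 ^ Suc m)"
    by (rule ternary_close) (use m in \<open>auto simp: h'_def less_Suc_eq\<close>)
  moreover have "\<bar>ternary h' - ternary h\<bar> = 1 / 3 ^ Suc m"
  proof -
    have "(\<lambda>n. (of_bool (h' n) - of_bool (h n)) / 3 ^ Suc n :: real) =
        (\<lambda>n. if n = m then (of_bool (f m) - of_bool (h m)) / 3 ^ Suc m else 0)"
      by (auto simp: h'_def)
    then have "ternary h' - ternary h = (of_bool (f m) - of_bool (h m)) / 3 ^ Suc m"
      unfolding ternary_diff
      using sums_unique[OF sums_single[of m "\<lambda>n. (of_bool (f m) - of_bool (h m)) / 3 ^ Suc m :: real"]]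
      by (simp del: power_Suc)
    then show ?thesis using m(1) by (cases "f m") auto
  qed
  ultimately have "1 / (2 * 3 ^ Suc m) \<le> \<bar>ternary f - ternary h\<bar>"
  proof -
    assume "\<bar>ternary f - ternary h'\<bar> \<le> 1 / (2 * 3 ^ Suc m)" "\<bar>ternary h' - ternary h\<bar> = 1 / 3 ^ Suc m"
    moreover have "(1::real) / 3 ^ Suc m = 2 * (1 / (2 * 3 ^ Suc m))" by simp
    ultimately show ?thesis by linarith
  qed
  moreover have "(1::real) / (2 * 3 ^ Suc n) \<le> 1 / (2 * 3 ^ Suc m)"
    using m(3) by (intro divide_left_mono mult_left_mono power_increasing) auto
  ultimately show False using assms by linarith
qed

lemma ternary_range: "0 \<le> ternary f" "ternary f < 1"
proof -
  show "0 \<le> ternary f" unfolding ternary_def by (rule suminf_nonneg[OF ternary_summable]) auto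
  have "\<bar>ternary f\<bar> \<le> 1 / (2 * 3 ^ 0)" unfolding ternary_def by (rule ternary_tail(2)) auto
  then show "ternary f < 1" by simp
qed

lemma (in prob_space) incseq_approx:
  assumes A: "\<And>i. A i \<in> events" "incseq A" and e: "e > 0"
  shows "\<exists>k. prob ((\<Union>i. A i) - A k) < e"
proof -
  have "(\<lambda>i. prob (A i)) \<longlonglongrightarrow> prob (\<Union>i. A i)"
    by (rule finite_Lim_measure_incseq) (use A in auto)
  then obtain k where "\<bar>prob (A k) - prob (\<Union>i. A i)\<bar> < e"
    using e by (metis LIMSEQ_D order_refl real_norm_def)
  moreover have "prob ((\<Union>i. A i) - A k) = prob (\<Union>i. A i) - prob (A k)"
    by (rule finite_measure_Diff) (use A in auto)
  ultimately show ?thesis by (intro exI[of _ k]) linarith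
qed

text \<open>
  A standard probability space is, up to a null set, a Borel subset of the line. The code
  \<open>g\<close> records membership in the countably many balls with centre in a dense sequence
  and radius \<open>1 / (m + 1)\<close>. It is injective, and the only difficulty is to find a
  conull set whose image under \<open>g\<close> is Borel.

  Completeness provides it. Let \<open>K\<close> be a set that is covered, for every radius, by
  finitely many of the balls, and on which each ball \<open>C n\<close> coincides with a closed
  subset \<open>F n l\<close>. If the codes of points of \<open>K\<close> converge, then each digit
  is eventually constant. A late point of the sequence lies in one of the finitely many balls of a
  given radius, and then so do all later points; so the sequence is Cauchy. The limit lies in the
  same sets \<open>F n l\<close>, so it belongs to \<open>K\<close> and has the limit code. Hence
  \<open>g ` K\<close> is closed, and such sets \<open>K\<close> can have measure arbitrarily close
  to 1.
\<close>

lemma standard_borel_coding: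
  fixes M :: "'a measure"
  assumes pM: "prob_space M" and std: "standard_borel M"
  obtains g :: "'a \<Rightarrow> real" and j :: "real \<Rightarrow> 'a"
  where "g \<in> borel_measurable M" "\<And>x. 0 \<le> g x" "\<And>x. g x < 1" "j \<in> measurable borel M"
    "AE x in M. j (g x) = x"
proof -
  interpret prob_space M by fact
  obtain X where X: "completely_metrizable_space X" "second_countable X" "topspace X = space M"
      "sets M = sigma_sets (space M) {U. openin X U}"
    using std unfolding standard_borel_def by blast
  obtain M' d where M': "Metric_space M' d" "Metric_space.mcomplete M' d" "X = Metric_space.mtopology M' d"
    using X(1) unfolding completely_metrizable_space_def by blast
  have "M' = space M" using X(3) M'(3) Metric_space.topspace_mtopology[OF M'(1)] by simp
  note M' = M'[unfolded this]
  interpret Metric_space "space M" d by (rule M'(1))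
  have openM: "U \<in> events" if "openin mtopology U" for U
    using X(4) M'(3) that by auto
  have closedM: "U \<in> events" if "closedin mtopology U" for U
  proof -
    have "space M - U \<in> events" using that openM by (auto simp: closedin_def)
    then have "space M - (space M - U) \<in> events" by (rule sets.compl_sets)
    moreover have "U \<subseteq> space M" using that by (auto simp: closedin_def)
    ultimately show ?thesis by (simp add: double_diff)
  qed
  obtain \<B> where \<B>: "countable \<B>" "\<And>V. V \<in> \<B> \<Longrightarrow> openin mtopology V"
      "\<And>U x. openin mtopology U \<Longrightarrow> x \<in> U \<Longrightarrow> \<exists>V\<in>\<B>. x \<in> V \<and> V \<subseteq> U"
    using X(2) M'(3) unfolding second_countable_def by (metis (no_types, lifting))
  obtain p0 where p0: "p0 \<in> space M" using not_empty by blast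
  define xs where "xs i = (let V = from_nat_into \<B> i in if V = {} then p0 else (SOME x. x \<in> V))" for i
  have \<B>ne: "\<B> \<noteq> {}" using \<B>(3)[of "space M" p0] p0 by auto
  have xs: "xs i \<in> space M" for i
  proof -
    have "from_nat_into \<B> i \<in> \<B>" using \<B>ne by (rule from_nat_into)
    then have "from_nat_into \<B> i \<subseteq> space M" using \<B>(2) openin_subset by fastforce
    then show ?thesis using p0 some_in_eq[of "from_nat_into \<B> i"] by (auto simp: xs_def Let_def)
  qed
  have dense: "\<exists>i. d (xs i) x < e" if "x \<in> space M" "e > 0" for x e
  proof -
    have "x \<in> mball x e" using that by simp
    from \<B>(3)[OF openin_mball this] obtain V where V: "V \<in> \<B>" "x \<in> V" "V \<subseteq> mball x e" by auto
    obtain i where i: "from_nat_into \<B> i = V" using from_nat_into_surj[OF \<B>(1) V(1)] by blast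
    have "(SOME x. x \<in> V) \<in> V" using V(2) by (metis some_in_eq empty_iff)
    then have "xs i \<in> V" using V(2) by (auto simp: xs_def i)
    then have "d x (xs i) < e" using V(3) by auto
    then show ?thesis using commute by auto
  qed
  define r where "r m = 1 / (real m + 1)" for m
  have r: "r m > 0" for m by (auto simp: r_def)
  have r_small: "\<exists>m. r m < e" if "e > 0" for e
    using reals_Archimedean[OF that] by (auto simp: r_def inverse_eq_divide add.commute)
  define C where "C n = mball (xs (fst (prod_decode n))) (r (snd (prod_decode n)))" for n
  define F where "F n l = mcball (xs (fst (prod_decode n))) (r (snd (prod_decode n)) - r l)" for n l
  have Copen: "openin mtopology (C n)" for n by (simp add: C_def)
  have Fclosed: "closedin mtopology (F n l)" for n l by (simp add: F_def)
  have [measurable]: "C n \<in> events" "F n l \<in> events" for n l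
    using openM Copen closedM Fclosed by auto
  have FC: "F n l \<subseteq> C n" for n l using r[of l] by (auto simp: F_def C_def)
  have UF: "(\<Union>l. F n l) = C n" for n
  proof
    show "C n \<subseteq> (\<Union>l. F n l)"
    proof
      fix x assume x: "x \<in> C n"
      then have "r (snd (prod_decode n)) - d (xs (fst (prod_decode n))) x > 0" by (auto simp: C_def)
      then obtain l where "r l < r (snd (prod_decode n)) - d (xs (fst (prod_decode n))) x" using r_small by blast
      then show "x \<in> (\<Union>l. F n l)" using x by (auto simp: F_def C_def intro!: exI[of _ l])
    qed
  qed (use FC in auto)
  have r_anti: "r (Suc l) \<le> r l" for l by (auto simp: r_def field_simps)
  have Finc: "incseq (F n)" for n
  proof (intro incseq_SucI subsetI)
    fix l x assume "x \<in> F n l"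
    then show "x \<in> F n (Suc l)" using r_anti[of l] by (auto simp: F_def)
  qed
  have Cbase: "\<exists>n. x \<in> C n \<and> C n \<subseteq> U" if U: "openin mtopology U" "x \<in> U" for x U
  proof -
    obtain e where e: "e > 0" "mball x e \<subseteq> U" using U by (auto simp: openin_mtopology)
    have xsp: "x \<in> space M" using U openin_subset by fastforce
    obtain m where m: "r m < e / 2" using r_small[of "e/2"] e by auto
    obtain i where i: "d (xs i) x < r m" using dense[OF xsp r] by blast
    have "mball (xs i) (r m) \<subseteq> mball x e"
      using i m xs[of i] xsp by (intro mball_subset) (auto simp: commute)
    then show ?thesis using i xs xsp e by (intro exI[of _ "prod_encode (i, m)"]) (auto simp: C_def)
  qed
  define g where "g x = ternary (\<lambda>n. x \<in> C n)" for x
  have gm: "g \<in> borel_measurable M"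
  proof -
    have "g = (\<lambda>x. \<Sum>n. indicator (C n) x / 3 ^ Suc n)"
      unfolding g_def ternary_def by (intro ext arg_cong[where f = suminf]) (auto simp: indicator_def)
    then show ?thesis by simp
  qed
  have g_eq: "x = y" if "x \<in> space M" "y \<in> space M" "g x = g y" for x y
  proof (rule ccontr)
    assume "x \<noteq> y"
    then have "x \<in> mball x (d x y)" using that by auto
    then obtain n where "x \<in> C n" "C n \<subseteq> mball x (d x y)" using Cbase[of "mball x (d x y)" x] by auto
    moreover have "x \<in> C n \<longleftrightarrow> y \<in> C n"
      using ternary_digit[of "\<lambda>n. x \<in> C n" "\<lambda>n. y \<in> C n" n] that by (simp add: g_def)
    ultimately show False by auto
  qed
  define N1 where "N1 m k = space M - (\<Union>i<k. mball (xs i) (r m))" for m k :: nat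
  have "\<exists>k. prob (N1 m k) < e" if "e > 0" for m e
  proof -
    have "(\<Union>k. \<Union>i<k. mball (xs i) (r m)) = space M"
    proof (intro equalityI subsetI)
      fix x assume x: "x \<in> space M"
      then obtain i where "d (xs i) x < r m" using dense[OF x r[of m]] by auto
      then have "x \<in> mball (xs i) (r m)" "i < Suc i" using x xs by auto
      then show "x \<in> (\<Union>k. \<Union>i<k. mball (xs i) (r m))" by blast
    qed (use mball_subset_mspace in auto)
    moreover have "incseq (\<lambda>k. \<Union>i<k. mball (xs i) (r m))"
      by (intro incseq_SucI UN_mono) auto
    moreover have "(\<Union>i<k. mball (xs i) (r m)) \<in> events" for k
      by (intro sets.finite_UN) (auto intro: openM)
    ultimately show ?thesis using incseq_approx[of "\<lambda>k. \<Union>i<k. mball (xs i) (r m)" e] that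
      by (auto simp: N1_def)
  qed
  then have "\<exists>k. \<forall>p m. prob (N1 m (k p m)) < 1 / (real p + 1) * (1/2) ^ Suc m"
    by (intro choice allI) auto
  then obtain k where k: "\<And>p m. prob (N1 m (k p m)) < 1 / (real p + 1) * (1/2) ^ Suc m" by blast
  have "\<exists>l. prob (C n - F n l) < e" if "e > 0" for n e
    using incseq_approx[of "F n" e] Finc that by (auto simp: UF)
  then have "\<exists>l. \<forall>p n. prob (C n - F n (l p n)) < 1 / (real p + 1) * (1/2) ^ Suc n"
    by (intro choice allI) auto
  then obtain l where l: "\<And>p n. prob (C n - F n (l p n)) < 1 / (real p + 1) * (1/2) ^ Suc n" by blast
  \<comment> \<open>The errors allowed in the choice of \<open>k\<close> and \<open>l\<close> sum up to at most \<open>2 / (p + 1)\<close>.\<close>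
  define K where "K p = {x\<in>space M. (\<forall>m. \<exists>i<k p m. x \<in> mball (xs i) (r m)) \<and>
      (\<forall>n. x \<in> F n (l p n) \<or> x \<notin> C n)}" for p
  have N1m [measurable]: "N1 m q \<in> events" for m q
    unfolding N1_def by (intro sets.compl_sets sets.finite_UN) (auto intro: openM)
  have Kco: "space M - K p = (\<Union>m. N1 m (k p m)) \<union> (\<Union>n. C n - F n (l p n))" for p
    unfolding K_def N1_def using mball_subset_mspace by (auto 0 3 simp: C_def)
  have Ksp: "K p \<subseteq> space M" for p by (auto simp: K_def)
  have Km [measurable]: "K p \<in> events" for p
  proof -
    have "space M - (space M - K p) \<in> events" unfolding Kco by (intro sets.compl_sets) measurable
    then show ?thesis using Ksp by (simp add: double_diff)
  qed
  have Kmeas: "prob (space M - K p) \<le> 2 / (real p + 1)" for p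
  proof -
    have geo: "(\<lambda>n. 1 / (real p + 1) * (1/2) ^ Suc n) sums (1 / (real p + 1) * 1)"
      by (intro sums_mult power_half_series)
    have *: "prob (\<Union>n. B n) \<le> 1 / (real p + 1)"
      if B: "\<And>n. B n \<in> events" "\<And>n. prob (B n) < 1 / (real p + 1) * (1/2) ^ Suc n" for B
    proof -
      have s: "summable (\<lambda>n. prob (B n))"
        by (rule summable_comparison_test'[OF sums_summable[OF geo]]) (use B less_imp_le in auto)
      have "prob (\<Union>n. B n) \<le> (\<Sum>n. prob (B n))"
        by (rule finite_measure_subadditive_countably) (use B s in auto)
      also have "\<dots> \<le> (\<Sum>n. 1 / (real p + 1) * (1/2) ^ Suc n)"
        by (rule suminf_le[OF _ s sums_summable[OF geo]]) (use B less_imp_le in auto)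
      finally show ?thesis using sums_unique[OF geo] by simp
    qed
    have "prob (space M - K p) \<le> prob (\<Union>m. N1 m (k p m)) + prob (\<Union>n. C n - F n (l p n))"
      unfolding Kco by (rule measure_Un_le) auto
    then show ?thesis using *[of "\<lambda>m. N1 m (k p m)"] *[of "\<lambda>n. C n - F n (l p n)"] k l by auto
  qed
  have gK: "closed (g ` K p)" for p
    unfolding closed_sequential_limits
  proof (intro allI impI, elim conjE)
    fix ys y assume ys: "\<forall>n. ys n \<in> g ` K p" "ys \<longlonglongrightarrow> y"
    then have "\<forall>n. \<exists>u. u \<in> K p \<and> g u = ys n" by (metis imageE)
    then obtain u where u: "\<And>n. u n \<in> K p" "\<And>n. g (u n) = ys n" by metis
    have usp: "u n \<in> space M" for n using u Ksp by auto
    have "\<exists>n0. \<forall>n\<ge>n0. \<forall>n'\<ge>n0. u n \<in> C j \<longleftrightarrow> u n' \<in> C j" for j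
    proof -
      have "Cauchy ys" using ys(2) by (rule LIMSEQ_imp_Cauchy)
      then obtain n0 where "\<And>n n'. n \<ge> n0 \<Longrightarrow> n' \<ge> n0 \<Longrightarrow> \<bar>ys n - ys n'\<bar> < 1 / (2 * 3 ^ Suc j)"
        unfolding Cauchy_iff using zero_less_power[of "3::real" "Suc j"]
        by (metis real_norm_def divide_pos_pos mult_pos_pos zero_less_numeral zero_less_one)
      then have "u n \<in> C j \<longleftrightarrow> u n' \<in> C j" if "n \<ge> n0" "n' \<ge> n0" for n n'
        using ternary_digit[of "\<lambda>k. u n \<in> C k" "\<lambda>k. u n' \<in> C k" j] that u(2) by (simp add: g_def)
      then show ?thesis by blast
    qed
    then obtain n0 where n0: "\<And>j n n'. n \<ge> n0 j \<Longrightarrow> n' \<ge> n0 j \<Longrightarrow> u n \<in> C j \<longleftrightarrow> u n' \<in> C j" by metis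
    have "MCauchy u"
      unfolding MCauchy_def
    proof (intro conjI allI impI)
      show "range u \<subseteq> space M" using usp by auto
      fix e :: real assume "e > 0"
      then obtain m where m: "r m < e / 2" using r_small[of "e/2"] by auto
      define N where "N = Max ((\<lambda>i. n0 (prod_encode (i, m))) ` {..k p m})"
      have "u N \<in> K p" by (rule u)
      then obtain i where i: "i < k p m" "u N \<in> mball (xs i) (r m)" by (auto simp: K_def)
      have Ni: "n0 (prod_encode (i, m)) \<le> N" unfolding N_def using i by (intro Max_ge) auto
      have ball: "u n \<in> mball (xs i) (r m)" if "n \<ge> N" for n
        using n0[of "prod_encode (i, m)" n N] Ni that i(2) by (auto simp: C_def)
      have "d (u n) (u n') < e" if "n \<ge> N" "n' \<ge> N" for n n'
        using triangle''[of "u n" "xs i" "u n'"] ball[OF that(1)] ball[OF that(2)] m usp xs by auto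
      then show "\<exists>N. \<forall>n n'. N \<le> n \<longrightarrow> N \<le> n' \<longrightarrow> d (u n) (u n') < e" by blast
    qed
    then obtain v where v: "limitin mtopology u v sequentially" using M'(2) unfolding mcomplete_def by blast
    then have vsp: "v \<in> space M" using limitin_mspace by blast
    have vC: "v \<in> C j \<longleftrightarrow> u n \<in> C j" and vF: "v \<in> F j (l p j) \<or> v \<notin> C j" if n: "n \<ge> n0 j" for n j
    proof -
      have a: "v \<in> F j (l p j)" if "u n \<in> C j"
      proof (rule limitin_closedin[OF v Fclosed])
        show "\<forall>\<^sub>F x in sequentially. u x \<in> F j (l p j)"
          unfolding eventually_sequentially
        proof (intro exI[of _ "n0 j"] allI impI)
          fix x assume "x \<ge> n0 j"
          then have "u x \<in> C j" using n0[of j x n] n that by blast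
          then show "u x \<in> F j (l p j)" using u(1)[of x] by (auto simp: K_def)
        qed
      qed auto
      have b: "u n \<in> C j" if "v \<in> C j"
      proof -
        have "\<forall>\<^sub>F x in sequentially. u x \<in> C j"
          using v Copen that unfolding limitin_def by blast
        then obtain x0 where "\<And>x. x \<ge> x0 \<Longrightarrow> u x \<in> C j" by (auto simp: eventually_sequentially)
        then have "u (max x0 (n0 j)) \<in> C j" by auto
        then show ?thesis using n0[of j n "max x0 (n0 j)"] n by auto
      qed
      show "v \<in> C j \<longleftrightarrow> u n \<in> C j" "v \<in> F j (l p j) \<or> v \<notin> C j" using a b FC by blast+
    qed
    have vball: "\<exists>i<k p m. v \<in> mball (xs i) (r m)" for m
    proof -
      define N where "N = Max ((\<lambda>i. n0 (prod_encode (i, m))) ` {..k p m})"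
      have "u N \<in> K p" by (rule u)
      then obtain i where i: "i < k p m" "u N \<in> mball (xs i) (r m)" by (auto simp: K_def)
      have Ni: "n0 (prod_encode (i, m)) \<le> N" unfolding N_def using i by (intro Max_ge) auto
      then have "v \<in> mball (xs i) (r m)" using vC[OF Ni] i by (auto simp: C_def)
      then show ?thesis using i by blast
    qed
    have "v \<in> K p" unfolding K_def using vsp vball vF by blast
    moreover have "ys \<longlonglongrightarrow> g v"
    proof (rule LIMSEQ_I)
      fix e :: real assume e: "e > 0"
      obtain m where m: "(1/3) ^ m < e" using real_arch_pow_inv[OF e, of "1/3"] by auto
      define N where "N = Max (n0 ` {..m})"
      have Nn: "n0 j \<le> N" if "j \<le> m" for j unfolding N_def using that by (intro Max_ge) auto
      have "norm (ys n - g v) < e" if "n \<ge> N" for n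
      proof -
        have "\<bar>g (u n) - g v\<bar> \<le> 1 / (2 * 3 ^ m)"
          unfolding g_def
        proof (rule ternary_close)
          fix k assume "k < m"
          then have "n0 k \<le> n" using Nn[of k] that by linarith
          then show "u n \<in> C k \<longleftrightarrow> v \<in> C k" using vC by blast
        qed
        also have "\<dots> \<le> (1/3) ^ m" by (simp add: power_one_over field_simps)
        finally show ?thesis using m u by simp
      qed
      then show "\<exists>no. \<forall>n\<ge>no. norm (ys n - g v) < e" by blast
    qed
    then have "g v = y" using ys(2) LIMSEQ_unique by blast
    ultimately show "y \<in> g ` K p" by blast
  qed
  define Z where "Z = (\<Union>p. K p)"
  have Zm: "Z \<in> events" unfolding Z_def by measurable
  have Zsp: "Z \<subseteq> space M" using Ksp by (auto simp: Z_def)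
  have AEZ: "AE x in M. x \<in> Z"
  proof -
    have "prob (space M - Z) \<le> 2 / (real p + 1)" for p
    proof -
      have "prob (space M - Z) \<le> prob (space M - K p)"
        by (rule finite_measure_mono) (auto simp: Z_def)
      then show ?thesis using Kmeas[of p] by linarith
    qed
    moreover have "(\<lambda>p. 2 / (real p + 1)) \<longlonglongrightarrow> 0" by real_asymp
    ultimately have "prob (space M - Z) \<le> 0" by (intro LIMSEQ_le_const) auto
    then have "prob (space M - Z) = 0" using measure_nonneg[of M "space M - Z"] by linarith
    then have "space M - Z \<in> null_sets M" using Zm by (auto simp: null_sets_def emeasure_eq_measure)
    then show ?thesis by (rule AE_I') auto
  qed
  define Y where "Y = g ` Z"
  have Ym [measurable]: "Y \<in> sets borel"
  proof -
    have "Y = (\<Union>p. g ` K p)" by (auto simp: Y_def Z_def)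
    then show ?thesis using borel_closed[OF gK] by auto
  qed
  define j where "j y = (if y \<in> Y then inv_into Z g y else p0)" for y
  have ginj: "inj_on g Z" using g_eq Zsp by (auto simp: inj_on_def)
  have jg: "j (g x) = x" if "x \<in> Z" for x
    using that ginj by (auto simp: j_def Y_def inv_into_f_f)
  \<comment> \<open>Codes closer than \<open>1 / (2 * 3 ^ Suc n)\<close> agree in digit \<open>n\<close>, so the points of \<open>Y\<close> that
    decode into \<open>C n\<close> are those near the code of a point of \<open>C n\<close>: an open condition.\<close>
  have jC: "j -` C n = Y \<inter> (\<Union>x\<in>C n. ball (g x) (1 / (2 * 3 ^ Suc n))) \<union> (if p0 \<in> C n then - Y else {})" (is "?L = ?R") for n
  proof (rule Set.set_eqI)
    fix y
    show "y \<in> ?L \<longleftrightarrow> y \<in> ?R"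
    proof (cases "y \<in> Y")
      case True
      then obtain x where x: "x \<in> Z" "y = g x" by (auto simp: Y_def)
      have dg: "x' \<in> C n \<longleftrightarrow> x \<in> C n" if "dist (g x') (g x) < 1 / (2 * 3 ^ Suc n)" for x'
        by (rule ternary_digit) (use that in \<open>simp add: g_def dist_real_def\<close>)
      have "x \<in> C n \<longleftrightarrow> y \<in> (\<Union>x\<in>C n. ball (g x) (1 / (2 * 3 ^ Suc n)))"
      proof
        assume "x \<in> C n"
        then show "y \<in> (\<Union>x\<in>C n. ball (g x) (1 / (2 * 3 ^ Suc n)))"
          unfolding x(2) by (intro UN_I[of x]) auto
      next
        assume "y \<in> (\<Union>x\<in>C n. ball (g x) (1 / (2 * 3 ^ Suc n)))"
        then obtain x' where x': "x' \<in> C n" "dist (g x') (g x) < 1 / (2 * 3 ^ Suc n)"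
          unfolding x(2) UN_iff mem_ball by (rule bexE)
        then show "x \<in> C n" using dg[OF x'(2)] by (rule_tac iffD1)
      qed
      moreover have "y \<in> ?L \<longleftrightarrow> x \<in> C n" using jg[OF x(1)] by (simp add: x(2))
      moreover have "y \<in> ?R \<longleftrightarrow> y \<in> (\<Union>x\<in>C n. ball (g x) (1 / (2 * 3 ^ Suc n)))"
        using True by (simp del: UN_iff mem_ball)
      ultimately show ?thesis by (simp only:)
    next
      case False then show ?thesis by (auto simp: j_def)
    qed
  qed
  have jCm: "j -` C n \<in> sets borel" for n
  proof -
    have "open (\<Union>x\<in>C n. ball (g x) (1 / (2 * 3 ^ Suc n)))" by auto
    then show ?thesis unfolding jC by (intro sets.Un sets.Int Ym) (auto intro: borel_open)
  qed
  have "j \<in> measurable borel M"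
  proof (rule measurable_sigma_sets[OF X(4)])
    show "{U. openin X U} \<subseteq> Pow (space M)" using X(3) openin_subset by fastforce
    show "j \<in> space borel \<rightarrow> space M"
    proof
      fix y :: real
      show "j y \<in> space M"
      proof (cases "y \<in> Y")
        case True
        then obtain x where "x \<in> Z" "y = g x" by (auto simp: Y_def)
        then show ?thesis using jg[of x] Zsp by auto
      qed (simp add: j_def p0)
    qed
    fix U assume "U \<in> {U. openin X U}"
    then have U: "openin mtopology U" using M'(3) by simp
    have "j -` U \<inter> space borel = (\<Union>n\<in>{n. C n \<subseteq> U}. j -` C n)"
    proof (intro equalityI subsetI)
      fix y assume "y \<in> j -` U \<inter> space borel"
      then have "j y \<in> U" by simp
      from Cbase[OF U this] show "y \<in> (\<Union>n\<in>{n. C n \<subseteq> U}. j -` C n)" by auto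
    qed auto
    then show "j -` U \<inter> space borel \<in> sets borel" using jCm by auto
  qed
  moreover have "AE x in M. j (g x) = x" using AEZ jg by auto
  ultimately show ?thesis using that[of g j] gm ternary_range by (auto simp: g_def)
qed

section \<open>Realizing prescribed labels by an automorphism\<close>

definition unif01 :: "real measure" where
  "unif01 = distr (restrict_space lborel {0<..<1}) borel (\<lambda>x. x)"

lemma unif01_interval: "measure unif01 {a..b} \<le> \<bar>b - a\<bar>"
proof -
  have "measure unif01 {a..b} = measure (restrict_space lborel {0<..<1}) ({a..b} \<inter> {0<..<1::real})"
    unfolding unif01_def
    by (subst measure_distr) (auto simp: space_restrict_space intro: measurable_restrict_space1)
  also have "\<dots> = measure lborel ({a..b} \<inter> {0<..<1::real})"
    by (subst measure_restrict_space) auto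
  also have "\<dots> \<le> measure lborel {a..b}"
    by (rule measure_mono_fmeasurable) (auto simp: fmeasurable_def emeasure_lborel_Icc_eq)
  also have "\<dots> \<le> \<bar>b - a\<bar>" by (cases "a \<le> b") auto
  finally show ?thesis .
qed

context prob_space
begin

text \<open>
  An isomorphism modulo null sets becomes a genuine bijection when it is restricted to the conull
  set of points whose full orbit under \<open>f\<close> and \<open>h\<close> avoids the exceptional
  set, and extended by the identity.
\<close>

lemma mod0_iso_extend:
  assumes f [measurable]: "f \<in> measurable M M" and h [measurable]: "h \<in> measurable M M"
    and df: "distr M M f = M" and dh: "distr M M h = M"
    and hf: "AE x in M. h (f x) = x" and fh: "AE x in M. f (h x) = x"
  shows "\<exists>T\<in>mp_automorphisms M. AE x in M. T x = f x"
proof -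
  have AEf: "AE x in M. P (f x)" if "AE x in M. P x" for P
    by (rule AE_distrD[OF f]) (simp only: df that)
  have AEh: "AE x in M. P (h x)" if "AE x in M. P x" for P
    by (rule AE_distrD[OF h]) (simp only: dh that)
  have "AE x in M. h (f x) = x \<and> f (h x) = x" using hf fh by auto
  then obtain N where N: "{x\<in>space M. \<not> (h (f x) = x \<and> f (h x) = x)} \<subseteq> N" "emeasure M N = 0" "N \<in> sets M"
    by (rule AE_E)
  define D where "D = space M - N"
  have D [measurable]: "D \<in> sets M" and Dsp: "D \<subseteq> space M" using N by (auto simp: D_def)
  have Dhf: "h (f x) = x" "f (h x) = x" if "x \<in> D" for x using that N(1) by (auto simp: D_def)
  have AED: "AE x in M. x \<in> D"
    using AE_not_in[of N M] N AE_space by (auto simp: D_def null_sets_def)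
  have AEfn: "AE x in M. (f ^^ n) x \<in> D" for n
  proof (induction n)
    case (Suc n) then show ?case using AEf[of "\<lambda>x. (f ^^ n) x \<in> D"] by (simp add: funpow_swap1)
  qed (use AED in simp)
  have AEhn: "AE x in M. (h ^^ n) x \<in> D" for n
  proof (induction n)
    case (Suc n) then show ?case using AEh[of "\<lambda>x. (h ^^ n) x \<in> D"] by (simp add: funpow_swap1)
  qed (use AED in simp)
  define X0 where "X0 = {x\<in>space M. \<forall>n. (f ^^ n) x \<in> D \<and> (h ^^ n) x \<in> D}"
  have fnm [measurable]: "(f ^^ n) \<in> measurable M M" "(h ^^ n) \<in> measurable M M" for n
    by (induction n) (auto intro!: measurable_comp[OF _ f] measurable_comp[OF _ h] measurable_ident simp: id_def)
  have X0m [measurable]: "X0 \<in> sets M" unfolding X0_def by measurable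
  have AEX0: "AE x in M. x \<in> X0"
    unfolding X0_def using AEfn AEhn by (auto simp: AE_all_countable)
  have X0D: "x \<in> D" if "x \<in> X0" for x using that unfolding X0_def by (auto dest: spec[of _ 0])
  have fX0: "f x \<in> X0" if x: "x \<in> X0" for x
  proof -
    have "(f ^^ n) (f x) \<in> D" for n using x unfolding X0_def by (auto dest: spec[of _ "Suc n"] simp: funpow_swap1)
    moreover have "(h ^^ n) (f x) \<in> D" for n
    proof (cases n)
      case 0 then show ?thesis using x unfolding X0_def by (auto dest: spec[of _ "Suc 0"])
    next
      case (Suc k) then show ?thesis using x X0D[OF x] Dhf unfolding X0_def by (auto simp: funpow_swap1)
    qed
    moreover have "f x \<in> space M" using x measurable_space[OF f] by (auto simp: X0_def)
    ultimately show ?thesis by (auto simp: X0_def)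
  qed
  have hX0: "h x \<in> X0" if x: "x \<in> X0" for x
  proof -
    have "(h ^^ n) (h x) \<in> D" for n using x unfolding X0_def by (auto dest: spec[of _ "Suc n"] simp: funpow_swap1)
    moreover have "(f ^^ n) (h x) \<in> D" for n
    proof (cases n)
      case 0 then show ?thesis using x unfolding X0_def by (auto dest: spec[of _ "Suc 0"])
    next
      case (Suc k) then show ?thesis using x X0D[OF x] Dhf unfolding X0_def by (auto simp: funpow_swap1)
    qed
    moreover have "h x \<in> space M" using x measurable_space[OF h] by (auto simp: X0_def)
    ultimately show ?thesis by (auto simp: X0_def)
  qed
  define T where "T x = (if x \<in> X0 then f x else x)" for x
  define R where "R x = (if x \<in> X0 then h x else x)" for x
  have Tm: "T \<in> measurable M M" and Rm: "R \<in> measurable M M" unfolding T_def R_def by measurable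
  have AET: "AE x in M. T x = f x" using AEX0 by (auto simp: T_def)
  have "distr M M T = distr M M f"
    by (rule distr_cong_AE) (use AET Tm in auto)
  then have "T \<in> mp_automorphisms M"
    using Dhf[OF X0D] fX0 hX0 by (intro mp_autI(1)[OF Tm Rm]) (auto simp: T_def R_def df)
  with AET show ?thesis by blast
qed

text \<open>
  Up to a null set the level set is contained in \<open>{j c}\<close>. If it had positive measure,
  non-atomicity would split it into two parts of positive measure, and both would contain \<open>j
  c\<close>.
\<close>

lemma level_null:
  fixes g :: "'a \<Rightarrow> real"
  assumes na: "non_atomic M" and g [measurable]: "g \<in> borel_measurable M" and jg: "AE x in M. j (g x) = x"
  shows "prob {x\<in>space M. g x = c} = 0"
proof (rule ccontr)
  let ?A = "{x\<in>space M. g x = c}"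
  assume "prob ?A \<noteq> 0"
  then have "0 < prob ?A" by (simp add: zero_less_measure_iff)
  moreover have A: "?A \<in> events" by measurable
  ultimately obtain B where B: "B \<in> events" "B \<subseteq> ?A" "0 < prob B" "prob B < prob ?A"
    using na unfolding non_atomic_def by blast
  have ex: "\<exists>x\<in>E. j (g x) = x" if E: "E \<in> events" "0 < prob E" for E
  proof (rule ccontr)
    assume "\<not> ?thesis"
    then have "AE x in M. x \<notin> E" using jg by auto
    then have "prob E = 0" using E by (simp add: prob_eq_0)
    then show False using E by simp
  qed
  have "prob (?A - B) > 0" using B A finite_measure_Diff[of ?A B] by simp
  then obtain y where y: "y \<in> ?A - B" "j (g y) = y" using ex[of "?A - B"] A B by auto
  obtain x where x: "x \<in> B" "j (g x) = x" using ex[of B] B by auto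
  have "g x = c" "g y = c" using x y B by auto
  then have "x = y" using x y by simp
  then show False using x y by simp
qed

text \<open>
  The distribution function of \<open>q + g\<close> turns the space into the unit interval. As
  \<open>g\<close> takes values in \<open>[0,1)\<close>, the order of \<open>q + g\<close> is
  lexicographic, so the points with label \<open>i\<close> are mapped to an interval whose end
  points are the probabilities of \<open>q < i\<close> and of \<open>q < Suc i\<close>.
\<close>

lemma labelled_uniformization:
  fixes g :: "'a \<Rightarrow> real" and q :: "'a \<Rightarrow> nat"
  assumes na: "non_atomic M" and g [measurable]: "g \<in> borel_measurable M" and g01: "\<And>x. 0 \<le> g x" "\<And>x. g x < 1"
    and j [measurable]: "j \<in> measurable borel M" and jg: "AE x in M. j (g x) = x"
    and q [measurable]: "q \<in> measurable M (count_space UNIV)"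
  obtains H J where "H \<in> borel_measurable M" "J \<in> measurable borel M" "distr M borel H = unif01"
    "AE x in M. J (H x) = x" "AE u in unif01. H (J u) = u"
    "\<And>x i. x \<in> space M \<Longrightarrow> q x < i \<Longrightarrow> H x \<le> prob {y\<in>space M. q y < i}"
    "\<And>x i. x \<in> space M \<Longrightarrow> i \<le> q x \<Longrightarrow> prob {y\<in>space M. q y < i} \<le> H x"
proof -
  define h where "h x = real (q x) + g x" for x
  have h [measurable]: "h \<in> borel_measurable M" unfolding h_def by measurable
  have frac_h: "frac (h x) = g x" for x
    using g01[of x] frac_unique_iff[of "h x" "g x"] by (simp add: h_def)
  define P where "P = distr M borel h"
  have "prob_space P" unfolding P_def by (rule prob_space_distr) measurable
  then interpret P: cdf_distribution P
    by (intro cdf_distribution.intro) (auto simp: real_distribution_def real_distribution_axioms_def P_def)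
  define F where "F = cdf P"
  have Fh: "F (h x) = prob {y\<in>space M. h y \<le> h x}" for x
    unfolding F_def cdf_def P_def by (subst measure_distr) (auto intro!: arg_cong[where f = prob])
  have Fm [measurable]: "F \<in> borel_measurable borel" unfolding F_def by (rule P.measurable_C)
  define I where "I u = (if u \<in> {0<..<1} then P.I u else 0)" for u
  have Im [measurable]: "I \<in> borel_measurable borel"
  proof -
    have "P.I \<in> borel_measurable (restrict_space borel {0<..<1})" by (rule P.measurable_CI)
    then show ?thesis unfolding I_def by (subst (asm) measurable_restrict_space_iff) auto
  qed
  have Psing: "measure P {y} = 0" for y
  proof -
    have "measure P {y} = prob {x\<in>space M. h x = y}"
      unfolding P_def by (subst measure_distr) (auto intro!: arg_cong[where f = prob])
    also have "\<dots> \<le> prob {x\<in>space M. g x = frac y}"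
      by (rule finite_measure_mono) (use frac_h in auto)
    finally show ?thesis using level_null[OF na g jg, of "frac y"] measure_nonneg[of P "{y}"] by linarith
  qed
  have FI: "F (I u) = u" if u: "u \<in> {0<..<1}" for u
  proof (rule antisym)
    have "(F \<longlongrightarrow> F (I u)) (at_left (I u))"
      using P.isCont_cdf[of "I u"] Psing unfolding F_def isCont_def
      by (auto intro: tendsto_mono[OF at_le])
    moreover have "\<forall>\<^sub>F x in at_left (I u). F x \<le> u"
      unfolding eventually_at_filter
    proof (intro always_eventually allI impI)
      fix x assume "x \<in> {..<I u}"
      then have "\<not> P.I u \<le> x" using u by (simp add: I_def)
      then show "F x \<le> u" using P.pseudoinverse[of u x] u by (auto simp: F_def)
    qed
    ultimately show "F (I u) \<le> u" by (intro tendsto_upperbound[of F "F (I u)" "at_left (I u)" u]) auto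
    show "u \<le> F (I u)" using P.pseudoinverse[of u "I u"] u by (auto simp: F_def I_def)
  qed
  let ?U = "restrict_space lborel {0<..<1::real}"
  have Um: "I \<in> measurable ?U borel" by (intro measurable_restrict_space1) measurable
  have PI: "P = distr ?U borel I"
    using P.distr_I_eq_M by (metis (no_types, lifting) distr_cong I_def space_restrict_space Int_iff space_borel)
  define H where "H x = F (h x)" for x
  define J where "J u = j (frac (I u))" for u
  have Hm [measurable]: "H \<in> borel_measurable M" unfolding H_def by measurable
  have Jm [measurable]: "J \<in> measurable borel M" unfolding J_def frac_def by measurable
  have dH: "distr M borel H = unif01"
  proof -
    have "distr M borel H = distr P borel F"
      unfolding P_def by (subst distr_distr) (auto simp: comp_def H_def[abs_def])
    also have "\<dots> = distr ?U borel (F \<circ> I)"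
      unfolding PI using Um by (subst distr_distr) auto
    also have "\<dots> = unif01"
      unfolding unif01_def by (rule distr_cong) (auto simp: FI space_restrict_space)
    finally show ?thesis .
  qed
  have "AE u in ?U. I (F (I u)) = I u" by (rule AE_I2) (simp add: FI space_restrict_space)
  then have "AE y in P. I (F y) = y" unfolding PI by (subst AE_distr_iff[OF Um]) auto
  then have "AE x in M. I (F (h x)) = h x" unfolding P_def by (rule AE_distrD[OF h])
  with jg have JH: "AE x in M. J (H x) = x" by (auto simp: J_def H_def frac_h)
  have "AE x in M. H (J (H x)) = H x" using JH by auto
  then have HJ: "AE u in unif01. H (J u) = u"
    unfolding dH[symmetric] by (subst AE_distr_iff) (auto simp del: distr_id2)
  have up: "H x \<le> prob {y\<in>space M. q y < i}" if "x \<in> space M" "q x < i" for x i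
  proof -
    have hx: "h x < real i" using that(2) g01(2)[of x] by (simp add: h_def)
    have "q y < i" if "h y \<le> h x" for y
    proof -
      have "real (q y) < real i" using that hx g01(1)[of y] by (simp add: h_def)
      then show ?thesis by simp
    qed
    then show ?thesis unfolding H_def Fh by (intro finite_measure_mono) auto
  qed
  have lo: "prob {y\<in>space M. q y < i} \<le> H x" if "x \<in> space M" "i \<le> q x" for x i
  proof -
    have "h y \<le> h x" if "q y < i" for y
    proof -
      have "q y + 1 \<le> q x" using that \<open>i \<le> q x\<close> by simp
      then have "real (q y) + 1 \<le> real (q x)" by (metis of_nat_1 of_nat_add of_nat_le_iff)
      then show ?thesis using g01(2)[of y] g01(1)[of x] by (simp add: h_def)
    qed
    then show ?thesis unfolding H_def Fh by (intro finite_measure_mono) auto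
  qed
  show ?thesis by (rule that[OF Hm Jm dH JH HJ up lo])
qed

text \<open>
  Uniformize the space once according to \<open>q\<close> and once according to \<open>c\<close>,
  and let \<open>T\<close> identify the two intervals. A point can change its label only if it lies
  between corresponding end points \<open>\<alpha> i\<close> and \<open>\<beta> i\<close> of the two
  partitions of the interval.
\<close>

lemma realize_numbered_labels:
  fixes q c :: "'a \<Rightarrow> nat"
  assumes std: "standard_borel M" and na: "non_atomic M"
    and q [measurable]: "q \<in> measurable M (count_space UNIV)" and c [measurable]: "c \<in> measurable M (count_space UNIV)"
    and qp: "\<And>x. x \<in> space M \<Longrightarrow> q x < p" and cp: "\<And>x. x \<in> space M \<Longrightarrow> c x < p"
  shows "\<exists>T\<in>mp_automorphisms M. prob {x\<in>space M. q x \<noteq> c (T x)}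
      \<le> real p * (\<Sum>l<p. \<bar>prob {x\<in>space M. q x = l} - prob {x\<in>space M. c x = l}\<bar>)"
proof -
  obtain g j where g: "g \<in> borel_measurable M" "\<And>x. 0 \<le> g x" "\<And>x. g x < (1::real)" and j: "j \<in> measurable borel M"
    and jg: "AE x in M. j (g x) = x" by (rule standard_borel_coding[OF prob_space_axioms std], rule that)
  obtain H J where H [measurable]: "H \<in> borel_measurable M" and J [measurable]: "J \<in> measurable borel M"
    and dH: "distr M borel H = unif01" and JH: "AE x in M. J (H x) = x" and HJ: "AE u in unif01. H (J u) = u"
    and up: "\<And>x i. x \<in> space M \<Longrightarrow> q x < i \<Longrightarrow> H x \<le> prob {y\<in>space M. q y < i}"
    and lo: "\<And>x i. x \<in> space M \<Longrightarrow> i \<le> q x \<Longrightarrow> prob {y\<in>space M. q y < i} \<le> H x"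
    by (rule labelled_uniformization[OF na g j jg q], rule that)
  obtain H' J' where H' [measurable]: "H' \<in> borel_measurable M" and J' [measurable]: "J' \<in> measurable borel M"
    and dH': "distr M borel H' = unif01" and JH': "AE x in M. J' (H' x) = x" and HJ': "AE u in unif01. H' (J' u) = u"
    and up': "\<And>x i. x \<in> space M \<Longrightarrow> c x < i \<Longrightarrow> H' x \<le> prob {y\<in>space M. c y < i}"
    and lo': "\<And>x i. x \<in> space M \<Longrightarrow> i \<le> c x \<Longrightarrow> prob {y\<in>space M. c y < i} \<le> H' x"
    by (rule labelled_uniformization[OF na g j jg c], rule that)
  have dJ: "distr unif01 M J = M"
  proof -
    have "distr unif01 M J = distr M M (J \<circ> H)" unfolding dH[symmetric] by (rule distr_distr[OF J H])
    also have "\<dots> = distr M M (\<lambda>x. x)" by (rule distr_cong_AE) (use JH in auto)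
    finally show ?thesis by simp
  qed
  have dJ': "distr unif01 M J' = M"
  proof -
    have "distr unif01 M J' = distr M M (J' \<circ> H')" unfolding dH'[symmetric] by (rule distr_distr[OF J' H'])
    also have "\<dots> = distr M M (\<lambda>x. x)" by (rule distr_cong_AE) (use JH' in auto)
    finally show ?thesis by simp
  qed
  have AEH: "AE x in M. P (H x)" if "AE u in unif01. P u" for P
    using that AE_distrD[OF H] unfolding dH[symmetric] by blast
  have AEH': "AE x in M. P (H' x)" if "AE u in unif01. P u" for P
    using that AE_distrD[OF H'] unfolding dH'[symmetric] by blast
  define f where "f x = J' (H x)" for x
  define h where "h x = J (H' x)" for x
  have fm: "f \<in> measurable M M" "h \<in> measurable M M" unfolding f_def h_def by measurable
  have df: "distr M M f = M"
    using distr_distr[OF J' H] dJ' unfolding dH by (simp add: comp_def f_def[abs_def])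
  have dh: "distr M M h = M"
    using distr_distr[OF J H'] dJ unfolding dH' by (simp add: comp_def h_def[abs_def])
  have H'f: "AE x in M. H' (f x) = H x" using AEH[OF HJ'] by (simp add: f_def)
  have Hh: "AE x in M. H (h x) = H' x" using AEH'[OF HJ] by (simp add: h_def)
  have hf: "AE x in M. h (f x) = x" using H'f JH by (auto simp: h_def)
  have fh: "AE x in M. f (h x) = x" using Hh JH' by (auto simp: f_def)
  obtain T where T: "T \<in> mp_automorphisms M" "AE x in M. T x = f x"
    using mod0_iso_extend[OF fm df dh hf fh] by blast
  have Tm [measurable]: "T \<in> measurable M M" by (rule mp_aut_measurable[OF T(1)])
  have H'T: "AE x in M. H' (T x) = H x" using T(2) H'f by auto
  define \<alpha> where "\<alpha> i = prob {x\<in>space M. q x < i}" for i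
  define \<beta> where "\<beta> i = prob {x\<in>space M. c x < i}" for i
  have "prob {x\<in>space M. q x \<noteq> c (T x)} \<le> prob (\<Union>i<p. {x\<in>space M. H x \<in> {min (\<alpha> i) (\<beta> i)..max (\<alpha> i) (\<beta> i)}})"
  proof (rule finite_measure_mono_AE)
    show "AE x in M. x \<in> {x \<in> space M. q x \<noteq> c (T x)} \<longrightarrow>
        x \<in> (\<Union>i<p. {x\<in>space M. H x \<in> {min (\<alpha> i) (\<beta> i)..max (\<alpha> i) (\<beta> i)}})"
      using H'T AE_space
    proof eventually_elim
      case (elim x)
      have Tx: "T x \<in> space M" using mp_aut_space[OF T(1)] elim by auto
      show ?case
      proof
        assume "x \<in> {x \<in> space M. q x \<noteq> c (T x)}"
        then consider "q x < c (T x)" | "c (T x) < q x" by force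
        then show "x \<in> (\<Union>i<p. {x\<in>space M. H x \<in> {min (\<alpha> i) (\<beta> i)..max (\<alpha> i) (\<beta> i)}})"
        proof cases
          case 1
          then show ?thesis
            using up[OF elim(2) 1] lo'[OF Tx order_refl] elim cp[OF Tx]
            by (intro UN_I[of "c (T x)"]) (auto simp: \<alpha>_def \<beta>_def min_le_iff_disj le_max_iff_disj)
        next
          case 2
          then show ?thesis
            using up'[OF Tx 2] lo[OF elim(2) order_refl] elim qp[OF elim(2)]
            by (intro UN_I[of "q x"]) (auto simp: \<alpha>_def \<beta>_def min_le_iff_disj le_max_iff_disj)
        qed
      qed
    qed
  qed measurable
  also have "\<dots> \<le> (\<Sum>i<p. prob {x\<in>space M. H x \<in> {min (\<alpha> i) (\<beta> i)..max (\<alpha> i) (\<beta> i)}})"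
    by (rule finite_measure_subadditive_finite) auto
  also have "\<dots> \<le> (\<Sum>i<p. \<bar>\<alpha> i - \<beta> i\<bar>)"
  proof (rule sum_mono)
    fix i
    have "prob {x\<in>space M. H x \<in> {min (\<alpha> i) (\<beta> i)..max (\<alpha> i) (\<beta> i)}} = measure unif01 {min (\<alpha> i) (\<beta> i)..max (\<alpha> i) (\<beta> i)}"
      unfolding dH[symmetric] by (subst measure_distr) (auto intro!: arg_cong[where f = prob])
    then show "prob {x\<in>space M. H x \<in> {min (\<alpha> i) (\<beta> i)..max (\<alpha> i) (\<beta> i)}} \<le> \<bar>\<alpha> i - \<beta> i\<bar>"
      using unif01_interval[of "min (\<alpha> i) (\<beta> i)" "max (\<alpha> i) (\<beta> i)"]
      by (cases "\<alpha> i \<le> \<beta> i") auto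
  qed
  also have "\<dots> \<le> (\<Sum>i<p. \<Sum>l<p. \<bar>prob {x\<in>space M. q x = l} - prob {x\<in>space M. c x = l}\<bar>)"
  proof (rule sum_mono)
    fix i assume i: "i \<in> {..<p}"
    have dec: "prob {x\<in>space M. f x < i} = (\<Sum>l<i. prob {x\<in>space M. f x = l})"
      if [measurable]: "f \<in> measurable M (count_space UNIV)" for f :: "'a \<Rightarrow> nat"
    proof -
      have "{x\<in>space M. f x < i} = (\<Union>l<i. {x\<in>space M. f x = l})" by auto
      then show ?thesis by (simp, subst finite_measure_finite_Union) (auto simp: disjoint_family_on_def)
    qed
    have "\<bar>\<alpha> i - \<beta> i\<bar> = \<bar>\<Sum>l<i. prob {x\<in>space M. q x = l} - prob {x\<in>space M. c x = l}\<bar>"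
      unfolding \<alpha>_def \<beta>_def dec[OF q] dec[OF c] by (simp add: sum_subtractf)
    also have "\<dots> \<le> (\<Sum>l<i. \<bar>prob {x\<in>space M. q x = l} - prob {x\<in>space M. c x = l}\<bar>)"
      by (rule sum_abs)
    also have "\<dots> \<le> (\<Sum>l<p. \<bar>prob {x\<in>space M. q x = l} - prob {x\<in>space M. c x = l}\<bar>)"
      by (rule sum_mono2) (use i in auto)
    finally show "\<bar>\<alpha> i - \<beta> i\<bar> \<le> (\<Sum>l<p. \<bar>prob {x\<in>space M. q x = l} - prob {x\<in>space M. c x = l}\<bar>)" .
  qed
  finally show ?thesis using T(1) by (intro bexI[of _ T]) auto
qed

lemma realize_labels:
  fixes q c :: "'a \<Rightarrow> 'l"
  assumes std: "standard_borel M" and na: "non_atomic M" and L: "finite L"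
    and q: "\<And>l. l \<in> L \<Longrightarrow> {x\<in>space M. q x = l} \<in> events" "\<And>x. x \<in> space M \<Longrightarrow> q x \<in> L"
    and c: "\<And>l. l \<in> L \<Longrightarrow> {x\<in>space M. c x = l} \<in> events" "\<And>x. x \<in> space M \<Longrightarrow> c x \<in> L"
  shows "\<exists>T\<in>mp_automorphisms M. prob {x\<in>space M. q x \<noteq> c (T x)}
      \<le> real (card L) * (\<Sum>l\<in>L. \<bar>prob {x\<in>space M. q x = l} - prob {x\<in>space M. c x = l}\<bar>)"
proof -
  obtain e where e: "bij_betw e L {0..<card L}" using ex_bij_betw_finite_nat[OF L] by blast
  have einj: "l \<in> L \<Longrightarrow> l' \<in> L \<Longrightarrow> e l = e l' \<longleftrightarrow> l = l'" and elt: "l \<in> L \<Longrightarrow> e l < card L" for l l'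
    using e by (auto simp: bij_betw_def inj_on_def)
  have meas: "(\<lambda>x. e (f x)) \<in> measurable M (count_space UNIV)"
    if f: "\<And>l. l \<in> L \<Longrightarrow> {x\<in>space M. f x = l} \<in> events" "\<And>x. x \<in> space M \<Longrightarrow> f x \<in> L" for f :: "'a \<Rightarrow> 'l"
    unfolding measurable_count_space_eq2_countable
  proof (intro conjI ballI)
    fix n
    have "(\<lambda>x. e (f x)) -` {n} \<inter> space M = (\<Union>l\<in>{l\<in>L. e l = n}. {x\<in>space M. f x = l})" using f(2) by auto
    also have "\<dots> \<in> events" using L f(1) by (intro sets.finite_UN) auto
    finally show "(\<lambda>x. e (f x)) -` {n} \<inter> space M \<in> events" .
  qed auto
  obtain T where T: "T \<in> mp_automorphisms M" "prob {x\<in>space M. e (q x) \<noteq> e (c (T x))}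
      \<le> real (card L) * (\<Sum>l<card L. \<bar>prob {x\<in>space M. e (q x) = l} - prob {x\<in>space M. e (c x) = l}\<bar>)"
    using realize_numbered_labels[OF std na meas[OF q] meas[OF c], where p = "card L"] q(2) c(2) elt by blast
  have "(\<Sum>l<card L. \<bar>prob {x\<in>space M. e (q x) = l} - prob {x\<in>space M. e (c x) = l}\<bar>)
      = (\<Sum>l\<in>L. \<bar>prob {x\<in>space M. e (q x) = e l} - prob {x\<in>space M. e (c x) = e l}\<bar>)"
    using sum.reindex_bij_betw[OF e, symmetric] by (simp add: atLeast0LessThan)
  also have "\<dots> = (\<Sum>l\<in>L. \<bar>prob {x\<in>space M. q x = l} - prob {x\<in>space M. c x = l}\<bar>)"
    using q(2) c(2) einj by (intro sum.cong refl arg_cong[where f = abs] arg_cong2[where f = minus] arg_cong[where f = prob]) auto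
  moreover have "{x\<in>space M. e (q x) \<noteq> e (c (T x))} = {x\<in>space M. q x \<noteq> c (T x)}"
    using q(2) c(2) einj mp_aut_space[OF T(1)] by auto
  ultimately show ?thesis using T by (intro bexI[of _ T]) simp_all
qed

end

section \<open>Rokhlin towers\<close>

lemma pred_eq_nat [measurable (raw)]:
  fixes f h :: "'a \<Rightarrow> nat"
  assumes "f \<in> measurable M (count_space UNIV)" "h \<in> measurable M (count_space UNIV)"
  shows "Measurable.pred M (\<lambda>x. f x = h x)"
  by (rule measurable_compose_countable[where f = "\<lambda>n x. n = h x", OF _ assms(1)])
    (use assms(2) in measurable)

text \<open>
  The number of the cell of width \<open>1 / n\<close> that contains \<open>t\<close>: a measurable
  key with finitely many values that separates two given points once \<open>n\<close> is large.
\<close>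

definition grid :: "nat \<Rightarrow> real \<Rightarrow> nat" where
  "grid n t = nat \<lfloor>real n * t\<rfloor>"

lemma grid_measurable [measurable]: "grid n \<in> measurable borel (count_space UNIV)"
  unfolding grid_def[abs_def] by measurable

lemma grid_less: "0 \<le> t \<Longrightarrow> t < 1 \<Longrightarrow> 0 < n \<Longrightarrow> grid n t < n"
  unfolding grid_def by (auto simp: nat_less_iff floor_less_iff)

lemma grid_separates:
  assumes "0 \<le> s" "0 \<le> t" "1 \<le> real n * \<bar>s - t\<bar>" shows "grid n s \<noteq> grid n t"
proof
  assume "grid n s = grid n t"
  then have "\<lfloor>real n * s\<rfloor> = \<lfloor>real n * t\<rfloor>" using assms by (simp add: grid_def nat_eq_iff)
  then have "\<bar>real n * s - real n * t\<bar> < 1" by linarith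
  moreover have "\<bar>real n * s - real n * t\<bar> = real n * \<bar>s - t\<bar>"
    by (simp add: abs_mult right_diff_distrib[symmetric])
  ultimately show False using assms by simp
qed

lemma grid_eventually_separates:
  assumes "0 \<le> s" "0 \<le> t" "s \<noteq> t"
  shows "\<exists>n0. \<forall>n\<ge>n0. grid n s \<noteq> grid n t"
proof -
  obtain n0 :: nat where n0: "1 / \<bar>s - t\<bar> \<le> real n0" using real_arch_simple by blast
  have "grid n s \<noteq> grid n t" if "n \<ge> n0" for n
  proof (rule grid_separates[OF assms(1,2)])
    have "1 / \<bar>s - t\<bar> \<le> real n" using n0 that by linarith
    then show "1 \<le> real n * \<bar>s - t\<bar>" using assms(3) by (simp add: field_simps)
  qed
  then show ?thesis by blast
qed

context prob_space
begin

text \<open>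
  Give each point a number \<open>\<rho> x\<close> that differs from the numbers of the next
  \<open>m - 1\<close> points of its orbit, and let \<open>C\<close> consist of the points where
  \<open>\<rho>\<close> attains its minimum \<open>\<sigma> x\<close> over the forward orbit. Every
  forward orbit attains its minimum and thus meets \<open>C\<close>. The minimum can only grow along
  the orbit and its distribution does not change, so it is invariant almost everywhere. Therefore
  two points of \<open>C\<close> on one orbit have the same number, so they are at least
  \<open>m\<close> steps apart.
\<close>

lemma small_sweep:
  assumes std: "standard_borel M" and U: "U \<in> mp_automorphisms M"
    and ap: "AE x in M. \<forall>k>0. (U ^^ k) x \<noteq> x" and m: "m > 0"
  shows "\<exists>C\<in>events. prob C \<le> 1 / real m \<and> (\<forall>x\<in>space M. \<exists>k. (U ^^ k) x \<in> C)"
proof -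
  obtain g j where g [measurable]: "g \<in> borel_measurable M" and g0: "\<And>x. 0 \<le> g x" and g1: "\<And>x. g x < (1::real)"
    and j: "j \<in> measurable borel M"
    and jg: "AE x in M. j (g x) = x" by (rule standard_borel_coding[OF prob_space_axioms std], rule that)
  have Um [measurable]: "(U ^^ k) \<in> measurable M M" for k by (rule mp_aut_measurable[OF mp_aut_funpow[OF U]])
  have Usp: "(U ^^ k) x \<in> space M" if "x \<in> space M" for k x by (rule mp_aut_space[OF mp_aut_funpow[OF U] that])
  define P where "P n x \<longleftrightarrow> (\<forall>k\<in>{0<..<m}. grid n (g ((U ^^ k) x)) \<noteq> grid n (g x))" for n x
  define \<gamma> where "\<gamma> n k x = grid n (g ((U ^^ k) x))" for n k x
  have [measurable]: "\<gamma> n k \<in> measurable M (count_space UNIV)" for n k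
    unfolding \<gamma>_def by (rule measurable_compose[OF Um]) measurable
  have "P = (\<lambda>n x. \<forall>k\<in>{0<..<m}. \<gamma> n k x \<noteq> \<gamma> n 0 x)" by (simp add: P_def \<gamma>_def fun_eq_iff)
  then have Pm [measurable]: "Measurable.pred M (P n)" for n by simp
  define l where "l x = (LEAST n. P n x)" for x
  have lm [measurable]: "l \<in> measurable M (count_space UNIV)" unfolding l_def by measurable
  define \<rho> where "\<rho> x = prod_encode (l x, grid (l x) (g x))" for x
  have "(\<lambda>x. (\<lambda>n x. prod_encode (n, grid n (g x))) (l x) x) \<in> measurable M (count_space UNIV)"
    by (rule measurable_compose_countable[OF _ lm]) measurable
  then have \<rho>m [measurable]: "\<rho> \<in> measurable M (count_space UNIV)" unfolding \<rho>_def by simp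
  have "AE x in M. \<forall>k. j (g ((U ^^ k) x)) = (U ^^ k) x"
    unfolding AE_all_countable using AE_mp_aut[OF mp_aut_funpow[OF U] jg] by blast
  with ap have \<rho>: "AE x in M. \<forall>k\<in>{0<..<m}. \<rho> ((U ^^ k) x) \<noteq> \<rho> x"
  proof eventually_elim
    case (elim x)
    have gne: "g ((U ^^ k) x) \<noteq> g x" if "k > 0" for k
    proof
      assume "g ((U ^^ k) x) = g x"
      then have "(U ^^ k) x = (U ^^ 0) x" using elim(2)[rule_format, of k] elim(2)[rule_format, of 0] by simp
      then show False using elim(1) that by simp
    qed
    have "\<forall>k\<in>{0<..<m}. \<exists>n0. \<forall>n\<ge>n0. grid n (g ((U ^^ k) x)) \<noteq> grid n (g x)"
      using grid_eventually_separates[OF g0 g0] gne by auto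
    then obtain n0 where n0: "\<And>k n. k \<in> {0<..<m} \<Longrightarrow> n \<ge> n0 k \<Longrightarrow> grid n (g ((U ^^ k) x)) \<noteq> grid n (g x)"
      by metis
    have "P (Max (n0 ` {..m})) x"
      unfolding P_def by (intro ballI n0) (auto intro: Max_ge)
    then have "P (l x) x" unfolding l_def by (rule LeastI)
    then show ?case unfolding P_def by (auto simp: \<rho>_def)
  qed
  define \<sigma> where "\<sigma> x = (LEAST n. \<exists>k. \<rho> ((U ^^ k) x) = n)" for x
  have \<sigma>m [measurable]: "\<sigma> \<in> measurable M (count_space UNIV)" unfolding \<sigma>_def by measurable
  have \<sigma>le: "\<sigma> x \<le> \<rho> ((U ^^ k) x)" for x k unfolding \<sigma>_def by (rule Least_le) blast
  have \<sigma>ex: "\<exists>k. \<rho> ((U ^^ k) x) = \<sigma> x" for x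
    unfolding \<sigma>_def by (rule LeastI[of "\<lambda>n. \<exists>k. \<rho> ((U ^^ k) x) = n" "\<rho> x"]) (auto intro: exI[of _ 0])
  have \<sigma>mono: "\<sigma> x \<le> \<sigma> ((U ^^ k) x)" for x k
  proof -
    obtain i where "\<rho> ((U ^^ i) ((U ^^ k) x)) = \<sigma> ((U ^^ k) x)" using \<sigma>ex by blast
    then show ?thesis using \<sigma>le[of x "i + k"] by (simp add: funpow_add)
  qed
  have \<sigma>inv: "AE x in M. \<sigma> ((U ^^ k) x) = \<sigma> x" for k
  proof -
    have "AE x in M. \<forall>n. \<sigma> x \<le> n \<longrightarrow> \<sigma> ((U ^^ k) x) \<le> n"
      unfolding AE_all_countable
    proof
      fix n
      let ?A = "{x\<in>space M. \<sigma> x \<le> n}" and ?B = "{x\<in>space M. \<sigma> ((U ^^ k) x) \<le> n}"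
      define \<sigma>k where "\<sigma>k x = \<sigma> ((U ^^ k) x)" for x
      have [measurable]: "\<sigma>k \<in> measurable M (count_space UNIV)"
        unfolding \<sigma>k_def by (rule measurable_compose[OF Um \<sigma>m])
      have "?B = {x\<in>space M. \<sigma>k x \<le> n}" by (simp add: \<sigma>k_def)
      then have [measurable]: "?B \<in> events" by simp
      have "prob (?A - ?B) = prob ?A - prob ?B"
        by (rule finite_measure_Diff) (use \<sigma>mono in \<open>auto intro: order_trans\<close>)
      also have "prob ?B = prob ?A" by (rule measure_mp_subst[OF mp_aut_funpow[OF U]]) measurable
      finally have "prob (?A - ?B) = 0" by simp
      then have "AE x in M. x \<notin> ?A - ?B" by (subst (asm) prob_eq_0) auto
      then show "AE x in M. \<sigma> x \<le> n \<longrightarrow> \<sigma> ((U ^^ k) x) \<le> n" using AE_space by eventually_elim auto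
    qed
    then show ?thesis
    proof eventually_elim
      case (elim x) then show ?case using \<sigma>mono[of x k] by (meson antisym order_refl)
    qed
  qed
  define C where "C = {x\<in>space M. \<rho> x = \<sigma> x}"
  have Cm [measurable]: "C \<in> events" unfolding C_def by measurable
  have hit: "\<exists>k. (U ^^ k) x \<in> C" if x: "x \<in> space M" for x
  proof -
    obtain k where "\<rho> ((U ^^ k) x) = \<sigma> x" using \<sigma>ex by blast
    then have "\<rho> ((U ^^ k) x) = \<sigma> ((U ^^ k) x)" using \<sigma>mono[of x k] \<sigma>le[of "(U ^^ k) x" 0] by simp
    then show ?thesis using Usp[OF x] by (auto simp: C_def)
  qed
  have "AE x in M. \<forall>k. \<sigma> ((U ^^ k) x) = \<sigma> x" using \<sigma>inv by (simp add: AE_all_countable)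
  with \<rho> have disc: "AE x in M. x \<in> C \<longrightarrow> (\<forall>k\<in>{0<..<m}. (U ^^ k) x \<notin> C)"
    by eventually_elim (auto simp: C_def)
  define C' where "C' = {x\<in>C. \<forall>k\<in>{0<..<m}. (U ^^ k) x \<notin> C}"
  have "C' = {x\<in>space M. x \<in> C \<and> (\<forall>k\<in>{0<..<m}. (U ^^ k) x \<notin> C)}" by (auto simp: C'_def C_def)
  then have C'm [measurable]: "C' \<in> events" by simp
  have CC': "prob C = prob C'"
    by (rule measure_eq_AE) (use disc in \<open>auto simp: C'_def\<close>)
  let ?V = "\<lambda>k. (U ^^ k) -` C' \<inter> space M"
  have "(\<Sum>k<m. prob (?V k)) = prob (\<Union>k<m. ?V k)"
  proof (rule finite_measure_finite_Union[symmetric])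
    show "disjoint_family_on ?V {..<m}"
      unfolding disjoint_family_on_def
    proof (intro ballI impI)
      have aux: "?V k \<inter> ?V k' = {}" if "k < k'" "k' < m" for k k'
      proof (rule ccontr)
        assume "?V k \<inter> ?V k' \<noteq> {}"
        then obtain x where x: "(U ^^ k) x \<in> C'" "(U ^^ k') x \<in> C'" by auto
        have "(U ^^ (k' - k)) ((U ^^ k) x) = (U ^^ k') x" using that by (simp add: funpow_add[symmetric, THEN fun_cong, unfolded comp_def])
        moreover have "(U ^^ (k' - k)) ((U ^^ k) x) \<notin> C" using x(1) that unfolding C'_def by auto
        ultimately show False using x(2) unfolding C'_def by auto
      qed
      fix k k' assume "k \<in> {..<m}" "k' \<in> {..<m}" "k \<noteq> k'"
      then show "?V k \<inter> ?V k' = {}" using aux[of k k'] aux[of k' k] by (cases "k < k'") auto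
    qed
  qed auto
  moreover have "prob (?V k) = prob C'" for k by (rule mp_aut_vimage_measure[OF mp_aut_funpow[OF U] C'm])
  ultimately have "real m * prob C' \<le> 1" using prob_le_1 by simp
  then have "prob C \<le> 1 / real m" using m CC' by (simp add: field_simps)
  then show ?thesis using hit Cm by blast
qed

text \<open>
  Let \<open>t x\<close> be the time until the orbit of \<open>x\<close> meets a set
  \<open>C\<close> as in \<open>small_sweep\<close>. Counting backwards from \<open>C\<close> in
  blocks of length \<open>N\<close>, the first points of the blocks are those for which
  \<open>N\<close> divides \<open>t x + 1\<close>. A point misses the tower only if its block is cut
  off by an earlier visit to \<open>C\<close>, which happens within \<open>N\<close> steps after
  such a visit.
\<close>

lemma rokhlin_tower:
  assumes std: "standard_borel M" and U: "U \<in> mp_automorphisms M"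
    and ap: "AE x in M. \<forall>k>0. (U ^^ k) x \<noteq> x" and N: "N > 0" and e: "e > 0"
  shows "\<exists>B\<in>events. (\<forall>x\<in>B. \<forall>k. 0 < k \<and> k < N \<longrightarrow> (U ^^ k) x \<notin> B) \<and>
      prob (space M - (\<Union>k<N. (U ^^ k) ` B)) < e"
proof -
  obtain m :: nat where "real N / e < real m" using reals_Archimedean2 by blast
  moreover have "0 \<le> real N / e" using e by simp
  ultimately have "0 < real m" by linarith
  then have m: "m > 0" "real N / real m < e" using e \<open>real N / e < real m\<close> by (auto simp: field_simps)
  obtain C where C [measurable]: "C \<in> events" and Cp: "prob C \<le> 1 / real m"
    and hit: "\<And>x. x \<in> space M \<Longrightarrow> \<exists>k. (U ^^ k) x \<in> C"
    using small_sweep[OF std U ap m(1)] by blast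
  have Um [measurable]: "(U ^^ k) \<in> measurable M M" for k by (rule mp_aut_measurable[OF mp_aut_funpow[OF U]])
  have Usp: "(U ^^ k) x \<in> space M" if "x \<in> space M" for k x by (rule mp_aut_space[OF mp_aut_funpow[OF U] that])
  have Uadd: "(U ^^ i) ((U ^^ k) x) = (U ^^ (i + k)) x" for i k x by (simp add: funpow_add)
  define t where "t x = (LEAST k. (U ^^ k) x \<in> C)" for x
  have tm [measurable]: "t \<in> measurable M (count_space UNIV)" unfolding t_def by measurable
  have tC: "(U ^^ t x) x \<in> C" if "x \<in> space M" for x unfolding t_def by (rule LeastI_ex[OF hit[OF that]])
  have tle: "t x \<le> k" if "(U ^^ k) x \<in> C" for x k unfolding t_def by (rule Least_le) (rule that)
  have tsub: "t ((U ^^ k) x) = t x - k" if x: "x \<in> space M" and k: "k \<le> t x" for x k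
  proof (rule antisym)
    show "t ((U ^^ k) x) \<le> t x - k" by (rule tle) (use tC[OF x] k in \<open>simp add: Uadd\<close>)
    have "(U ^^ (t ((U ^^ k) x) + k)) x \<in> C" using tC[OF Usp[OF x, of k]] by (simp add: Uadd)
    from tle[OF this] show "t x - k \<le> t ((U ^^ k) x)" by simp
  qed
  define B where "B = {x\<in>space M. N dvd t x + 1}"
  have Bm: "B \<in> events" unfolding B_def by measurable
  have disj: "(U ^^ k) x \<notin> B" if "x \<in> B" "0 < k" "k < N" for x k
  proof
    assume a: "(U ^^ k) x \<in> B"
    have x: "x \<in> space M" "N dvd t x + 1" using that by (auto simp: B_def)
    have "N \<le> t x + 1" by (rule dvd_imp_le[OF x(2)]) simp
    then have k: "k \<le> t x" using that by simp
    have "N dvd (t x - k) + 1" using a tsub[OF x(1) k] by (auto simp: B_def)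
    then have "N dvd (t x + 1) - ((t x - k) + 1)" using x(2) by (rule dvd_diff_nat[rotated])
    then have "N dvd k" using k by simp
    then show False using that by (auto dest: dvd_imp_le)
  qed
  have cover: "space M - (\<Union>k<N. (U ^^ k) ` B) \<subseteq> (\<Union>k<N. (U ^^ k) ` C)"
  proof
    fix y assume y: "y \<in> space M - (\<Union>k<N. (U ^^ k) ` B)"
    define k where "k = N - 1 - t y mod N"
    have kN: "k < N" using N by (simp add: k_def)
    define x where "x = minv M (U ^^ k) y"
    have x: "x \<in> space M" "(U ^^ k) x = y"
      using y minv_space[OF mp_aut_funpow[OF U]] minv_right[OF mp_aut_funpow[OF U]] by (auto simp: x_def)
    have "t x < k"
    proof (rule ccontr)
      assume "\<not> t x < k"
      then have "t x = t y + k" using tsub[OF x(1), of k] x(2) by simp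
      moreover have "t y mod N + k + 1 = N" using mod_less_divisor[OF N, of "t y"] by (simp add: k_def)
      ultimately have "t x + 1 = N * (t y div N) + N" using mult_div_mod_eq[of N "t y"] by linarith
      then have "x \<in> B" using x by (auto simp: B_def)
      then show False using x y kN by blast
    qed
    then have "y = (U ^^ (k - t x)) ((U ^^ t x) x)" using x by (simp add: Uadd)
    then show "y \<in> (\<Union>k<N. (U ^^ k) ` C)" using tC[OF x(1)] kN by (intro UN_I[of "k - t x"]) auto
  qed
  have "prob (space M - (\<Union>k<N. (U ^^ k) ` B)) \<le> prob (\<Union>k<N. (U ^^ k) ` C)"
    by (rule finite_measure_mono[OF cover]) (auto intro: mp_aut_image_sets(1)[OF mp_aut_funpow[OF U] C])
  also have "\<dots> \<le> (\<Sum>k<N. prob ((U ^^ k) ` C))"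
    by (rule finite_measure_subadditive_finite) (auto intro: mp_aut_image_sets(1)[OF mp_aut_funpow[OF U] C])
  also have "\<dots> = real N * prob C" using mp_aut_image_sets(2)[OF mp_aut_funpow[OF U] C] by simp
  also have "\<dots> \<le> real N * (1 / real m)" using Cp by (intro mult_left_mono) auto
  also have "\<dots> < e" using m by simp
  finally show ?thesis using Bm disj by blast
qed

end

section \<open>Random maps along the orbits of an automorphism\<close>

text \<open>
  On the tower \<open>W\<close> a point at level \<open>l y\<close> is sent to the point \<open>l
  y\<close> steps along the \<open>b\<close>-orbit of the sample with index \<open>\<kappa>
  y\<close>. The default value \<open>y\<close> off the tower keeps the map measurable.
\<close>

definition random_map ::
    "('a \<Rightarrow> 'a) \<Rightarrow> 'a set \<Rightarrow> ('a \<Rightarrow> nat) \<Rightarrow> ('a \<Rightarrow> nat) \<Rightarrow> (nat \<Rightarrow> 'a) \<Rightarrow> 'a \<Rightarrow> 'a" where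
  "random_map b W l \<kappa> \<omega> y = (if y \<in> W then (b ^^ l y) (\<omega> (\<kappa> y)) else y)"

context prob_space
begin

context
  fixes b :: "'a \<Rightarrow> 'a" and W :: "'a set" and l \<kappa> :: "'a \<Rightarrow> nat" and J :: nat
  assumes b: "b \<in> mp_automorphisms M" and W [measurable]: "W \<in> events"
    and l [measurable]: "l \<in> measurable M (count_space UNIV)"
    and \<kappa> [measurable]: "\<kappa> \<in> measurable M (count_space {..<J})"
begin

abbreviation "samples \<equiv> Pi\<^sub>M {..<J} (\<lambda>_. M)"
abbreviation "sample_map \<equiv> random_map b W l \<kappa>"

lemma key_less: "y \<in> space M \<Longrightarrow> \<kappa> y < J"
  using measurable_space[OF \<kappa>, of y] by simp

lemma prob_space_samples: "prob_space samples"
  by (rule prob_space_PiM) (rule prob_space_axioms)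

lemma random_map_measurable:
  assumes f: "f \<in> measurable N samples" and h: "h \<in> measurable N M"
  shows "(\<lambda>p. sample_map (f p) (h p)) \<in> measurable N M"
proof -
  note [measurable] = f h
  have bm [measurable]: "(b ^^ r) \<in> measurable M M" for r by (rule mp_aut_measurable[OF mp_aut_funpow[OF b]])
  have 1: "(\<lambda>p. (b ^^ r) (f p k)) \<in> measurable N M" if "k \<in> {..<J}" for r k
    by (rule measurable_compose[OF measurable_compose[OF f measurable_component_singleton[OF that]] bm])
  have 2: "(\<lambda>p. (b ^^ r) (f p (\<kappa> (h p)))) \<in> measurable N M" for r
    by (rule measurable_compose_countable'[where f = "\<lambda>k p. (b ^^ r) (f p k)" and I = "{..<J}"])
      (use 1 in \<open>auto intro: measurable_compose[OF h \<kappa>]\<close>)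
  have 3: "(\<lambda>p. (b ^^ l (h p)) (f p (\<kappa> (h p)))) \<in> measurable N M"
    by (rule measurable_compose_countable[where f = "\<lambda>r p. (b ^^ r) (f p (\<kappa> (h p)))"])
      (use 2 in \<open>auto intro: measurable_compose[OF h l]\<close>)
  show ?thesis unfolding random_map_def by (rule measurable_If[OF 3 h]) measurable
qed

text \<open>
  Different keys refer to independent samples, and each value has distribution \<open>M\<close>
  because \<open>b\<close> preserves it.
\<close>

lemma random_map_uncorrelated:
  assumes D [measurable]: "D \<in> events"
    and y: "y \<in> W" "y \<in> space M" and y': "y' \<in> W" "y' \<in> space M" and ne: "\<kappa> y \<noteq> \<kappa> y'"
  shows "(\<integral>\<omega>. (indicator D (sample_map \<omega> y) - prob D) * (indicator D (sample_map \<omega> y') - prob D) \<partial>samples) = 0"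
proof -
  interpret P: product_sigma_finite "\<lambda>_::nat. M" by standard
  define u where "u r z = indicator D ((b ^^ r) z) - prob D" for r z
  have bm [measurable]: "(b ^^ r) \<in> measurable M M" for r by (rule mp_aut_measurable[OF mp_aut_funpow[OF b]])
  have um [measurable]: "u r \<in> borel_measurable M" for r unfolding u_def by measurable
  have ui: "integrable M (u r)" for r
    by (rule integrable_const_bound[where B = 1])
      (use prob_le_1[of D] measure_nonneg[of M D] in \<open>auto simp: u_def indicator_def\<close>)
  have u0: "(\<integral>z. u r z \<partial>M) = 0" for r
  proof -
    have "(\<integral>z. indicator D ((b ^^ r) z) \<partial>M) = (\<integral>z. indicator ((b ^^ r) -` D \<inter> space M) z \<partial>M)"
      by (rule Bochner_Integration.integral_cong) (auto simp: indicator_def)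
    also have "\<dots> = prob D" using mp_aut_vimage_measure[OF mp_aut_funpow[OF b] D, of r] by simp
    finally have "(\<integral>z. indicator D ((b ^^ r) z) \<partial>M) = prob D" .
    moreover have "integrable M (\<lambda>z. indicator D ((b ^^ r) z) :: real)"
      by (rule integrable_const_bound[where B = 1]) (auto simp: indicator_def)
    ultimately show ?thesis unfolding u_def using prob_space by (subst Bochner_Integration.integral_diff) auto
  qed
  define f where "f i = (if i = \<kappa> y then u (l y) else if i = \<kappa> y' then u (l y') else (\<lambda>_. 1))" for i
  have pr: "(\<Prod>i\<in>{..<J}. f i (\<omega> i)) = u (l y) (\<omega> (\<kappa> y)) * u (l y') (\<omega> (\<kappa> y'))" for \<omega>
  proof -
    have "(\<Prod>i\<in>{..<J}. f i (\<omega> i)) = (\<Prod>i\<in>{\<kappa> y, \<kappa> y'}. f i (\<omega> i))"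
      by (rule prod.mono_neutral_right) (use key_less y y' in \<open>auto simp: f_def\<close>)
    then show ?thesis using ne by (simp add: f_def)
  qed
  have "(\<integral>\<omega>. (indicator D (sample_map \<omega> y) - prob D) * (indicator D (sample_map \<omega> y') - prob D) \<partial>samples)
      = (\<integral>\<omega>. (\<Prod>i\<in>{..<J}. f i (\<omega> i)) \<partial>samples)"
    unfolding pr using y y' by (simp add: random_map_def u_def)
  also have "\<dots> = (\<Prod>i\<in>{..<J}. \<integral>z. f i z \<partial>M)"
    by (rule P.product_integral_prod) (use ui in \<open>auto simp: f_def\<close>)
  also have "\<dots> = 0"
    using key_less[OF y(2)] u0[of "l y"] by (intro prod_zero) (auto simp: f_def intro!: bexI[of _ "\<kappa> y"])
  finally show ?thesis .
qed

text \<open>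
  After expanding the square only the pairs \<open>t, t'\<close> for which the two values are
  correlated survive, and each of them contributes at most 1. Integrating over \<open>x\<close>
  first or over \<open>\<omega>\<close> first gives the same result.
\<close>

lemma random_map_second_moment:
  fixes y :: "nat \<Rightarrow> 'a \<Rightarrow> 'a" and N :: nat
  assumes D [measurable]: "D \<in> events" and ym [measurable]: "\<And>t. y t \<in> measurable M M"
    and B [measurable]: "B \<in> events"
  defines "Y \<equiv> \<lambda>\<omega> x. \<Sum>t<N. indicator D (sample_map \<omega> (y t x)) - prob D"
  shows "integrable (samples \<Otimes>\<^sub>M M) (\<lambda>(\<omega>, x). indicator B x * (Y \<omega> x)\<^sup>2)"
    and "(\<integral>\<omega>. (\<integral>x. indicator B x * (Y \<omega> x)\<^sup>2 \<partial>M) \<partial>samples) \<le>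
      (\<Sum>t<N. \<Sum>t'<N. prob {x\<in>B. \<not> (y t x \<in> W \<and> y t' x \<in> W \<and> \<kappa> (y t x) \<noteq> \<kappa> (y t' x))})"
proof -
  interpret Q: prob_space samples by (rule prob_space_samples)
  interpret QM: pair_prob_space samples M by standard
  have [measurable]: "(\<lambda>p. sample_map (fst p) (y t (snd p))) \<in> measurable (samples \<Otimes>\<^sub>M M) M" for t
    by (rule random_map_measurable) measurable
  have [measurable]: "(\<lambda>p. Y (fst p) (snd p)) \<in> borel_measurable (samples \<Otimes>\<^sub>M M)"
    unfolding Y_def by measurable
  have ind1: "\<bar>indicator D z - prob D\<bar> \<le> 1" for z
    using prob_le_1[of D] measure_nonneg[of M D] by (auto simp: indicator_def)
  have Y1: "\<bar>Y \<omega> x\<bar> \<le> real N" for \<omega> x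
  proof -
    have "\<bar>Y \<omega> x\<bar> \<le> (\<Sum>t<N. \<bar>indicator D (sample_map \<omega> (y t x)) - prob D\<bar>)" unfolding Y_def by (rule sum_abs)
    also have "\<dots> \<le> (\<Sum>t<N. 1)" by (rule sum_mono) (rule ind1)
    finally show ?thesis by simp
  qed
  have Y2: "(Y \<omega> x)\<^sup>2 \<le> (real N)\<^sup>2" for \<omega> x using Y1[of \<omega> x] by (simp add: abs_le_square_iff[symmetric])
  show int: "integrable (samples \<Otimes>\<^sub>M M) (\<lambda>(\<omega>, x). indicator B x * (Y \<omega> x)\<^sup>2)"
    by (rule QM.integrable_const_bound[where B = "(real N)\<^sup>2"])
      (use Y2 in \<open>auto simp: indicator_def split_beta'\<close>)
  let ?bad = "\<lambda>t t'. {x\<in>B. \<not> (y t x \<in> W \<and> y t' x \<in> W \<and> \<kappa> (y t x) \<noteq> \<kappa> (y t' x))}"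
  have base_space: "B \<subseteq> space M" by (rule sets.sets_into_space[OF B])
  have badm: "?bad t t' \<in> events" for t t'
  proof -
    have k: "\<kappa> \<in> measurable M (count_space UNIV)"
      by (rule measurable_compose[OF \<kappa>, of "\<lambda>k. k"]) simp
    define k1 where "k1 t x = \<kappa> (y t x)" for t x
    have [measurable]: "k1 t \<in> measurable M (count_space UNIV)" for t
      unfolding k1_def by (rule measurable_compose[OF ym k])
    have "{x\<in>space M. x \<in> B \<and> \<not> (y t x \<in> W \<and> y t' x \<in> W \<and> k1 t x \<noteq> k1 t' x)} \<in> events" by measurable
    moreover have "{x\<in>space M. x \<in> B \<and> \<not> (y t x \<in> W \<and> y t' x \<in> W \<and> k1 t x \<noteq> k1 t' x)} = ?bad t t'"
      using base_space by (auto simp: k1_def)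
    ultimately show ?thesis by metis
  qed
  have pt: "(\<integral>\<omega>. indicator B x * (Y \<omega> x)\<^sup>2 \<partial>samples) \<le> (\<Sum>t<N. \<Sum>t'<N. indicator (?bad t t') x)"
    if x: "x \<in> space M" for x
  proof (cases "x \<in> B")
    case True
    have yx: "y t x \<in> space M" for t using measurable_space[OF ym x] .
    have [measurable]: "(\<lambda>\<omega>. sample_map \<omega> (y t x)) \<in> measurable samples M" for t
      by (rule random_map_measurable) (use yx in auto)
    define f where "f t \<omega> = indicator D (sample_map \<omega> (y t x)) - prob D" for t \<omega>
    have fm [measurable]: "f t \<in> borel_measurable samples" for t unfolding f_def by measurable
    have f1: "\<bar>f t \<omega> * f t' \<omega>\<bar> \<le> 1" for t t' \<omega>
      using mult_mono[OF ind1 ind1] by (simp add: f_def abs_mult)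
    have fi: "integrable samples (\<lambda>\<omega>. f t \<omega> * f t' \<omega>)" for t t'
      by (rule Q.integrable_const_bound[where B = 1]) (use f1 in auto)
    have "(\<integral>\<omega>. indicator B x * (Y \<omega> x)\<^sup>2 \<partial>samples) = (\<integral>\<omega>. (\<Sum>t<N. \<Sum>t'<N. f t \<omega> * f t' \<omega>) \<partial>samples)"
      using True by (simp add: Y_def f_def power2_eq_square sum_product)
    also have "\<dots> = (\<Sum>t<N. \<Sum>t'<N. \<integral>\<omega>. f t \<omega> * f t' \<omega> \<partial>samples)"
      using fi by (simp add: Bochner_Integration.integral_sum)
    also have "\<dots> \<le> (\<Sum>t<N. \<Sum>t'<N. indicator (?bad t t') x)"
    proof (intro sum_mono)
      fix t t'
      show "(\<integral>\<omega>. f t \<omega> * f t' \<omega> \<partial>samples) \<le> indicator (?bad t t') x"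
      proof (cases "x \<in> ?bad t t'")
        case True
        have "(\<integral>\<omega>. f t \<omega> * f t' \<omega> \<partial>samples) \<le> (\<integral>\<omega>. 1 \<partial>samples)"
          by (rule integral_mono[OF fi]) (use abs_le_D1[OF f1] in auto)
        then show ?thesis using True Q.prob_space by simp
      next
        case False
        then have "(\<integral>\<omega>. f t \<omega> * f t' \<omega> \<partial>samples) = 0"
          unfolding f_def using random_map_uncorrelated[OF D _ yx _ yx] \<open>x \<in> B\<close> by auto
        then show ?thesis by simp
      qed
    qed
    finally show ?thesis .
  qed (auto intro!: sum_nonneg)
  have "(\<integral>\<omega>. (\<integral>x. indicator B x * (Y \<omega> x)\<^sup>2 \<partial>M) \<partial>samples) = (\<integral>x. (\<integral>\<omega>. indicator B x * (Y \<omega> x)\<^sup>2 \<partial>samples) \<partial>M)"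
    by (rule QM.Fubini_integral[symmetric, of "\<lambda>\<omega> x. indicator B x * (Y \<omega> x)\<^sup>2"]) (rule int)
  also have "\<dots> \<le> (\<integral>x. (\<Sum>t<N. \<Sum>t'<N. indicator (?bad t t') x) \<partial>M)"
  proof (rule integral_mono[OF _ _ pt])
    show "integrable M (\<lambda>x. \<integral>\<omega>. indicator B x * (Y \<omega> x)\<^sup>2 \<partial>samples)"
      by (rule QM.integrable_snd[OF int])
    show "integrable M (\<lambda>x. \<Sum>t<N. \<Sum>t'<N. indicator (?bad t t') x :: real)"
      using badm by (intro Bochner_Integration.integrable_sum integrable_real_indicator) (auto simp: emeasure_eq_measure)
  qed
  also have "\<dots> = (\<Sum>t<N. \<Sum>t'<N. prob (?bad t t'))"
  proof -
    have "integrable M (indicator (?bad t t') :: _ \<Rightarrow> real)" for t t'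
      using badm by (intro integrable_real_indicator) (auto simp: emeasure_eq_measure)
    moreover have "?bad t t' \<inter> space M = ?bad t t'" for t t' using base_space by auto
    ultimately show ?thesis by (simp add: Bochner_Integration.integral_sum)
  qed
  finally show "(\<integral>\<omega>. (\<integral>x. indicator B x * (Y \<omega> x)\<^sup>2 \<partial>M) \<partial>samples) \<le> (\<Sum>t<N. \<Sum>t'<N. prob (?bad t t'))" .
qed

text \<open>
  Some \<open>\<omega>\<close> does at least as well as the average, for all indices at once. The
  first moment is bounded by the second through \<open>\<bar>Y\<bar> \<le> d + Y\<^sup>2 /
  d\<close>.
\<close>

lemma good_sample:
  fixes y :: "'i \<Rightarrow> nat \<Rightarrow> 'a \<Rightarrow> 'a" and D :: "'i \<Rightarrow> 'a set"
  assumes \<Lambda>: "finite \<Lambda>" and D [measurable]: "\<And>i. i \<in> \<Lambda> \<Longrightarrow> D i \<in> events"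
    and ym [measurable]: "\<And>i t. i \<in> \<Lambda> \<Longrightarrow> y i t \<in> measurable M M"
    and B [measurable]: "B \<in> events" and d: "d > 0"
    and bad: "\<And>i. i \<in> \<Lambda> \<Longrightarrow> (\<Sum>t<N. \<Sum>t'<N.
        prob {x\<in>B. \<not> (y i t x \<in> W \<and> y i t' x \<in> W \<and> \<kappa> (y i t x) \<noteq> \<kappa> (y i t' x))}) \<le> c"
  shows "\<exists>\<omega>\<in>space samples. (\<Sum>i\<in>\<Lambda>. \<integral>x. indicator B x * \<bar>\<Sum>t<N. indicator (D i) (sample_map \<omega> (y i t x)) - prob (D i)\<bar> \<partial>M)
      \<le> real (card \<Lambda>) * (d * prob B + c / d)"
proof -
  interpret Q: prob_space samples by (rule prob_space_samples)
  interpret QM: pair_prob_space samples M by standard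
  define Y where "Y i \<omega> x = (\<Sum>t<N. indicator (D i) (sample_map \<omega> (y i t x)) - prob (D i))" for i \<omega> x
  have int: "integrable (samples \<Otimes>\<^sub>M M) (\<lambda>(\<omega>, x). indicator B x * (Y i \<omega> x)\<^sup>2)" if "i \<in> \<Lambda>" for i
    unfolding Y_def by (rule random_map_second_moment(1)[OF D[OF that] ym[OF that] B])
  have bd: "(\<integral>\<omega>. (\<integral>x. indicator B x * (Y i \<omega> x)\<^sup>2 \<partial>M) \<partial>samples) \<le> c" if "i \<in> \<Lambda>" for i
    unfolding Y_def by (rule order_trans[OF random_map_second_moment(2)[OF D[OF that] ym[OF that] B] bad[OF that]])
  have int1: "integrable samples (\<lambda>\<omega>. \<integral>x. indicator B x * (Y i \<omega> x)\<^sup>2 \<partial>M)" if "i \<in> \<Lambda>" for i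
    by (rule QM.integrable_fst[OF int[OF that]])
  define V where "V \<omega> = (\<Sum>i\<in>\<Lambda>. \<integral>x. indicator B x * (Y i \<omega> x)\<^sup>2 \<partial>M)" for \<omega>
  have Vi: "integrable samples V" unfolding V_def using int1 by (rule Bochner_Integration.integrable_sum)
  have "(\<integral>\<omega>. V \<omega> \<partial>samples) = (\<Sum>i\<in>\<Lambda>. \<integral>\<omega>. (\<integral>x. indicator B x * (Y i \<omega> x)\<^sup>2 \<partial>M) \<partial>samples)"
    unfolding V_def using int1 by (rule Bochner_Integration.integral_sum)
  also have "\<dots> \<le> (\<Sum>i\<in>\<Lambda>. c)" by (rule sum_mono) (rule bd)
  finally have EV: "(\<integral>\<omega>. V \<omega> \<partial>samples) \<le> real (card \<Lambda>) * c" by simp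
  obtain \<omega> where \<omega>: "\<omega> \<in> space samples" "V \<omega> \<le> real (card \<Lambda>) * c"
  proof (rule ccontr)
    assume "\<not> thesis"
    then have "\<And>\<omega>. \<omega> \<in> space samples \<Longrightarrow> real (card \<Lambda>) * c < V \<omega>" using that by (meson not_less)
    then have "real (card \<Lambda>) * c < (\<integral>\<omega>. V \<omega> \<partial>samples)"
      using Vi by (intro Q.expectation_greater) auto
    then show False using EV by simp
  qed
  have "(\<integral>x. indicator B x * \<bar>Y i \<omega> x\<bar> \<partial>M) \<le> d * prob B + (\<integral>x. indicator B x * (Y i \<omega> x)\<^sup>2 \<partial>M) / d"
    if i: "i \<in> \<Lambda>" for i
  proof -
    have "(\<lambda>x. sample_map \<omega> (y i t x)) \<in> measurable M M" for t
      by (rule random_map_measurable) (use \<omega> i in auto)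
    note [measurable] = this
    have Ym [measurable]: "Y i \<omega> \<in> borel_measurable M" unfolding Y_def using i by measurable
    have Y1: "\<bar>Y i \<omega> x\<bar> \<le> real N" for x
    proof -
      have "\<bar>Y i \<omega> x\<bar> \<le> (\<Sum>t<N. \<bar>indicator (D i) (sample_map \<omega> (y i t x)) - prob (D i)\<bar>)" unfolding Y_def by (rule sum_abs)
      also have "\<dots> \<le> (\<Sum>t<N. 1)"
        by (rule sum_mono) (use prob_le_1[of "D i"] measure_nonneg[of M "D i"] in \<open>auto simp: indicator_def\<close>)
      finally show ?thesis by simp
    qed
    have i1: "integrable M (\<lambda>x. indicator B x * \<bar>Y i \<omega> x\<bar>)"
      by (rule integrable_const_bound[where B = "real N"]) (use Y1 in \<open>auto simp: indicator_def\<close>)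
    have Y2: "(Y i \<omega> x)\<^sup>2 \<le> (real N)\<^sup>2" for x using Y1[of x] by (simp add: abs_le_square_iff[symmetric])
    have i2: "integrable M (\<lambda>x. indicator B x * (Y i \<omega> x)\<^sup>2)"
      by (rule integrable_const_bound[where B = "(real N)\<^sup>2"]) (use Y2 in \<open>auto simp: indicator_def\<close>)
    have i3: "integrable M (indicator B :: _ \<Rightarrow> real)" by (rule integrable_real_indicator) (auto simp: emeasure_eq_measure)
    have "(\<integral>x. indicator B x * \<bar>Y i \<omega> x\<bar> \<partial>M) \<le> (\<integral>x. d * indicator B x + (indicator B x * (Y i \<omega> x)\<^sup>2) / d \<partial>M)"
    proof (rule integral_mono[OF i1])
      show "integrable M (\<lambda>x. d * indicator B x + indicator B x * (Y i \<omega> x)\<^sup>2 / d)" using i2 i3 by auto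
      fix x
      have "\<bar>Y i \<omega> x\<bar> \<le> d + (Y i \<omega> x)\<^sup>2 / d"
      proof (cases "\<bar>Y i \<omega> x\<bar> \<le> d")
        case True
        moreover have "0 \<le> (Y i \<omega> x)\<^sup>2 / d" using d by simp
        ultimately show ?thesis by linarith
      next
        case False
        then have "d * \<bar>Y i \<omega> x\<bar> \<le> \<bar>Y i \<omega> x\<bar> * \<bar>Y i \<omega> x\<bar>" by (intro mult_right_mono) auto
        then have "\<bar>Y i \<omega> x\<bar> \<le> (Y i \<omega> x)\<^sup>2 / d" using d by (simp add: field_simps power2_eq_square)
        then show ?thesis using d by linarith
      qed
      then show "indicator B x * \<bar>Y i \<omega> x\<bar> \<le> d * indicator B x + indicator B x * (Y i \<omega> x)\<^sup>2 / d"
        by (auto simp: indicator_def)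
    qed
    also have "\<dots> = d * prob B + (\<integral>x. indicator B x * (Y i \<omega> x)\<^sup>2 \<partial>M) / d"
      using i2 i3 B by (subst Bochner_Integration.integral_add) auto
    finally show ?thesis .
  qed
  then have "(\<Sum>i\<in>\<Lambda>. \<integral>x. indicator B x * \<bar>Y i \<omega> x\<bar> \<partial>M) \<le> (\<Sum>i\<in>\<Lambda>. d * prob B + (\<integral>x. indicator B x * (Y i \<omega> x)\<^sup>2 \<partial>M) / d)"
    by (rule sum_mono)
  also have "\<dots> = real (card \<Lambda>) * (d * prob B) + V \<omega> / d"
    by (simp add: V_def sum.distrib sum_divide_distrib)
  also have "\<dots> \<le> real (card \<Lambda>) * (d * prob B) + (real (card \<Lambda>) * c) / d"
    using \<omega>(2) d by (intro add_left_mono divide_right_mono) auto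
  also have "\<dots> = real (card \<Lambda>) * (d * prob B + c / d)" by (simp add: algebra_simps)
  finally show ?thesis using \<omega>(1) by (intro bexI[of _ \<omega>]) (simp_all add: Y_def)
qed

end

end

section \<open>Permuting the columns of a tower\<close>

text \<open>
  For each label \<open>e\<close> match as many positions with \<open>f t = e\<close> as possible
  with positions where \<open>h\<close> equals \<open>e\<close>, and extend the resulting partial
  injection to a permutation. What remains unmatched is the excess of one count over the other.
\<close>

lemma matching_permutation:
  fixes f h :: "nat \<Rightarrow> 'e"
  assumes E: "finite E" and f: "\<And>t. t < N \<Longrightarrow> f t \<in> E" and h: "\<And>t. t < N \<Longrightarrow> h t \<in> E"
  shows "\<exists>\<sigma>. bij_betw \<sigma> {..<N} {..<N} \<and> real (card {t. t < N \<and> f t \<noteq> h (\<sigma> t)}) \<le>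
    (\<Sum>e\<in>E. \<bar>real (card {t. t < N \<and> f t = e}) - real (card {t. t < N \<and> h t = e})\<bar>)"
proof -
  define A where "A e = {t. t < N \<and> f t = e}" for e
  define B where "B e = {t. t < N \<and> h t = e}" for e
  define m where "m e = min (card (A e)) (card (B e))" for e
  have fin: "finite (A e)" "finite (B e)" for e by (auto simp: A_def B_def)
  have "\<forall>e. \<exists>A'. A' \<subseteq> A e \<and> card A' = m e" by (metis m_def min.cobounded1 obtain_subset_with_card_n)
  then obtain A' where A': "\<And>e. A' e \<subseteq> A e" "\<And>e. card (A' e) = m e" by metis
  have "\<forall>e. \<exists>B'. B' \<subseteq> B e \<and> card B' = m e" by (metis m_def min.cobounded2 obtain_subset_with_card_n)
  then obtain B' where B': "\<And>e. B' e \<subseteq> B e" "\<And>e. card (B' e) = m e" by metis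
  have A'D: "f t = e" "t < N" if "t \<in> A' e" for t e using A'(1)[of e] that by (auto simp: A_def)
  have B'D: "h t = e" "t < N" if "t \<in> B' e" for t e using B'(1)[of e] that by (auto simp: B_def)
  have fin': "finite (A' e)" "finite (B' e)" for e using fin A' B' finite_subset by metis+
  have "\<exists>k. bij_betw k (A' e) (B' e)" for e
    by (rule finite_same_card_bij[OF fin'(1) fin'(2)]) (simp add: A' B')
  then obtain k where k: "\<And>e. bij_betw (k e) (A' e) (B' e)" by metis
  define AA where "AA = (\<Union>e\<in>E. A' e)"
  define BB where "BB = (\<Union>e\<in>E. B' e)"
  have AAf: "t \<in> A' (f t)" "f t \<in> E" "t < N" if "t \<in> AA" for t using that A'D by (auto simp: AA_def)
  have BBh: "t \<in> B' (h t)" "h t \<in> E" "t < N" if "t \<in> BB" for t using that B'D by (auto simp: BB_def)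
  have b1: "bij_betw (\<lambda>t. k (f t) t) AA BB"
  proof (rule bij_betw_byWitness[where f' = "\<lambda>t. the_inv_into (A' (h t)) (k (h t)) t"])
    have kB: "k (f t) t \<in> B' (f t)" if "t \<in> AA" for t
      using AAf[OF that] k[of "f t"] by (auto simp: bij_betw_def)
    have hk: "h (k (f t) t) = f t" if "t \<in> AA" for t using kB[OF that] B'D by auto
    show "\<forall>t\<in>AA. the_inv_into (A' (h (k (f t) t))) (k (h (k (f t) t))) (k (f t) t) = t"
      using hk AAf k by (simp add: the_inv_into_f_f bij_betw_def)
    have iA: "the_inv_into (A' (h t)) (k (h t)) t \<in> A' (h t)" if "t \<in> BB" for t
      using BBh[OF that] k[of "h t"] the_inv_into_into[of "k (h t)" "A' (h t)" t "A' (h t)"]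
      by (auto simp: bij_betw_def)
    have fi: "f (the_inv_into (A' (h t)) (k (h t)) t) = h t" if "t \<in> BB" for t using iA[OF that] A'D by auto
    show "\<forall>t\<in>BB. k (f (the_inv_into (A' (h t)) (k (h t)) t)) (the_inv_into (A' (h t)) (k (h t)) t) = t"
      using fi BBh k by (simp add: f_the_inv_into_f bij_betw_def)
    show "(\<lambda>t. k (f t) t) ` AA \<subseteq> BB" using kB AAf by (auto simp: BB_def)
    show "(\<lambda>t. the_inv_into (A' (h t)) (k (h t)) t) ` BB \<subseteq> AA" using iA BBh by (auto simp: AA_def)
  qed
  have AAN: "AA \<subseteq> {..<N}" "BB \<subseteq> {..<N}" using AAf BBh by auto
  have "card AA = card BB" using b1 by (rule bij_betw_same_card)
  then have "card ({..<N} - AA) = card ({..<N} - BB)" using AAN by (simp add: card_Diff_subset finite_subset)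
  then obtain r where r: "bij_betw r ({..<N} - AA) ({..<N} - BB)"
    using finite_same_card_bij[of "{..<N} - AA" "{..<N} - BB"] by auto
  define \<sigma> where "\<sigma> t = (if t \<in> AA then k (f t) t else r t)" for t
  have "bij_betw \<sigma> (AA \<union> ({..<N} - AA)) (BB \<union> ({..<N} - BB))"
  proof (rule bij_betw_combine)
    show "bij_betw \<sigma> AA BB" using b1 by (rule bij_betw_cong[THEN iffD1, rotated]) (auto simp: \<sigma>_def)
    show "bij_betw \<sigma> ({..<N} - AA) ({..<N} - BB)" using r by (rule bij_betw_cong[THEN iffD1, rotated]) (auto simp: \<sigma>_def)
  qed auto
  then have bij: "bij_betw \<sigma> {..<N} {..<N}" using AAN by (simp add: Un_absorb1)
  have good: "f t = h (\<sigma> t)" if "t \<in> AA" for t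
  proof -
    have "\<sigma> t \<in> B' (f t)" using that AAf[OF that] k[of "f t"] by (auto simp: \<sigma>_def bij_betw_def)
    then show ?thesis using B'D by auto
  qed
  have dA: "A' i \<inter> A' i' = {}" if "i \<noteq> i'" for i i' by (metis A'D(1) disjoint_iff that)
  have cAA: "card AA = (\<Sum>e\<in>E. m e)"
    unfolding AA_def using A'(2) dA fin' E by (subst card_UN_disjoint) auto
  have cN: "N = (\<Sum>e\<in>E. card (A e))"
  proof -
    have "{..<N} = (\<Union>e\<in>E. A e)" using f by (auto simp: A_def)
    then have "card {..<N} = (\<Sum>e\<in>E. card (A e))" using fin E by (simp, subst card_UN_disjoint) (auto simp: A_def)
    then show ?thesis by simp
  qed
  have "{t. t < N \<and> f t \<noteq> h (\<sigma> t)} \<subseteq> {..<N} - AA" using good by auto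
  then have "card {t. t < N \<and> f t \<noteq> h (\<sigma> t)} \<le> card ({..<N} - AA)" by (intro card_mono) auto
  also have "\<dots> = N - card AA" using AAN by (simp add: card_Diff_subset finite_subset)
  finally have "card {t. t < N \<and> f t \<noteq> h (\<sigma> t)} \<le> N - card AA" .
  moreover have "card AA \<le> N" using card_mono[OF _ AAN(1)] by simp
  ultimately have "real (card {t. t < N \<and> f t \<noteq> h (\<sigma> t)}) \<le> real N - real (card AA)" by linarith
  also have "\<dots> = (\<Sum>e\<in>E. real (card (A e)) - real (m e))"
    unfolding sum_subtractf of_nat_sum[symmetric] cAA[symmetric] cN[symmetric] ..
  also have "\<dots> \<le> (\<Sum>e\<in>E. \<bar>real (card (A e)) - real (card (B e))\<bar>)"
    by (rule sum_mono) (auto simp: m_def min_def)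
  finally show ?thesis using bij unfolding A_def B_def by blast
qed

text \<open>
  A Rokhlin tower with base \<open>B\<close> and height \<open>N\<close>. The part of an orbit above
  one base point is called a column.
\<close>

locale tower = prob_space M for M :: "'a measure" +
  fixes U :: "'a \<Rightarrow> 'a" and B :: "'a set" and N :: nat
  assumes U: "U \<in> mp_automorphisms M" and B [measurable]: "B \<in> events"
    and disj: "\<And>x k. x \<in> B \<Longrightarrow> 0 < k \<Longrightarrow> k < N \<Longrightarrow> (U ^^ k) x \<notin> B"
begin

definition "tower_set = (\<Union>k<N. (U ^^ k) ` B)"
definition "level y = (LEAST r. y \<in> (U ^^ r) ` B)"
definition "base y = minv M (U ^^ level y) y"

lemma U_funpow: "(U ^^ k) \<in> mp_automorphisms M" by (rule mp_aut_funpow[OF U])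

lemma base_space: "x \<in> B \<Longrightarrow> x \<in> space M" using sets.sets_into_space[OF B] by auto

lemma Uadd: "(U ^^ i) ((U ^^ k) x) = (U ^^ (i + k)) x" by (simp add: funpow_add)

lemma unique:
  assumes "x \<in> B" "x' \<in> B" "t < N" "t' < N" "(U ^^ t) x = (U ^^ t') x'"
  shows "t = t'" "x = x'"
proof -
  have *: "t = t' \<and> x = x'" if "x \<in> B" "x' \<in> B" "t < N" "t' < N" "(U ^^ t) x = (U ^^ t') x'" "t \<le> t'" for x x' t t'
  proof -
    have "(U ^^ t) x = (U ^^ t) ((U ^^ (t' - t)) x')" using that by (simp add: Uadd)
    then have x: "x = (U ^^ (t' - t)) x'" using that base_space mp_aut_space[OF U_funpow] mp_aut_inj[OF U_funpow] by metis
    have "t' - t < N" using that by linarith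
    then have "\<not> 0 < t' - t" using disj[of x' "t' - t"] that x by blast
    then have "t = t'" using that by linarith
    then show ?thesis using x by simp
  qed
  show "t = t'" "x = x'" using *[OF assms] *[OF assms(2,1,4,3) assms(5)[symmetric]] nle_le by blast+
qed

lemma image_sets [measurable]: "C \<in> events \<Longrightarrow> (U ^^ k) ` C \<in> events"
  by (rule mp_aut_image_sets(1)[OF U_funpow])

lemma tower_set_sets [measurable]: "tower_set \<in> events" unfolding tower_set_def by measurable

lemma tower_set_space: "y \<in> tower_set \<Longrightarrow> y \<in> space M" using sets.sets_into_space[OF tower_set_sets] by auto

lemma tower_setI: "x \<in> B \<Longrightarrow> t < N \<Longrightarrow> (U ^^ t) x \<in> tower_set" by (auto simp: tower_set_def)

lemma level_base:
  assumes "x \<in> B" "t < N" shows "level ((U ^^ t) x) = t" "base ((U ^^ t) x) = x"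
proof -
  show 1: "level ((U ^^ t) x) = t"
    unfolding level_def
  proof (rule Least_equality)
    fix r assume "(U ^^ t) x \<in> (U ^^ r) ` B"
    then obtain x' where "x' \<in> B" "(U ^^ t) x = (U ^^ r) x'" by auto
    then show "t \<le> r" using unique[of x x' t r] assms by (cases "r < N") auto
  qed (use assms in auto)
  show "base ((U ^^ t) x) = x" unfolding base_def 1 using minv_left[OF U_funpow base_space[OF assms(1)]] .
qed

lemma tower_setE:
  assumes "y \<in> tower_set" obtains "base y \<in> B" "level y < N" "y = (U ^^ level y) (base y)"
proof -
  obtain t x where "x \<in> B" "t < N" "y = (U ^^ t) x" using assms by (auto simp: tower_set_def)
  then show ?thesis using level_base[of x t] that by auto
qed

lemma level_measurable [measurable]: "level \<in> measurable M (count_space UNIV)"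
  unfolding level_def by measurable

lemma base_measurable [measurable]: "base \<in> measurable M M"
  unfolding base_def
  by (rule measurable_compose_countable[OF _ level_measurable]) (rule mp_aut_minv_measurable[OF U_funpow])

lemma tower_sum:
  assumes Z [measurable]: "Z \<in> events"
  shows "(\<Sum>t<N. prob {x\<in>B. (U ^^ t) x \<in> Z}) = prob (tower_set \<inter> Z)"
proof -
  have [measurable]: "(U ^^ t) \<in> measurable M M" for t by (rule mp_aut_measurable[OF U_funpow])
  have m: "{x\<in>B. (U ^^ t) x \<in> Z} \<in> events" for t
  proof -
    have "{x\<in>B. (U ^^ t) x \<in> Z} = {x\<in>space M. x \<in> B \<and> (U ^^ t) x \<in> Z}" using base_space by auto
    then show ?thesis by simp
  qed
  have "tower_set \<inter> Z = (\<Union>t<N. (U ^^ t) ` {x\<in>B. (U ^^ t) x \<in> Z})" by (auto simp: tower_set_def)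
  also have "prob \<dots> = (\<Sum>t<N. prob ((U ^^ t) ` {x\<in>B. (U ^^ t) x \<in> Z}))"
  proof (rule finite_measure_finite_Union)
    show "disjoint_family_on (\<lambda>t. (U ^^ t) ` {x\<in>B. (U ^^ t) x \<in> Z}) {..<N}"
      unfolding disjoint_family_on_def using unique by fastforce
  qed (use m in auto)
  finally show ?thesis using mp_aut_image_sets(2)[OF U_funpow m] by simp
qed

lemma base_prob: "real N * prob B = prob tower_set"
  using tower_sum[OF sets.top] mp_aut_space[OF U_funpow] base_space tower_set_space by (simp add: Int_absorb2 subset_eq cong: conj_cong)

lemma base_small: "real N * prob B \<le> 1" using base_prob prob_le_1 by simp

text \<open>
  An element of the full group of \<open>U\<close> that permutes every column as prescribed. It
  agrees with one of the finitely many automorphisms \<open>U ^^ u \<circ> inv (U ^^ t)\<close> on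
  each of finitely many pieces.
\<close>

lemma column_permutation:
  assumes bij: "\<And>x. x \<in> B \<Longrightarrow> bij_betw (\<sigma> x) {..<N} {..<N}"
    and m: "\<And>t u. t < N \<Longrightarrow> u < N \<Longrightarrow> {x\<in>B. \<sigma> x t = u} \<in> events"
  shows "\<exists>\<psi>\<in>mp_automorphisms M. (\<forall>x\<in>B. \<forall>t<N. \<psi> ((U ^^ t) x) = (U ^^ \<sigma> x t) x) \<and>
     (\<forall>y\<in>space M. \<exists>x\<in>space M. \<exists>t u. y = (U ^^ t) x \<and> \<psi> y = (U ^^ u) x)"
proof -
  define k where "k y = (if y \<in> tower_set then (level y, \<sigma> (base y) (level y)) else (0, 0))" for y
  define X where "X p = (U ^^ snd p) \<circ> minv M (U ^^ fst p)" for p :: "nat \<times> nat"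
  define \<psi> where "\<psi> y = X (k y) y" for y
  have on: "\<psi> ((U ^^ t) x) = (U ^^ \<sigma> x t) x" if "x \<in> B" "t < N" for x t
    using that level_base[OF that] tower_setI[OF that] minv_left[OF U_funpow base_space[OF that(1)]] by (simp add: \<psi>_def k_def X_def)
  have off: "\<psi> y = y" if "y \<notin> tower_set" "y \<in> space M" for y
    using that minv_left[OF U_funpow that(2), of 0] by (simp add: \<psi>_def k_def X_def)
  have \<sigma>N: "\<sigma> x t < N" if "x \<in> B" "t < N" for x t
    using bij[OF that(1)] that(2) by (auto simp: bij_betw_def)
  have km: "k \<in> measurable M (count_space UNIV)"
    unfolding measurable_count_space_eq2_countable
  proof (intro conjI ballI)
    fix p :: "nat \<times> nat"
    obtain t u where p: "p = (t, u)" by (cases p)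
    have "k -` {p} \<inter> space M = (if t < N \<and> u < N then (U ^^ t) ` {x\<in>B. \<sigma> x t = u} else {})
        \<union> (if p = (0, 0) then space M - tower_set else {})" (is "?L = ?R")
    proof (rule Set.set_eqI)
      fix y
      show "y \<in> ?L \<longleftrightarrow> y \<in> ?R"
      proof (cases "y \<in> tower_set")
        case True
        then obtain t' x where y: "x \<in> B" "t' < N" "y = (U ^^ t') x" by (auto simp: tower_set_def)
        have "k y = (t', \<sigma> x t')" using True y level_base[OF y(1,2)] by (simp add: k_def)
        moreover have "y \<in> (U ^^ t) ` {x\<in>B. \<sigma> x t = u} \<longleftrightarrow> t = t' \<and> \<sigma> x t' = u" if "t < N"
        proof
          assume "y \<in> (U ^^ t) ` {x\<in>B. \<sigma> x t = u}"
          then obtain x' where "x' \<in> B" "\<sigma> x' t = u" "y = (U ^^ t) x'" by auto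
          then show "t = t' \<and> \<sigma> x t' = u" using unique[of x x' t' t] y that by auto
        qed (use y in auto)
        ultimately show ?thesis using True y \<sigma>N[OF y(1,2)] tower_set_space[OF True] by (auto simp: p)
      next
        case False
        moreover have "y \<notin> (U ^^ t) ` {x\<in>B. \<sigma> x t = u}" if "t < N" using False that by (auto simp: tower_set_def)
        ultimately show ?thesis by (auto simp: k_def p)
      qed
    qed
    also have "\<dots> \<in> events" using m by auto
    finally show "k -` {p} \<inter> space M \<in> events" .
  qed auto
  have \<psi>tower_set: "\<psi> y \<in> tower_set" if yc: "y \<in> tower_set" for y
  proof -
    obtain t x where y: "x \<in> B" "t < N" "y = (U ^^ t) x" using yc by (auto simp: tower_set_def)
    then show ?thesis using on \<sigma>N tower_setI by auto
  qed
  have "bij_betw \<psi> (space M) (space M)"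
    unfolding bij_betw_def
  proof
    show "inj_on \<psi> (space M)"
    proof (rule inj_onI)
      fix y y' assume s: "y \<in> space M" "y' \<in> space M" and e: "\<psi> y = \<psi> y'"
      show "y = y'"
      proof -
        consider "y \<in> tower_set" "y' \<in> tower_set" | "y \<notin> tower_set \<or> y' \<notin> tower_set" by blast
        then show ?thesis
      proof cases
        assume "y \<in> tower_set" "y' \<in> tower_set"
        then obtain t x t' x' where y: "x \<in> B" "t < N" "y = (U ^^ t) x" "x' \<in> B" "t' < N" "y' = (U ^^ t') x'"
          by (auto simp: tower_set_def)
        have e': "(U ^^ \<sigma> x t) x = (U ^^ \<sigma> x' t') x'"
          using e on[OF y(1,2)] on[OF y(4,5)] by (simp add: y)
        note unique[OF y(1,4) \<sigma>N[OF y(1,2)] \<sigma>N[OF y(4,5)] e']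
        then have "x = x'" "\<sigma> x t = \<sigma> x' t'" by simp_all
        moreover from this have "t = t'" using bij[OF y(1)] y by (auto simp: bij_betw_def inj_on_def)
        ultimately show ?thesis using y by simp
      next
        assume "y \<notin> tower_set \<or> y' \<notin> tower_set"
        then show ?thesis using e off[OF _ s(1)] off[OF _ s(2)] \<psi>tower_set[of y] \<psi>tower_set[of y'] by auto
      qed
      qed
    qed
    show "\<psi> ` space M = space M"
    proof (intro equalityI subsetI)
      fix y assume "y \<in> \<psi> ` space M"
      then obtain z where "z \<in> space M" "y = \<psi> z" by blast
      then show "y \<in> space M" using off[of z] \<psi>tower_set[of z] tower_set_space by (cases "z \<in> tower_set") auto
    next
      fix y assume s: "y \<in> space M"
      show "y \<in> \<psi> ` space M"
      proof (cases "y \<in> tower_set")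
        case True
        then obtain u x where y: "x \<in> B" "u < N" "y = (U ^^ u) x" by (auto simp: tower_set_def)
        obtain t where t: "t < N" "\<sigma> x t = u" using bij_betw_imp_surj_on[OF bij[OF y(1)]] y(2) by (metis imageE lessThan_iff)
        have "y = \<psi> ((U ^^ t) x)" unfolding on[OF y(1) t(1)] t(2) by (rule y(3))
        moreover have "(U ^^ t) x \<in> space M" by (rule mp_aut_space[OF U_funpow base_space[OF y(1)]])
        ultimately show ?thesis by (rule image_eqI[where f = \<psi> and x = "(U ^^ t) x"])
      next
        case False
        have "y = \<psi> y" using off[OF False s] by (rule sym)
        then show ?thesis using s by (rule image_eqI[where f = \<psi> and x = y])
      qed
    qed
  qed
  moreover have "X p \<in> mp_automorphisms M" for p
    unfolding X_def by (intro mp_aut_comp(1) U_funpow mp_aut_minv)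
  ultimately have "\<psi> \<in> mp_automorphisms M"
    using mp_aut_piecewise[OF km, of X] unfolding \<psi>_def[abs_def] by blast
  moreover have "\<exists>x\<in>space M. \<exists>t u. y = (U ^^ t) x \<and> \<psi> y = (U ^^ u) x" if y: "y \<in> space M" for y
  proof (cases "y \<in> tower_set")
    case True
    then obtain t x where y: "x \<in> B" "t < N" "y = (U ^^ t) x" by (auto simp: tower_set_def)
    then show ?thesis
      using on[OF y(1,2)] base_space[OF y(1)] by (intro bexI[of _ x] exI[of _ t] exI[of _ "\<sigma> x t"]) simp_all
  next
    case False
    then show ?thesis using off[OF _ y] y by (intro bexI[of _ y] exI[of _ 0]) simp_all
  qed
  ultimately show ?thesis using on by blast
qed

end

section \<open>Matching distributions inside the full group\<close>

text \<open>
  The atom of the algebra generated by \<open>\<A>\<close> on which exactly the members of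
  \<open>E\<close> hold.
\<close>

definition cell :: "'a measure \<Rightarrow> 'a set set \<Rightarrow> 'a set set \<Rightarrow> 'a set" where
  "cell M \<A> E = {y\<in>space M. {A\<in>\<A>. y \<in> A} = E}"

lemma cell_sets:
  assumes fin: "finite \<A>" and \<A>: "\<A> \<subseteq> sets M"
  shows "cell M \<A> E \<in> sets M"
proof -
  have "cell M \<A> E = (if E \<subseteq> \<A> then {y\<in>space M. \<forall>A\<in>\<A>. y \<in> A \<longleftrightarrow> A \<in> E} else {})"
    unfolding cell_def by (auto simp: set_eq_iff)
  also have "\<dots> \<in> sets M"
  proof -
    have "{y\<in>space M. y \<in> A \<longleftrightarrow> A \<in> E} \<in> sets M" if "A \<in> \<A>" for A
      using \<A> that by (cases "A \<in> E") auto
    then have "{y\<in>space M. \<forall>A\<in>\<A>. y \<in> A \<longleftrightarrow> A \<in> E} \<in> sets M" by (rule sets.sets_Collect_finite_All[OF _ fin])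
    then show ?thesis by simp
  qed
  finally show ?thesis .
qed

context tower
begin

text \<open>
  How far, integrated over the columns, the number of visits of \<open>\<Phi> \<circ> h\<close> to
  \<open>D\<close> along a column is from its expected value \<open>N * prob D\<close>.
\<close>

definition mean_dev :: "('a \<Rightarrow> 'a) \<Rightarrow> ('a \<Rightarrow> 'a) \<Rightarrow> 'a set \<Rightarrow> real" where
  "mean_dev \<Phi> h D = (\<integral>x. indicator B x * \<bar>\<Sum>t<N. indicator D (\<Phi> (h ((U ^^ t) x))) - prob D\<bar> \<partial>M)"

lemma mean_dev_integrable:
  assumes \<Phi>: "\<Phi> \<in> measurable M M" and h: "h \<in> measurable M M" and D [measurable]: "D \<in> events"
  shows "integrable M (\<lambda>x. indicator B x * (\<Sum>t<N. indicator D (\<Phi> (h ((U ^^ t) x))) - prob D))"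
    and "integrable M (\<lambda>x. indicator B x * \<bar>\<Sum>t<N. indicator D (\<Phi> (h ((U ^^ t) x))) - prob D\<bar>)"
proof -
  have [measurable]: "(\<lambda>x. \<Phi> (h ((U ^^ t) x))) \<in> measurable M M" for t
    by (rule measurable_compose[OF measurable_compose[OF mp_aut_measurable[OF U_funpow] h] \<Phi>])
  define Y where "Y x = (\<Sum>t<N. indicator D (\<Phi> (h ((U ^^ t) x))) - prob D)" for x
  have [measurable]: "Y \<in> borel_measurable M" unfolding Y_def by measurable
  have Y1: "\<bar>Y x\<bar> \<le> real N" for x
  proof -
    have "\<bar>Y x\<bar> \<le> (\<Sum>t<N. \<bar>indicator D (\<Phi> (h ((U ^^ t) x))) - prob D\<bar>)" unfolding Y_def by (rule sum_abs)
    also have "\<dots> \<le> (\<Sum>t<N. 1)"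
      by (rule sum_mono) (use prob_le_1[of D] measure_nonneg[of M D] in \<open>auto simp: indicator_def\<close>)
    finally show ?thesis by simp
  qed
  show "integrable M (\<lambda>x. indicator B x * (\<Sum>t<N. indicator D (\<Phi> (h ((U ^^ t) x))) - prob D))"
    unfolding Y_def[symmetric]
    by (rule integrable_const_bound[where B = "real N"]) (use Y1 in \<open>auto simp: indicator_def\<close>)
  show "integrable M (\<lambda>x. indicator B x * \<bar>\<Sum>t<N. indicator D (\<Phi> (h ((U ^^ t) x))) - prob D\<bar>)"
    unfolding Y_def[symmetric]
    by (rule integrable_const_bound[where B = "real N"]) (use Y1 in \<open>auto simp: indicator_def\<close>)
qed

lemma mean_dev_nonneg: "0 \<le> mean_dev \<Phi> h D"
  unfolding mean_dev_def by (rule Bochner_Integration.integral_nonneg) (auto simp: indicator_def)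

text \<open>
  Summing the visits over all columns gives the measure of the part of the preimage of
  \<open>D\<close> that lies in the tower.
\<close>

lemma mean_dev_marginal:
  assumes \<Phi> [measurable]: "\<Phi> \<in> measurable M M" and D [measurable]: "D \<in> events"
  shows "\<bar>prob {x\<in>space M. \<Phi> x \<in> D} - prob D\<bar> \<le> prob (space M - tower_set) + mean_dev \<Phi> (\<lambda>x. x) D"
proof -
  let ?Z = "{x\<in>space M. \<Phi> x \<in> D}"
  have Zm [measurable]: "?Z \<in> events" by measurable
  have Um [measurable]: "(U ^^ t) \<in> measurable M M" for t by (rule mp_aut_measurable[OF U_funpow])
  have Km [measurable]: "{x\<in>B. (U ^^ t) x \<in> ?Z} \<in> events" for t
  proof -
    have "{x\<in>B. (U ^^ t) x \<in> ?Z} = {x\<in>space M. x \<in> B \<and> (U ^^ t) x \<in> ?Z}" using base_space by auto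
    also have "\<dots> \<in> events" by measurable
    finally show ?thesis .
  qed
  have ri: "integrable M (indicator K :: 'a \<Rightarrow> real)" if "K \<in> events" for K
    using that by (intro integrable_real_indicator) (auto simp: emeasure_eq_measure)
  have eq: "indicator B x * (\<Sum>t<N. indicator D (\<Phi> ((U ^^ t) x)) - prob D)
      = (\<Sum>t<N. indicator {x\<in>B. (U ^^ t) x \<in> ?Z} x - prob D * indicator B x)" for x
    using mp_aut_space[OF U_funpow] base_space by (cases "x \<in> B") (auto simp: indicator_def intro!: sum.cong)
  have "(\<integral>x. indicator B x * (\<Sum>t<N. indicator D (\<Phi> ((U ^^ t) x)) - prob D) \<partial>M)
      = (\<Sum>t<N. prob {x\<in>B. (U ^^ t) x \<in> ?Z} - prob D * prob B)"
    unfolding eq using ri[OF Km] ri[OF B]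
    by (simp add: Bochner_Integration.integral_sum Bochner_Integration.integral_diff B Km)
  also have "\<dots> = prob (tower_set \<inter> ?Z) - prob D * prob tower_set"
    unfolding sum_subtractf tower_sum[OF Zm] base_prob[symmetric] by simp
  finally have "\<bar>prob (tower_set \<inter> ?Z) - prob D * prob tower_set\<bar> = \<bar>\<integral>x. indicator B x * (\<Sum>t<N. indicator D (\<Phi> ((U ^^ t) x)) - prob D) \<partial>M\<bar>"
    by simp
  also have "\<dots> \<le> (\<integral>x. \<bar>indicator B x * (\<Sum>t<N. indicator D (\<Phi> ((U ^^ t) x)) - prob D)\<bar> \<partial>M)"
    by (rule integral_abs_bound)
  also have "\<dots> = mean_dev \<Phi> (\<lambda>x. x) D" unfolding mean_dev_def by (simp add: abs_mult)
  finally have 1: "\<bar>prob (tower_set \<inter> ?Z) - prob D * prob tower_set\<bar> \<le> mean_dev \<Phi> (\<lambda>x. x) D" .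
  have 2: "prob ?Z = prob (tower_set \<inter> ?Z) + prob (?Z - tower_set)"
    using finite_measure_Diff'[of ?Z tower_set] by (simp add: Int_commute)
  have 3: "prob (space M - tower_set) = 1 - prob tower_set" using prob_compl[of tower_set] by simp
  have 4: "prob (?Z - tower_set) \<le> prob (space M - tower_set)" by (rule finite_measure_mono) auto
  have 5: "0 \<le> prob D * prob (space M - tower_set)" "prob D * prob (space M - tower_set) \<le> prob (space M - tower_set)"
    using prob_le_1[of D] measure_nonneg[of M D] by (auto intro!: mult_left_le_one_le)
  have "prob ?Z - prob D = (prob (tower_set \<inter> ?Z) - prob D * prob tower_set) + (prob (?Z - tower_set) - prob D * prob (space M - tower_set))"
    unfolding 2 3 by (simp add: algebra_simps)
  moreover have "\<bar>prob (?Z - tower_set) - prob D * prob (space M - tower_set)\<bar> \<le> prob (space M - tower_set)"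
    using 4 5 measure_nonneg[of M "?Z - tower_set"] by linarith
  ultimately show ?thesis using 1 by linarith
qed

text \<open>
  In the column of \<open>x\<close> the position \<open>t\<close> has a source label, the cell of
  \<open>\<Phi> (inv V (U\<^sup>t x))\<close>, and a target label, the cell of the point obtained
  from \<open>\<Phi> (U\<^sup>t x)\<close> by \<open>inv b\<close>. The map \<open>\<psi>\<close>
  sends positions to positions whose target label equals the given source label; applied to \<open>y
  = V x\<close> this is the required equivalence. Both labels have almost the expected frequency in
  most columns, and \<open>b\<close> preserves the measure, so \<open>matching_permutation\<close>
  leaves few positions unmatched.
\<close>

lemma matched_full_group_element:
  fixes V b \<Phi> :: "'a \<Rightarrow> 'a" and \<A> :: "'a set set"
  assumes \<Phi> [measurable]: "\<Phi> \<in> measurable M M" and V: "V \<in> mp_automorphisms M" and b: "b \<in> mp_automorphisms M"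
    and fin: "finite \<A>" and \<A>: "\<A> \<subseteq> events"
  defines "At \<equiv> cell M \<A>"
  shows "\<exists>\<psi>\<in>mp_automorphisms M. \<exists>Z\<in>events.
     (\<forall>y\<in>space M. \<exists>x\<in>space M. \<exists>t u. y = (U ^^ t) x \<and> \<psi> y = (U ^^ u) x) \<and>
     prob Z \<le> prob (space M - tower_set) + (\<Sum>E\<in>Pow \<A>. mean_dev \<Phi> (minv M V) (At E) + mean_dev \<Phi> (\<lambda>x. x) (b ` At E)) \<and>
     (\<forall>x\<in>space M - Z. \<forall>A\<in>\<A>. \<Phi> x \<in> A \<longleftrightarrow> \<Phi> (\<psi> (V x)) \<in> b ` A)"
proof -
  have Am: "A \<in> events" if "A \<in> \<A>" for A using that \<A> by auto
  have Usp: "x \<in> B \<Longrightarrow> (U ^^ t) x \<in> space M" for t x using mp_aut_space[OF U_funpow] base_space by auto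
  have Um [measurable]: "(U ^^ t) \<in> measurable M M" for t by (rule mp_aut_measurable[OF U_funpow])
  have Vim: "minv M V \<in> measurable M M" by (rule mp_aut_minv_measurable[OF V])
  have \<Phi>sp: "\<Phi> x \<in> space M" if "x \<in> space M" for x using measurable_space[OF \<Phi> that] .
  have bim: "b ` A \<in> events" if "A \<in> events" for A by (rule mp_aut_image_sets(1)[OF b that])
  have binj: "z \<in> space M \<Longrightarrow> z \<in> b ` C \<longleftrightarrow> minv M b z \<in> C" if "C \<subseteq> space M" for z C
    using mp_aut_image[OF b that] by simp
  have Asp: "A \<subseteq> space M" if "A \<in> \<A>" for A using sets.sets_into_space[OF Am[OF that]] .
  have Atm: "At E \<in> events" for E unfolding At_def by (rule cell_sets[OF fin \<A>])
  have Atsp: "At E \<subseteq> space M" for E by (auto simp: At_def cell_def)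
  define src where "src x t = {A\<in>\<A>. \<Phi> (minv M V ((U ^^ t) x)) \<in> A}" for x t
  define tgt where "tgt x t = {A\<in>\<A>. \<Phi> ((U ^^ t) x) \<in> b ` A}" for x t
  \<comment> \<open>The permutation may depend only on the finitely many possible labellings of a column; otherwise
    it need not be measurable in \<open>x\<close>.\<close>
  define F where "F = ({..<N} \<rightarrow>\<^sub>E Pow \<A>)"
  have finF: "finite F" unfolding F_def using fin by (intro finite_PiE) auto
  have "\<exists>\<sigma>. bij_betw \<sigma> {..<N} {..<N} \<and> real (card {t. t < N \<and> f t \<noteq> h (\<sigma> t)}) \<le>
    (\<Sum>e\<in>Pow \<A>. \<bar>real (card {t. t < N \<and> f t = e}) - real (card {t. t < N \<and> h t = e})\<bar>)"
    if "f \<in> F" "h \<in> F" for f h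
    by (rule matching_permutation) (use fin that in \<open>auto simp: F_def PiE_def Pi_def\<close>)
  then have "\<forall>f\<in>F. \<forall>h\<in>F. \<exists>\<sigma>. bij_betw \<sigma> {..<N} {..<N} \<and> real (card {t. t < N \<and> f t \<noteq> h (\<sigma> t)}) \<le>
    (\<Sum>e\<in>Pow \<A>. \<bar>real (card {t. t < N \<and> f t = e}) - real (card {t. t < N \<and> h t = e})\<bar>)" by blast
  then obtain G where "\<forall>f\<in>F. \<forall>h\<in>F. bij_betw (G f h) {..<N} {..<N} \<and> real (card {t. t < N \<and> f t \<noteq> h (G f h t)}) \<le>
    (\<Sum>e\<in>Pow \<A>. \<bar>real (card {t. t < N \<and> f t = e}) - real (card {t. t < N \<and> h t = e})\<bar>)"
    by (subst (asm) bchoice_iff[where S = F], subst (asm) bchoice_iff) (auto simp: bchoice_iff)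
  then have Gbij: "\<And>f h. f \<in> F \<Longrightarrow> h \<in> F \<Longrightarrow> bij_betw (G f h) {..<N} {..<N}"
    and Gcard: "\<And>f h. f \<in> F \<Longrightarrow> h \<in> F \<Longrightarrow> real (card {t. t < N \<and> f t \<noteq> h (G f h t)}) \<le>
    (\<Sum>e\<in>Pow \<A>. \<bar>real (card {t. t < N \<and> f t = e}) - real (card {t. t < N \<and> h t = e})\<bar>)" by auto
  define rs where "rs x = restrict (src x) {..<N}" for x
  define rt where "rt x = restrict (tgt x) {..<N}" for x
  have rsF: "rs x \<in> F" and rtF: "rt x \<in> F" for x by (auto simp: rs_def rt_def F_def src_def tgt_def)
  have cell: "{x\<in>B. rs x = f \<and> rt x = h} \<in> events" if "f \<in> F" "h \<in> F" for f h
  proof -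
    have e: "restrict k {..<N} = f \<longleftrightarrow> (\<forall>s\<in>{..<N}. k s = f s)" if "f \<in> F" for k f
      using that unfolding F_def by (auto simp: fun_eq_iff PiE_def extensional_def)
    have f\<A>: "f s \<subseteq> \<A>" "h s \<subseteq> \<A>" if "s \<in> {..<N}" for s using that \<open>f \<in> F\<close> \<open>h \<in> F\<close> by (auto simp: F_def)
    have 1: "{x\<in>space M. src x s = f s} \<in> events" if s: "s \<in> {..<N}" for s
    proof -
      have "{x\<in>space M. src x s = f s} = {x\<in>space M. \<forall>A\<in>\<A>. \<Phi> (minv M V ((U ^^ s) x)) \<in> A \<longleftrightarrow> A \<in> f s}"
        using f\<A>[OF s] unfolding src_def by (auto simp: set_eq_iff)
      also have "\<dots> \<in> events"
      proof (rule sets.sets_Collect_finite_All[OF _ fin])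
        fix A assume A: "A \<in> \<A>"
        have "{x\<in>space M. \<Phi> (minv M V ((U ^^ s) x)) \<in> A} = (\<lambda>x. \<Phi> (minv M V ((U ^^ s) x))) -` A \<inter> space M" by auto
        also have "\<dots> \<in> events"
          by (rule measurable_sets[OF measurable_compose[OF measurable_compose[OF Um Vim] \<Phi>] Am[OF A]])
        finally show "{x\<in>space M. \<Phi> (minv M V ((U ^^ s) x)) \<in> A \<longleftrightarrow> A \<in> f s} \<in> events"
          by (cases "A \<in> f s") (auto dest: sets.sets_Collect_neg)
      qed
      finally show ?thesis .
    qed
    have 2: "{x\<in>space M. tgt x s = h s} \<in> events" if s: "s \<in> {..<N}" for s
    proof -
      have "{x\<in>space M. tgt x s = h s} = {x\<in>space M. \<forall>A\<in>\<A>. \<Phi> ((U ^^ s) x) \<in> b ` A \<longleftrightarrow> A \<in> h s}"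
        using f\<A>[OF s] unfolding tgt_def by (auto simp: set_eq_iff)
      also have "\<dots> \<in> events"
      proof (rule sets.sets_Collect_finite_All[OF _ fin])
        fix A assume A: "A \<in> \<A>"
        have "{x\<in>space M. \<Phi> ((U ^^ s) x) \<in> b ` A} = (\<lambda>x. \<Phi> ((U ^^ s) x)) -` (b ` A) \<inter> space M" by auto
        also have "\<dots> \<in> events"
          by (rule measurable_sets[OF measurable_compose[OF Um \<Phi>] bim[OF Am[OF A]]])
        finally show "{x\<in>space M. \<Phi> ((U ^^ s) x) \<in> b ` A \<longleftrightarrow> A \<in> h s} \<in> events"
          by (cases "A \<in> h s") (auto dest: sets.sets_Collect_neg)
      qed
      finally show ?thesis .
    qed
    have "{x\<in>B. rs x = f \<and> rt x = h} =
        B \<inter> ({x\<in>space M. \<forall>s\<in>{..<N}. src x s = f s} \<inter> {x\<in>space M. \<forall>s\<in>{..<N}. tgt x s = h s})"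
      unfolding rs_def rt_def e[OF \<open>f \<in> F\<close>] e[OF \<open>h \<in> F\<close>] using base_space by auto
    also have "\<dots> \<in> events" by (intro sets.Int B sets.sets_Collect_finite_All 1 2) auto
    finally show ?thesis .
  qed
  have cellP: "{x\<in>B. P (rs x) (rt x)} \<in> events" for P
  proof -
    have "{x\<in>B. P (rs x) (rt x)} = (\<Union>p\<in>{p\<in>F \<times> F. P (fst p) (snd p)}. {x\<in>B. rs x = fst p \<and> rt x = snd p})"
      using rsF rtF by auto
    also have "\<dots> \<in> events" using finF cell by (intro sets.finite_UN) auto
    finally show ?thesis .
  qed
  define \<sigma> where "\<sigma> x = G (rs x) (rt x)" for x
  have \<sigma>bij: "bij_betw (\<sigma> x) {..<N} {..<N}" for x unfolding \<sigma>_def by (rule Gbij[OF rsF rtF])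
  have \<sigma>N: "\<sigma> x t < N" if "t < N" for x t using \<sigma>bij[of x] that by (auto simp: bij_betw_def)
  have \<sigma>cell: "{x\<in>B. \<sigma> x t = u} \<in> events" for t u
    unfolding \<sigma>_def by (rule cellP)
  obtain \<psi> where \<psi>: "\<psi> \<in> mp_automorphisms M" "\<forall>x\<in>B. \<forall>t<N. \<psi> ((U ^^ t) x) = (U ^^ \<sigma> x t) x"
     "\<forall>y\<in>space M. \<exists>x\<in>space M. \<exists>t u. y = (U ^^ t) x \<and> \<psi> y = (U ^^ u) x"
    using column_permutation[of \<sigma>, OF \<sigma>bij \<sigma>cell] by (elim bexE conjE)
  define K where "K t = {x\<in>B. src x t \<noteq> tgt x (\<sigma> x t)}" for t
  have Km [measurable]: "K t \<in> events" if "t < N" for t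
  proof -
    have "K t = {x\<in>B. rs x t \<noteq> rt x (G (rs x) (rt x) t)}"
      unfolding K_def \<sigma>_def[symmetric] using that \<sigma>N[OF that] by (simp add: rs_def rt_def)
    then show ?thesis using cellP[of "\<lambda>f h. f t \<noteq> h (G f h t)"] by simp
  qed
  define Mis where "Mis = (\<Union>t<N. (U ^^ t) ` K t)"
  have Mism [measurable]: "Mis \<in> events" unfolding Mis_def by (intro sets.finite_UN image_sets Km) auto
  let ?S = "\<lambda>E x. indicator B x * \<bar>\<Sum>t<N. indicator (At E) (\<Phi> (minv M V ((U ^^ t) x))) - prob (At E)\<bar>"
  let ?T = "\<lambda>E x. indicator B x * \<bar>\<Sum>t<N. indicator (b ` At E) (\<Phi> ((U ^^ t) x)) - prob (b ` At E)\<bar>"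
  have Si: "integrable M (?S E)" for E by (rule mean_dev_integrable(2)[OF \<Phi> Vim Atm])
  have Ti: "integrable M (?T E)" for E
    using mean_dev_integrable(2)[OF \<Phi> measurable_ident bim[OF Atm]] by (simp add: id_def)
  have count: "(\<Sum>t<N. indicator (K t) x) \<le> (\<Sum>E\<in>Pow \<A>. ?S E x + ?T E x)" for x
  proof (cases "x \<in> B")
    case True
    have s1: "real (card {t. t < N \<and> rs x t = E}) = (\<Sum>t<N. indicator (At E) (\<Phi> (minv M V ((U ^^ t) x))))" for E
    proof -
      have "real (card {t. t < N \<and> rs x t = E}) = (\<Sum>t<N. if rs x t = E then 1 else 0)"
        by (simp add: sum.If_cases) (rule arg_cong[where f = card], auto)
      also have "\<dots> = (\<Sum>t<N. indicator (At E) (\<Phi> (minv M V ((U ^^ t) x))))"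
        using \<Phi>sp[OF minv_space[OF V Usp[OF True]]]
        by (intro sum.cong) (auto simp: rs_def src_def At_def cell_def indicator_def)
      finally show ?thesis .
    qed
    have bAt: "z \<in> b ` At E \<longleftrightarrow> {A\<in>\<A>. z \<in> b ` A} = E" if "z \<in> space M" for z E
    proof -
      have "{A\<in>\<A>. z \<in> b ` A} = {A\<in>\<A>. minv M b z \<in> A}" using binj[OF Asp that] by auto
      then show ?thesis using binj[OF Atsp that] minv_space[OF b that] by (simp add: At_def cell_def)
    qed
    have s2: "real (card {t. t < N \<and> rt x t = E}) = (\<Sum>t<N. indicator (b ` At E) (\<Phi> ((U ^^ t) x)))" for E
    proof -
      have "real (card {t. t < N \<and> rt x t = E}) = (\<Sum>t<N. if rt x t = E then 1 else 0)"
        by (simp add: sum.If_cases) (rule arg_cong[where f = card], auto)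
      also have "\<dots> = (\<Sum>t<N. indicator (b ` At E) (\<Phi> ((U ^^ t) x)))"
        using bAt[OF \<Phi>sp[OF Usp[OF True]]]
        by (intro sum.cong) (auto simp: rt_def tgt_def indicator_def)
      finally show ?thesis .
    qed
    have "(\<Sum>t<N. indicator (K t) x) = real (card {t. t < N \<and> x \<in> K t})"
      by (simp add: indicator_def sum.If_cases) (rule arg_cong[where f = card], auto)
    also have "{t. t < N \<and> x \<in> K t} = {t. t < N \<and> rs x t \<noteq> rt x (G (rs x) (rt x) t)}"
    proof -
      have "x \<in> K t \<longleftrightarrow> rs x t \<noteq> rt x (\<sigma> x t)" if "t < N" for t
        using True that \<sigma>N[OF that, of x] by (simp add: K_def rs_def rt_def)
      then show ?thesis unfolding \<sigma>_def by auto
    qed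
    also have "real (card \<dots>) \<le> (\<Sum>E\<in>Pow \<A>. \<bar>real (card {t. t < N \<and> rs x t = E}) - real (card {t. t < N \<and> rt x t = E})\<bar>)"
      by (rule Gcard[OF rsF rtF])
    also have "\<dots> \<le> (\<Sum>E\<in>Pow \<A>. ?S E x + ?T E x)"
    proof (rule sum_mono)
      fix E
      have "prob (b ` At E) = prob (At E)" by (rule mp_aut_image_sets(2)[OF b Atm])
      then show "\<bar>real (card {t. t < N \<and> rs x t = E}) - real (card {t. t < N \<and> rt x t = E})\<bar> \<le> ?S E x + ?T E x"
        unfolding s1 s2 using True by (simp add: sum_subtractf)
    qed
    finally show ?thesis .
  next
    case False
    then show ?thesis by (simp add: K_def)
  qed
  have Kri: "integrable M (indicator (K t) :: 'a \<Rightarrow> real)" if "t < N" for t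
    using Km[OF that] by (intro integrable_real_indicator) (auto simp: emeasure_eq_measure)
  have "prob Mis \<le> (\<Sum>t<N. prob ((U ^^ t) ` K t))"
    unfolding Mis_def by (rule finite_measure_subadditive_finite) (use Km image_sets in auto)
  also have "\<dots> = (\<Sum>t<N. prob (K t))" using mp_aut_image_sets(2)[OF U_funpow Km] by simp
  also have "\<dots> = (\<Sum>t<N. \<integral>x. indicator (K t) x \<partial>M)"
    using Km by (intro sum.cong) auto
  also have "\<dots> = (\<integral>x. (\<Sum>t<N. indicator (K t) x) \<partial>M)"
    using Kri by (intro Bochner_Integration.integral_sum[symmetric]) auto
  also have "\<dots> \<le> (\<integral>x. (\<Sum>E\<in>Pow \<A>. ?S E x + ?T E x) \<partial>M)"
    using Kri Si Ti by (intro integral_mono count) (auto intro!: Bochner_Integration.integrable_sum)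
  also have "\<dots> = (\<Sum>E\<in>Pow \<A>. mean_dev \<Phi> (minv M V) (At E) + mean_dev \<Phi> (\<lambda>x. x) (b ` At E))"
    unfolding mean_dev_def using Si Ti
    by (subst Bochner_Integration.integral_sum) (auto intro!: Bochner_Integration.integrable_add sum.cong Bochner_Integration.integral_add)
  finally have Misp: "prob Mis \<le> (\<Sum>E\<in>Pow \<A>. mean_dev \<Phi> (minv M V) (At E) + mean_dev \<Phi> (\<lambda>x. x) (b ` At E))" .
  define Z where "Z = V -` ((space M - tower_set) \<union> Mis) \<inter> space M"
  have Zm: "Z \<in> events" unfolding Z_def by (rule measurable_sets[OF mp_aut_measurable[OF V]]) auto
  have "prob Z = prob ((space M - tower_set) \<union> Mis)" unfolding Z_def by (rule mp_aut_vimage_measure[OF V]) auto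
  also have "\<dots> \<le> prob (space M - tower_set) + prob Mis" by (rule measure_Un_le) auto
  finally have Zp: "prob Z \<le> prob (space M - tower_set) + (\<Sum>E\<in>Pow \<A>. mean_dev \<Phi> (minv M V) (At E) + mean_dev \<Phi> (\<lambda>x. x) (b ` At E))"
    using Misp by linarith
  have "\<Phi> x \<in> A \<longleftrightarrow> \<Phi> (\<psi> (V x)) \<in> b ` A" if x: "x \<in> space M - Z" and A: "A \<in> \<A>" for x A
  proof -
    have "V x \<in> tower_set" "V x \<notin> Mis" using x mp_aut_space[OF V] by (auto simp: Z_def)
    then obtain t x0 where y: "x0 \<in> B" "t < N" "V x = (U ^^ t) x0" by (auto simp: tower_set_def)
    then have "x0 \<notin> K t" using \<open>V x \<notin> Mis\<close> by (auto simp: Mis_def)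
    then have st: "src x0 t = tgt x0 (\<sigma> x0 t)" using y by (simp add: K_def)
    have 1: "minv M V ((U ^^ t) x0) = x" using minv_left[OF V, of x] x y(3) by simp
    have 2: "\<psi> (V x) = (U ^^ \<sigma> x0 t) x0" using \<psi>(2) y by simp
    have "\<Phi> x \<in> A \<longleftrightarrow> A \<in> src x0 t" using A 1 by (simp add: src_def)
    also have "\<dots> \<longleftrightarrow> \<Phi> (\<psi> (V x)) \<in> b ` A" unfolding st 2 using A by (simp add: tgt_def)
    finally show ?thesis .
  qed
  then show ?thesis using \<psi>(1,3) Zm Zp by (intro bexI[of _ \<psi>] bexI[of _ Z]) auto
qed

end

section \<open>Choosing the samples of the random map\<close>

lemma near_pairs: "(\<Sum>t<N. \<Sum>t'<N. of_bool (t < t' + L \<and> t' < t + L)) \<le> (real N * (2 * real L) :: real)"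
proof -
  have "(\<Sum>t'<N. of_bool (t < t' + L \<and> t' < t + L)) \<le> (2 * real L :: real)" for t
  proof -
    have "(\<Sum>t'<N. of_bool (t < t' + L \<and> t' < t + L)) = real (card {t'. t' < N \<and> t < t' + L \<and> t' < t + L})"
      by (simp add: of_bool_def sum.If_cases) (rule arg_cong[where f = card], auto)
    also have "\<dots> \<le> real (card {t - L..<t + L})" by (intro of_nat_mono card_mono) auto
    also have "\<dots> \<le> 2 * real L" by simp
    finally show ?thesis .
  qed
  then have "(\<Sum>t<N. \<Sum>t'<N. of_bool (t < t' + L \<and> t' < t + L)) \<le> (\<Sum>t<N. 2 * real L :: real)" by (rule sum_mono)
  then show ?thesis by simp
qed

context prob_space
begin

lemma prob_eventually_small:
  assumes S [measurable]: "\<And>n. S n \<in> events" and ev: "\<And>x. x \<in> space M \<Longrightarrow> \<exists>n0. \<forall>n\<ge>n0. x \<notin> S n" and e: "e > 0"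
  shows "\<forall>\<^sub>F n in sequentially. prob (S n) < e"
proof -
  define R where "R n = (\<Union>k\<in>{n..}. S k)" for n
  have Rm [measurable]: "R n \<in> events" for n unfolding R_def by measurable
  have "(\<lambda>n. prob (R n)) \<longlonglongrightarrow> prob (\<Inter>n. R n)"
  proof (rule finite_Lim_measure_decseq)
    show "decseq R" unfolding decseq_def R_def by (intro allI impI UN_mono) auto
  qed auto
  moreover have "(\<Inter>n. R n) = {}"
  proof -
    have "x \<notin> (\<Inter>n. R n)" for x
    proof
      assume x: "x \<in> (\<Inter>n. R n)"
      then have "x \<in> space M" using sets.sets_into_space[OF Rm[of 0]] by auto
      then obtain n0 where "\<forall>n\<ge>n0. x \<notin> S n" using ev by blast
      then have "x \<notin> R n0" by (auto simp: R_def)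
      then show False using x by blast
    qed
    then show ?thesis by blast
  qed
  ultimately have "(\<lambda>n. prob (R n)) \<longlonglongrightarrow> 0" by simp
  then have "\<forall>\<^sub>F n in sequentially. prob (R n) < e" using e by (rule order_tendstoD(2))
  then show ?thesis
  proof eventually_elim
    case (elim n)
    have "prob (S n) \<le> prob (R n)" by (rule finite_measure_mono) (auto simp: R_def)
    then show ?case using elim by linarith
  qed
qed

text \<open>
  Two towers over \<open>U\<close> are used. The lower one, of height \<open>L\<close>, carries the
  random map; it fails to be equivariant only off that tower and on its top level, a set of measure
  about \<open>1 / L\<close>. The higher one, of height \<open>N\<close>, supplies the columns in
  which frequencies are counted. Two points of the sequence \<open>h (U\<^sup>t x)\<close> are
  correlated only if they lie over the same base point of the lower tower, which \<open>sep\<close>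
  excludes for \<open>\<bar>t - t'\<bar> \<ge> L\<close>, if one of them is off that tower, or if
  two different base points have the same key. Taking \<open>L\<close> first, then \<open>N\<close>
  much larger than \<open>L\<close>, and finally the grid of keys fine enough for \<open>N\<close>
  makes all three contributions small.
\<close>

lemma sampled_map:
  assumes std: "standard_borel M" and U: "U \<in> mp_automorphisms M"
    and ap: "AE x in M. \<forall>k>0. (U ^^ k) x \<noteq> x" and b: "b \<in> mp_automorphisms M"
    and finH: "finite H" and H: "\<And>h. h \<in> H \<Longrightarrow> h \<in> mp_automorphisms M"
    and sep: "\<And>h. h \<in> H \<Longrightarrow> AE x in M. \<forall>t t' p q. q + t < t' \<longrightarrow> (U ^^ q) (h ((U ^^ t) x)) \<noteq> (U ^^ p) (h ((U ^^ t') x))"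
    and finD: "finite \<D>" and \<D>: "\<D> \<subseteq> events" and \<delta>: "\<delta> > 0"
  shows "\<exists>\<Phi> B N Z. \<Phi> \<in> measurable M M \<and> tower M U B N \<and> prob (space M - tower.tower_set U B N) < \<delta> \<and>
     Z \<in> events \<and> prob Z < \<delta> \<and> (\<forall>x\<in>space M - Z. \<Phi> (U x) = b (\<Phi> x)) \<and>
     (\<forall>h\<in>H. \<forall>D\<in>\<D>. tower.mean_dev M U B N \<Phi> h D < \<delta>)"
proof -
  obtain g j where g [measurable]: "g \<in> borel_measurable M" and g0: "\<And>x. 0 \<le> g x" and g1: "\<And>x. g x < (1::real)"
    and j: "j \<in> measurable borel M"
    and jg: "AE x in M. j (g x) = x" by (rule standard_borel_coding[OF prob_space_axioms std], rule that)
  define \<Lambda> where "\<Lambda> = H \<times> \<D>"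
  have fin\<Lambda>: "finite \<Lambda>" using finH finD by (simp add: \<Lambda>_def)
  define c where "c = real (card \<Lambda>) + 1"
  have c: "c \<ge> 1" by (simp add: c_def)
  \<comment> \<open>The first-moment bound of \<open>good_sample\<close> is used with \<open>d = d0 * N\<close>; for each of the pairs in \<open>\<Lambda>\<close> the total error is at most \<open>4 * d0\<close>.\<close>
  define d0 where "d0 = \<delta> / (5 * c)"
  have d0: "d0 > 0" using \<delta> c by (simp add: d0_def)
  obtain L :: nat where L: "2 / \<delta> < real L" using reals_Archimedean2 by blast
  have "0 < 2 / \<delta>" using \<delta> by simp
  then have L0: "0 < real L" using L by linarith
  then have L1: "L > 0" by simp
  have L2: "1 / real L < \<delta> / 2" using L L0 \<delta> by (simp add: field_simps)
  define \<eta> where "\<eta> = min (d0\<^sup>2) (\<delta> / 2)"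
  have \<eta>: "\<eta> > 0" "\<eta> \<le> d0\<^sup>2" "\<eta> \<le> \<delta> / 2" using d0 \<delta> by (auto simp: \<eta>_def)
  obtain B1 where B1: "B1 \<in> events" "\<And>x k. x \<in> B1 \<Longrightarrow> 0 < k \<Longrightarrow> k < L \<Longrightarrow> (U ^^ k) x \<notin> B1"
     "prob (space M - (\<Union>k<L. (U ^^ k) ` B1)) < \<eta>"
    using rokhlin_tower[OF std U ap L1 \<eta>(1)] by blast
  interpret T1: tower M U B1 L by unfold_locales (use U B1 in auto)
  obtain N :: nat where N: "(2 * real L + 1) / d0\<^sup>2 < real N" using reals_Archimedean2 by blast
  have "0 < (2 * real L + 1) / d0\<^sup>2" using d0 by simp
  then have N0: "0 < real N" using N by linarith
  then have N1: "N > 0" by simp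
  obtain B2 where B2: "B2 \<in> events" "\<And>x k. x \<in> B2 \<Longrightarrow> 0 < k \<Longrightarrow> k < N \<Longrightarrow> (U ^^ k) x \<notin> B2"
     "prob (space M - (\<Union>k<N. (U ^^ k) ` B2)) < \<delta>"
    using rokhlin_tower[OF std U ap N1 \<delta>] by blast
  interpret T2: tower M U B2 N by unfold_locales (use U B2 in auto)
  define W where "W = T1.tower_set"
  have Wm [measurable]: "W \<in> events" unfolding W_def by (rule T1.tower_set_sets)
  have Wp: "prob (space M - W) < \<eta>" using B1(3) by (simp add: W_def T1.tower_set_def)
  have off2: "prob (space M - T2.tower_set) < \<delta>" using B2(3) by (simp add: T2.tower_set_def)
  have Um [measurable]: "(U ^^ t) \<in> measurable M M" for t by (rule mp_aut_measurable[OF T1.U_funpow])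
  define y where "y h t x = h ((U ^^ t) x)" for h :: "'a \<Rightarrow> 'a" and t x
  have ym [measurable]: "y h t \<in> measurable M M" if "h \<in> H" for h t
    unfolding y_def by (rule measurable_compose[OF Um mp_aut_measurable[OF H[OF that]]])
  define gb where "gb z = g (T1.base z)" for z
  have gbm [measurable]: "gb \<in> borel_measurable M" unfolding gb_def
    by (rule measurable_compose[OF T1.base_measurable g])
  have gb01: "0 \<le> gb z" "gb z < 1" for z using g0 g1 by (auto simp: gb_def)
  have base_sep: "AE x in M. \<forall>t t'. t + L \<le> t' \<longrightarrow> y h t x \<in> W \<longrightarrow> y h t' x \<in> W \<longrightarrow> gb (y h t x) \<noteq> gb (y h t' x)" if h: "h \<in> H" for h
  proof -
    have "AE x in M. \<forall>t r. j (g (minv M (U ^^ r) (h ((U ^^ t) x)))) = minv M (U ^^ r) (h ((U ^^ t) x))"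
      unfolding AE_all_countable
    proof (intro allI)
      fix t r
      have "(minv M (U ^^ r) \<circ> h) \<circ> (U ^^ t) \<in> mp_automorphisms M"
        by (intro mp_aut_comp(1) mp_aut_minv T1.U_funpow H h)
      from AE_mp_aut[OF this jg] show "AE x in M. j (g (minv M (U ^^ r) (h ((U ^^ t) x)))) = minv M (U ^^ r) (h ((U ^^ t) x))"
        by simp
    qed
    with sep[OF h] show ?thesis
    proof eventually_elim
      case (elim x)
      show ?case
      proof (intro allI impI notI)
        fix t t' assume t: "t + L \<le> t'" and w: "y h t x \<in> W" "y h t' x \<in> W" and e: "gb (y h t x) = gb (y h t' x)"
        have 1: "T1.level (y h t x) < L" "y h t x = (U ^^ T1.level (y h t x)) (T1.base (y h t x))"
          using w(1) unfolding W_def by (auto elim: T1.tower_setE)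
        have 2: "T1.level (y h t' x) < L" "y h t' x = (U ^^ T1.level (y h t' x)) (T1.base (y h t' x))"
          using w(2) unfolding W_def by (auto elim: T1.tower_setE)
        have jb: "j (gb (y h s x)) = T1.base (y h s x)" for s
          using elim(2) by (simp add: gb_def T1.base_def y_def)
        have be: "T1.base (y h t x) = T1.base (y h t' x)" using jb[of t] jb[of t'] e by simp
        define r where "r = T1.level (y h t x)"
        define r' where "r' = T1.level (y h t' x)"
        define z where "z = T1.base (y h t' x)"
        have "y h t x = (U ^^ r) z" "y h t' x = (U ^^ r') z"
          using 1(2) 2(2) unfolding r_def r'_def z_def be by simp_all
        then have "(U ^^ r') (y h t x) = (U ^^ r) (y h t' x)"
          by (simp only: T1.Uadd add.commute)
        then have "(U ^^ T1.level (y h t' x)) (y h t x) = (U ^^ T1.level (y h t x)) (y h t' x)"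
          unfolding r_def r'_def .
        moreover have "T1.level (y h t' x) + t < t'" using 2(1) t by linarith
        ultimately show False using elim(1) by (auto simp: y_def)
      qed
    qed
  qed
  \<comment> \<open>The points where the grid of width \<open>1 / J\<close> does not yet separate two different base points.\<close>
  define S where "S h t t' J = {x\<in>space M. gb (y h t x) \<noteq> gb (y h t' x) \<and> grid J (gb (y h t x)) = grid J (gb (y h t' x))}" for h t t' J
  have Sm: "S h t t' J \<in> events" if h: "h \<in> H" for h t t' J
  proof -
    define u where "u t x = gb (y h t x)" for t x
    define v where "v t x = grid J (gb (y h t x))" for t x
    have [measurable]: "u t \<in> borel_measurable M" for t unfolding u_def by (rule measurable_compose[OF ym[OF h] gbm])
    have [measurable]: "v t \<in> measurable M (count_space UNIV)" for t
      unfolding v_def by (rule measurable_compose[OF measurable_compose[OF ym[OF h] gbm] grid_measurable])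
    have "{x\<in>space M. u t x \<noteq> u t' x \<and> v t x = v t' x} \<in> events" by measurable
    then show ?thesis unfolding S_def u_def v_def .
  qed
  have "\<forall>\<^sub>F J in sequentially. \<forall>h\<in>H. \<forall>t\<in>{..<N}. \<forall>t'\<in>{..<N}. prob (S h t t' J) < 1 / (real N)\<^sup>2"
  proof (intro eventually_ball_finite finH ballI prob_eventually_small Sm finite_lessThan)
    fix h t t' x
    show "\<exists>n0. \<forall>n\<ge>n0. x \<notin> S h t t' n"
      using grid_eventually_separates[OF gb01(1) gb01(1), of "y h t x" "y h t' x"] by (auto simp: S_def)
  qed (use N0 in auto)
  moreover have "\<forall>\<^sub>F J in sequentially. J > (0::nat)" by (rule eventually_gt_at_top)
  ultimately obtain J where J0: "J > 0" and J: "\<And>h t t'. h \<in> H \<Longrightarrow> t < N \<Longrightarrow> t' < N \<Longrightarrow> prob (S h t t' J) < 1 / (real N)\<^sup>2"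
    using eventually_happens'[OF sequentially_bot eventually_conj] by (metis (no_types, lifting) lessThan_iff)
  define \<kappa> where "\<kappa> z = grid J (gb z)" for z
  have \<kappa>J: "\<kappa> z < J" for z unfolding \<kappa>_def by (rule grid_less[OF gb01 J0])
  have \<kappa>m: "\<kappa> \<in> measurable M (count_space UNIV)"
    unfolding \<kappa>_def by (rule measurable_compose[OF gbm grid_measurable])
  have \<kappa>mJ: "\<kappa> \<in> measurable M (count_space {..<J})"
    by (rule measurable_count_space_extend[OF subset_UNIV _ \<kappa>m]) (use \<kappa>J in auto)
  let ?bad = "\<lambda>h t t'. {x\<in>B2. \<not> (y h t x \<in> W \<and> y h t' x \<in> W \<and> \<kappa> (y h t x) \<noteq> \<kappa> (y h t' x))}"
  have B2sp: "x \<in> B2 \<Longrightarrow> x \<in> space M" for x by (rule T2.base_space)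
  have NB: "real N * prob B2 \<le> 1" by (rule T2.base_small)
  have bad: "(\<Sum>t<N. \<Sum>t'<N. prob (?bad h t t')) \<le> 2 * real L + 2 * real N * \<eta> + 1" if h: "h \<in> H" for h
  proof -
    define p where "p t = prob {x\<in>B2. y h t x \<notin> W}" for t
    have pm: "{x\<in>B2. y h t x \<notin> W} \<in> events" for t
    proof -
      note [measurable] = ym[OF h] T2.B
      have "{x\<in>B2. y h t x \<notin> W} = {x\<in>space M. x \<in> B2 \<and> y h t x \<notin> W}" using B2sp by auto
      also have "\<dots> \<in> events" by measurable
      finally show ?thesis .
    qed
    have sp: "(\<Sum>t<N. p t) \<le> \<eta>"
    proof -
      define Zh where "Zh = h -` (space M - W) \<inter> space M"
      have Zhm: "Zh \<in> events" unfolding Zh_def by (rule measurable_sets[OF mp_aut_measurable[OF H[OF h]]]) auto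
      have "{x\<in>B2. y h t x \<notin> W} = {x\<in>B2. (U ^^ t) x \<in> Zh}" for t
        using B2sp mp_aut_space[OF T1.U_funpow] mp_aut_space[OF H[OF h]] by (auto simp: Zh_def y_def)
      then have "(\<Sum>t<N. p t) = prob (T2.tower_set \<inter> Zh)" using T2.tower_sum[OF Zhm] by (simp add: p_def)
      also have "\<dots> \<le> prob Zh" by (rule finite_measure_mono) (use Zhm in auto)
      also have "\<dots> = prob (space M - W)" unfolding Zh_def by (rule mp_aut_vimage_measure[OF H[OF h]]) auto
      finally show ?thesis using Wp by simp
    qed
    have one: "prob (?bad h t t') \<le> of_bool (t < t' + L \<and> t' < t + L) * prob B2 + p t + p t' + 1 / (real N)\<^sup>2"
      if t: "t < N" "t' < N" for t t'
    proof (cases "t < t' + L \<and> t' < t + L")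
      case True
      have "prob (?bad h t t') \<le> prob B2" by (rule finite_measure_mono) (use B2 in auto)
      moreover have "of_bool (t < t' + L \<and> t' < t + L) * prob B2 = prob B2" using True by simp
      moreover have "0 \<le> p t" "0 \<le> p t'" "0 \<le> 1 / (real N)\<^sup>2" by (simp_all add: p_def)
      ultimately show ?thesis by linarith
    next
      case False
      have "prob (?bad h t t') \<le> prob (({x\<in>B2. y h t x \<notin> W} \<union> {x\<in>B2. y h t' x \<notin> W}) \<union> S h t t' J)"
      proof (rule finite_measure_mono_AE)
        show "AE x in M. x \<in> ?bad h t t' \<longrightarrow> x \<in> ({x\<in>B2. y h t x \<notin> W} \<union> {x\<in>B2. y h t' x \<notin> W}) \<union> S h t t' J"
          using base_sep[OF h]
        proof eventually_elim
          case (elim x)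
          have "t + L \<le> t' \<or> t' + L \<le> t" using False by linarith
          then have ne: "gb (y h t x) \<noteq> gb (y h t' x)" if "y h t x \<in> W" "y h t' x \<in> W"
            using elim[rule_format, of t t'] elim[rule_format, of t' t] that by metis
          show ?case
          proof
            assume x: "x \<in> ?bad h t t'"
            show "x \<in> ({x\<in>B2. y h t x \<notin> W} \<union> {x\<in>B2. y h t' x \<notin> W}) \<union> S h t t' J"
            proof (cases "y h t x \<in> W \<and> y h t' x \<in> W")
              case True
              then show ?thesis using x ne B2sp[of x] by (simp add: S_def \<kappa>_def)
            next
              case False then show ?thesis using x by auto
            qed
          qed
        qed
      qed (use pm Sm[OF h] in auto)
      also have "\<dots> \<le> prob ({x\<in>B2. y h t x \<notin> W} \<union> {x\<in>B2. y h t' x \<notin> W}) + prob (S h t t' J)"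
        by (rule measure_Un_le) (use pm Sm[OF h] in auto)
      also have "\<dots> \<le> (p t + p t') + prob (S h t t' J)"
        unfolding p_def by (intro add_right_mono measure_Un_le pm)
      finally have "prob (?bad h t t') \<le> p t + p t' + prob (S h t t' J)" .
      moreover have "of_bool (t < t' + L \<and> t' < t + L) * prob B2 = 0" using False by simp
      ultimately show ?thesis using J[OF h t] by linarith
    qed
    have "(\<Sum>t<N. \<Sum>t'<N. prob (?bad h t t')) \<le>
      (\<Sum>t<N. \<Sum>t'<N. of_bool (t < t' + L \<and> t' < t + L) * prob B2 + p t + p t' + 1 / (real N)\<^sup>2)"
      by (intro sum_mono one) auto
    also have "\<dots> = (\<Sum>t<N. \<Sum>t'<N. of_bool (t < t' + L \<and> t' < t + L)) * prob B2 + real N * (\<Sum>t<N. p t) + real N * (\<Sum>t<N. p t) + 1"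
      using N0 by (simp add: sum.distrib sum_distrib_left sum_distrib_right power2_eq_square)
    also have "\<dots> \<le> (real N * (2 * real L)) * prob B2 + real N * \<eta> + real N * \<eta> + 1"
      using sp near_pairs[where N = N and L = L] by (intro add_mono mult_right_mono mult_left_mono) auto
    also have "\<dots> = (2 * real L) * (real N * prob B2) + 2 * real N * \<eta> + 1" by (simp add: algebra_simps)
    also have "\<dots> \<le> (2 * real L) * 1 + 2 * real N * \<eta> + 1"
      using NB by (intro add_right_mono mult_left_mono) auto
    finally show ?thesis by simp
  qed
  define cc where "cc = 2 * real L + 2 * real N * \<eta> + 1"
  have dN: "d0 * real N > 0" using d0 N0 by simp
  have "\<exists>\<omega>\<in>space (Pi\<^sub>M {..<J} (\<lambda>_. M)).
    (\<Sum>i\<in>\<Lambda>. \<integral>x. indicator B2 x * \<bar>\<Sum>t<N. indicator (snd i) (random_map b W T1.level \<kappa> \<omega> (y (fst i) t x)) - prob (snd i)\<bar> \<partial>M)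
      \<le> real (card \<Lambda>) * ((d0 * real N) * prob B2 + cc / (d0 * real N))"
  proof (rule good_sample[OF b Wm T1.level_measurable \<kappa>mJ fin\<Lambda> _ _ B2(1) dN])
    fix i assume i: "i \<in> \<Lambda>"
    then show "snd i \<in> events" using \<D> by (auto simp: \<Lambda>_def)
    have h: "fst i \<in> H" using i by (auto simp: \<Lambda>_def)
    show "y (fst i) t \<in> measurable M M" for t by (rule ym[OF h])
    show "(\<Sum>t<N. \<Sum>t'<N. prob (?bad (fst i) t t')) \<le> cc" unfolding cc_def by (rule bad[OF h])
  qed
  then obtain \<omega> where \<omega>: "\<omega> \<in> space (Pi\<^sub>M {..<J} (\<lambda>_. M))"
    "(\<Sum>i\<in>\<Lambda>. \<integral>x. indicator B2 x * \<bar>\<Sum>t<N. indicator (snd i) (random_map b W T1.level \<kappa> \<omega> (y (fst i) t x)) - prob (snd i)\<bar> \<partial>M)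
      \<le> real (card \<Lambda>) * ((d0 * real N) * prob B2 + cc / (d0 * real N))"
    by (elim bexE)
  define \<Phi> where "\<Phi> = random_map b W T1.level \<kappa> \<omega>"
  have \<Phi>m: "\<Phi> \<in> measurable M M"
    using random_map_measurable[OF b Wm T1.level_measurable \<kappa>mJ, of "\<lambda>_. \<omega>" M "\<lambda>x. x"] \<omega>(1)
    by (simp add: \<Phi>_def)
  have bound: "real (card \<Lambda>) * ((d0 * real N) * prob B2 + cc / (d0 * real N)) < \<delta>"
  proof -
    have 1: "(d0 * real N) * prob B2 \<le> d0" using NB d0 mult_left_mono[OF NB, of d0] by (simp add: mult.assoc)
    have 2: "(2 * real L + 1) / (d0 * real N) \<le> d0"
      using N d0 N0 by (simp add: field_simps power2_eq_square)
    have 3: "2 * real N * \<eta> / (d0 * real N) \<le> 2 * d0"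
      using \<eta>(2) d0 N0 by (simp add: field_simps power2_eq_square)
    have "cc / (d0 * real N) = (2 * real L + 1) / (d0 * real N) + 2 * real N * \<eta> / (d0 * real N)"
      unfolding cc_def add_divide_distrib[symmetric] by (simp add: algebra_simps)
    then have "(d0 * real N) * prob B2 + cc / (d0 * real N) \<le> 4 * d0" using 1 2 3 by linarith
    then have "real (card \<Lambda>) * ((d0 * real N) * prob B2 + cc / (d0 * real N)) \<le> real (card \<Lambda>) * (4 * d0)"
      by (rule mult_left_mono) simp
    also have "\<dots> \<le> c * (4 * d0)" using d0 by (intro mult_right_mono) (auto simp: c_def)
    also have "\<dots> < \<delta>" using c \<delta> by (simp add: d0_def field_simps)
    finally show ?thesis .
  qed
  have devs: "T2.mean_dev \<Phi> h D < \<delta>" if "h \<in> H" "D \<in> \<D>" for h D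
  proof -
    have "T2.mean_dev \<Phi> h D = (case (h, D) of (h, D) \<Rightarrow> T2.mean_dev \<Phi> h D)" by simp
    also have "\<dots> \<le> (\<Sum>i\<in>\<Lambda>. case i of (h, D) \<Rightarrow> T2.mean_dev \<Phi> h D)"
      by (rule member_le_sum) (use that fin\<Lambda> T2.mean_dev_nonneg in \<open>auto simp: \<Lambda>_def\<close>)
    also have "\<dots> = (\<Sum>i\<in>\<Lambda>. \<integral>x. indicator B2 x * \<bar>\<Sum>t<N. indicator (snd i) (random_map b W T1.level \<kappa> \<omega> (y (fst i) t x)) - prob (snd i)\<bar> \<partial>M)"
      by (simp add: T2.mean_dev_def \<Phi>_def y_def split_beta')
    finally show ?thesis using \<omega>(2) bound by linarith
  qed
  \<comment> \<open>Below the top level, \<open>U\<close> raises the level by one and keeps the base point, hence the sample.\<close>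
  define Z where "Z = (space M - W) \<union> (U ^^ (L - 1)) ` B1"
  have Zm: "Z \<in> events" unfolding Z_def by (intro sets.Un T1.image_sets T1.B) auto
  have Zp: "prob Z < \<delta>"
  proof -
    have "prob Z \<le> prob (space M - W) + prob ((U ^^ (L - 1)) ` B1)"
      unfolding Z_def by (rule measure_Un_le) (use T1.image_sets T1.B in auto)
    also have "prob ((U ^^ (L - 1)) ` B1) = prob B1" by (rule mp_aut_image_sets(2)[OF T1.U_funpow T1.B])
    also have "prob B1 \<le> 1 / real L" using T1.base_small L0 by (simp add: field_simps)
    finally show ?thesis using Wp \<eta>(3) L2 by linarith
  qed
  have eqv: "\<Phi> (U x) = b (\<Phi> x)" if x: "x \<in> space M - Z" for x
  proof -
    have "x \<in> T1.tower_set" using x by (auto simp: Z_def W_def)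
    then obtain r z where z: "z \<in> B1" "r < L" "x = (U ^^ r) z" by (auto simp: T1.tower_set_def)
    have "r \<noteq> L - 1" using x z by (auto simp: Z_def)
    then have r: "Suc r < L" using z by linarith
    have Ux: "U x = (U ^^ Suc r) z" using z by simp
    have "\<kappa> (U x) = grid J (g z)" by (simp only: \<kappa>_def gb_def Ux T1.level_base(2)[OF z(1) r])
    moreover have "\<kappa> x = grid J (g z)" by (simp only: \<kappa>_def gb_def z(3) T1.level_base(2)[OF z(1,2)])
    moreover have "T1.level (U x) = Suc r" by (simp only: Ux T1.level_base(1)[OF z(1) r])
    moreover have "T1.level x = r" by (simp only: z(3) T1.level_base(1)[OF z(1,2)])
    moreover have "U x \<in> W" unfolding W_def Ux by (rule T1.tower_setI[OF z(1) r])
    moreover have "x \<in> W" unfolding W_def z(3) by (rule T1.tower_setI[OF z(1,2)])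
    ultimately show ?thesis by (simp add: \<Phi>_def random_map_def)
  qed
  have "tower M U B2 N" by (rule T2.tower_axioms)
  then show ?thesis using \<Phi>m off2 Zm Zp eqv devs by blast
qed

end

section \<open>Approximation by the full group of one generator\<close>

context prob_space
begin

text \<open>
  The random map does what is asked of \<open>T\<close>, except that it is not an automorphism. Its
  frequencies are controlled for the identity, which gives its distribution on the cells of the
  finite algebra \<open>\<D>0\<close> and the target frequencies, and for the inverses of the
  \<open>V i\<close>, which gives the source frequencies. Then \<open>T\<close> is an automorphism
  that puts almost all points into the same cell of \<open>\<D>0\<close> as the random map does, so
  the two can be exchanged in every statement about the sets involved.
\<close>

lemma full_group_approximation:
  fixes V b :: "'i \<Rightarrow> 'a \<Rightarrow> 'a"
  assumes std: "standard_borel M" and na: "non_atomic M" and U: "U \<in> mp_automorphisms M"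
    and ap: "AE x in M. \<forall>k>0. (U ^^ k) x \<noteq> x" and b0: "b0 \<in> mp_automorphisms M"
    and I: "finite I" and V: "\<And>i. i \<in> I \<Longrightarrow> V i \<in> mp_automorphisms M" and b: "\<And>i. i \<in> I \<Longrightarrow> b i \<in> mp_automorphisms M"
    and sep: "\<And>i. i \<in> I \<Longrightarrow> AE x in M. \<forall>t t' p q. t \<noteq> t' \<longrightarrow>
        (U ^^ q) (minv M (V i) ((U ^^ t) x)) \<noteq> (U ^^ p) (minv M (V i) ((U ^^ t') x))"
    and fin: "finite \<A>" and \<A>: "\<A> \<subseteq> events" and e: "\<epsilon> > 0"
  shows "\<exists>T\<in>mp_automorphisms M. \<exists>\<psi>.
     (\<forall>i\<in>I. \<psi> i \<in> mp_automorphisms M \<and>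
        (\<forall>y\<in>space M. \<exists>x\<in>space M. \<exists>t u. y = (U ^^ t) x \<and> \<psi> i y = (U ^^ u) x)) \<and>
     (\<exists>Z\<in>events. prob Z < \<epsilon> \<and> (\<forall>x\<in>space M - Z. \<forall>A\<in>\<A>. (T x \<in> A \<longleftrightarrow> T (U x) \<in> b0 ` A) \<and>
        (\<forall>i\<in>I. T x \<in> A \<longleftrightarrow> T (\<psi> i (V i x)) \<in> b i ` A)))"
proof -
  have Am: "A \<in> events" if "A \<in> \<A>" for A using that \<A> by auto
  define \<D>0 where "\<D>0 = \<A> \<union> (`) b0 ` \<A> \<union> (\<Union>i\<in>I. (`) (b i) ` \<A>)"
  have fin0: "finite \<D>0" using fin I by (simp add: \<D>0_def)
  have \<D>0: "\<D>0 \<subseteq> events"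
    using Am mp_aut_image_sets(1)[OF b0] mp_aut_image_sets(1)[OF b] by (auto simp: \<D>0_def)
  define n where "n = real (card (Pow \<D>0))"
  define k where "k = real (card (Pow \<A>))"
  define m where "m = real (card I)"
  define K where "K = 2 * (n * (n * 2)) + 1 + m * (1 + k * 2 + n * (n * 2))"
  have K0: "K \<ge> 0" by (auto simp: K_def n_def k_def m_def)
  define \<delta> where "\<delta> = \<epsilon> / (K + 1)"
  have \<delta>: "\<delta> > 0" using e K0 by (simp add: \<delta>_def)
  have \<delta>K: "\<delta> * K < \<epsilon>" using e K0 by (simp add: \<delta>_def field_simps)
  define H where "H = insert (\<lambda>x. x) ((\<lambda>i. minv M (V i)) ` I)"
  have finH: "finite H" using I by (simp add: H_def)
  have Hmp: "h \<in> mp_automorphisms M" if "h \<in> H" for h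
    using that mp_aut_id(2) mp_aut_minv[OF V] by (auto simp: H_def)
  have U_funpow: "(U ^^ t) \<in> mp_automorphisms M" for t by (rule mp_aut_funpow[OF U])
  have sepH: "AE x in M. \<forall>t t' p q. q + t < t' \<longrightarrow> (U ^^ q) (h ((U ^^ t) x)) \<noteq> (U ^^ p) (h ((U ^^ t') x))"
    if h: "h \<in> H" for h
  proof (cases "h = (\<lambda>x. x)")
    case True
    show ?thesis using ap AE_space
    proof eventually_elim
      case (elim x)
      have "(U ^^ q) ((U ^^ t) x) \<noteq> (U ^^ p) ((U ^^ t') x)" if "q + t < t'" for t t' p q
      proof
        assume "(U ^^ q) ((U ^^ t) x) = (U ^^ p) ((U ^^ t') x)"
        moreover have "(U ^^ p) ((U ^^ t') x) = (U ^^ (q + t)) ((U ^^ (p + t' - (q + t))) x)"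
          using that by (simp add: funpow_add[symmetric, THEN fun_cong, unfolded comp_def])
        ultimately have "(U ^^ (q + t)) ((U ^^ (p + t' - (q + t))) x) = (U ^^ (q + t)) x"
          by (simp add: funpow_add)
        then have "(U ^^ (p + t' - (q + t))) x = x"
          using mp_aut_inj[OF U_funpow mp_aut_space[OF U_funpow elim(2)] elim(2)] by blast
        then show False using elim(1) that by simp
      qed
      then show ?case by (simp add: True)
    qed
  next
    case False
    then obtain i where i: "i \<in> I" "h = minv M (V i)" using h by (auto simp: H_def)
    show ?thesis using sep[OF i(1)] unfolding i(2)
      by eventually_elim (metis less_irrefl trans_less_add2 add.commute)
  qed
  define \<D> where "\<D> = cell M \<D>0 ` Pow \<D>0 \<union> cell M \<A> ` Pow \<A> \<union> (\<Union>i\<in>I. (\<lambda>E. b i ` cell M \<A> E) ` Pow \<A>)"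
  have fin\<D>: "finite \<D>" using fin fin0 I by (simp add: \<D>_def)
  have cA: "cell M \<A> E \<in> events" for E by (rule cell_sets[OF fin \<A>])
  have c0: "cell M \<D>0 E \<in> events" for E by (rule cell_sets[OF fin0 \<D>0])
  have \<D>: "\<D> \<subseteq> events" using cA c0 mp_aut_image_sets(1)[OF b] by (auto simp: \<D>_def)
  have "\<exists>\<Phi> B N Z. \<Phi> \<in> measurable M M \<and> tower M U B N \<and> prob (space M - tower.tower_set U B N) < \<delta> \<and>
     Z \<in> events \<and> prob Z < \<delta> \<and> (\<forall>x\<in>space M - Z. \<Phi> (U x) = b0 (\<Phi> x)) \<and>
     (\<forall>h\<in>H. \<forall>D\<in>\<D>. tower.mean_dev M U B N \<Phi> h D < \<delta>)"
    by (rule sampled_map[OF std U ap b0 finH Hmp sepH fin\<D> \<D> \<delta>])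
  then obtain \<Phi> B N Z0 where \<Phi> [measurable]: "\<Phi> \<in> measurable M M" and tw: "tower M U B N"
    and off: "prob (space M - tower.tower_set U B N) < \<delta>" and Z0: "Z0 \<in> events" "prob Z0 < \<delta>"
    and eqv: "\<forall>x\<in>space M - Z0. \<Phi> (U x) = b0 (\<Phi> x)"
    and devs: "\<forall>h\<in>H. \<forall>D\<in>\<D>. tower.mean_dev M U B N \<Phi> h D < \<delta>"
    by (elim exE conjE)
  interpret tower M U B N by (rule tw)
  have \<Phi>sp: "x \<in> space M \<Longrightarrow> \<Phi> x \<in> space M" for x by (rule measurable_space[OF \<Phi>])
  define c where "c y = {D\<in>\<D>0. y \<in> D}" for y
  have cset: "{x\<in>space M. c x = P} = cell M \<D>0 P" for P by (simp add: c_def cell_def)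
  have qset: "{x\<in>space M. c (\<Phi> x) = P} = {x\<in>space M. \<Phi> x \<in> cell M \<D>0 P}" for P
    using \<Phi>sp by (auto simp: c_def cell_def)
  have "\<exists>T\<in>mp_automorphisms M. prob {x\<in>space M. c (\<Phi> x) \<noteq> c (T x)}
      \<le> real (card (Pow \<D>0)) * (\<Sum>P\<in>Pow \<D>0. \<bar>prob {x\<in>space M. c (\<Phi> x) = P} - prob {x\<in>space M. c x = P}\<bar>)"
  proof (rule realize_labels[OF std na, of "Pow \<D>0" "\<lambda>x. c (\<Phi> x)" c])
    show "{x\<in>space M. c (\<Phi> x) = P} \<in> events" for P
      unfolding qset using measurable_sets[OF \<Phi> c0[of P]] by (simp add: vimage_def Int_def conj_commute)
    show "{x\<in>space M. c x = P} \<in> events" for P unfolding cset by (rule c0)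
  qed (use fin0 in \<open>auto simp: c_def\<close>)
  then obtain T where T: "T \<in> mp_automorphisms M" and Tp: "prob {x\<in>space M. c (\<Phi> x) \<noteq> c (T x)}
      \<le> real (card (Pow \<D>0)) * (\<Sum>P\<in>Pow \<D>0. \<bar>prob {x\<in>space M. c (\<Phi> x) = P} - prob {x\<in>space M. c x = P}\<bar>)"
    by (elim bexE)
  \<comment> \<open>Off \<open>E0\<close> the maps \<open>\<Phi>\<close> and \<open>T\<close> are indistinguishable by sets in \<open>\<D>0\<close>.\<close>
  define E0 where "E0 = {x\<in>space M. c (\<Phi> x) \<noteq> c (T x)}"
  have E0p: "prob E0 \<le> \<delta> * (n * (n * 2))"
  proof -
    have "(\<Sum>P\<in>Pow \<D>0. \<bar>prob {x\<in>space M. c (\<Phi> x) = P} - prob {x\<in>space M. c x = P}\<bar>) \<le> (\<Sum>P\<in>Pow \<D>0. 2 * \<delta>)"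
    proof (rule sum_mono)
      fix P assume "P \<in> Pow \<D>0"
      then have "mean_dev \<Phi> (\<lambda>x. x) (cell M \<D>0 P) < \<delta>" using devs by (auto simp: H_def \<D>_def)
      then show "\<bar>prob {x\<in>space M. c (\<Phi> x) = P} - prob {x\<in>space M. c x = P}\<bar> \<le> 2 * \<delta>"
        unfolding qset cset using mean_dev_marginal[OF \<Phi> c0[of P]] off by linarith
    qed
    then have "prob E0 \<le> n * (\<Sum>P\<in>Pow \<D>0. 2 * \<delta>)"
      unfolding E0_def n_def by (intro order_trans[OF Tp] mult_left_mono) auto
    then show ?thesis by (simp add: n_def algebra_simps)
  qed
  have E0m: "E0 \<in> events"
  proof -
    have TD: "{x\<in>space M. T x \<in> D} \<in> events" "{x\<in>space M. \<Phi> x \<in> D} \<in> events" if "D \<in> \<D>0" for D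
      using measurable_sets[OF mp_aut_measurable[OF T], of D] measurable_sets[OF \<Phi>, of D] \<D>0 that
      by (auto simp: vimage_def Int_def conj_commute)
    have "E0 = (\<Union>D\<in>\<D>0. sym_diff {x\<in>space M. T x \<in> D} {x\<in>space M. \<Phi> x \<in> D})"
      by (auto simp: E0_def c_def)
    also have "\<dots> \<in> events" using fin0 TD by (intro sets.finite_UN) auto
    finally show ?thesis .
  qed
  have E0D: "\<Phi> x \<in> D \<longleftrightarrow> T x \<in> D" if "x \<in> space M" "x \<notin> E0" "D \<in> \<D>0" for x D
    using that by (auto simp: E0_def c_def set_eq_iff)
  define good_pair where "good_pair i \<psi> Z \<longleftrightarrow> \<psi> \<in> mp_automorphisms M \<and> Z \<in> events \<and>
     (\<forall>y\<in>space M. \<exists>x\<in>space M. \<exists>t u. y = (U ^^ t) x \<and> \<psi> y = (U ^^ u) x) \<and>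
     prob Z \<le> \<delta> * (1 + k * 2) \<and>
     (\<forall>x\<in>space M - Z. \<forall>A\<in>\<A>. \<Phi> x \<in> A \<longleftrightarrow> \<Phi> (\<psi> (V i x)) \<in> b i ` A)" for i \<psi> Z
  have "\<exists>\<psi> Z. good_pair i \<psi> Z" if i: "i \<in> I" for i
  proof -
    obtain \<psi> Z where \<psi>: "\<psi> \<in> mp_automorphisms M" "Z \<in> events"
     "\<forall>y\<in>space M. \<exists>x\<in>space M. \<exists>t u. y = (U ^^ t) x \<and> \<psi> y = (U ^^ u) x"
     "prob Z \<le> prob (space M - tower_set) + (\<Sum>E\<in>Pow \<A>. mean_dev \<Phi> (minv M (V i)) (cell M \<A> E) + mean_dev \<Phi> (\<lambda>x. x) (b i ` cell M \<A> E))"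
     "\<forall>x\<in>space M - Z. \<forall>A\<in>\<A>. \<Phi> x \<in> A \<longleftrightarrow> \<Phi> (\<psi> (V i x)) \<in> b i ` A"
      using matched_full_group_element[OF \<Phi> V[OF i] b[OF i] fin \<A>] by (elim bexE conjE)
    have "(\<Sum>E\<in>Pow \<A>. mean_dev \<Phi> (minv M (V i)) (cell M \<A> E) + mean_dev \<Phi> (\<lambda>x. x) (b i ` cell M \<A> E)) \<le> (\<Sum>E\<in>Pow \<A>. 2 * \<delta>)"
    proof (rule sum_mono)
      fix E assume E: "E \<in> Pow \<A>"
      have "minv M (V i) \<in> H" "(\<lambda>x. x) \<in> H" using i by (auto simp: H_def)
      moreover have "cell M \<A> E \<in> \<D>" "b i ` cell M \<A> E \<in> \<D>" using E i unfolding \<D>_def by blast+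
      ultimately have "mean_dev \<Phi> (minv M (V i)) (cell M \<A> E) < \<delta>" "mean_dev \<Phi> (\<lambda>x. x) (b i ` cell M \<A> E) < \<delta>"
        using devs by auto
      then show "mean_dev \<Phi> (minv M (V i)) (cell M \<A> E) + mean_dev \<Phi> (\<lambda>x. x) (b i ` cell M \<A> E) \<le> 2 * \<delta>" by linarith
    qed
    then have "prob Z \<le> \<delta> * (1 + k * 2)" using \<psi>(4) off by (simp add: k_def algebra_simps)
    with \<psi>(1-3,5) have "good_pair i \<psi> Z" unfolding good_pair_def by (intro conjI)
    then show ?thesis by (intro exI)
  qed
  then have "\<forall>i\<in>I. \<exists>\<psi> Z. good_pair i \<psi> Z" by (intro ballI)
  from bchoice[OF this] obtain \<psi> where "\<forall>i\<in>I. \<exists>Z. good_pair i (\<psi> i) Z" by (elim exE)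
  from bchoice[OF this] obtain Zi where gp: "\<forall>i\<in>I. good_pair i (\<psi> i) (Zi i)" by (elim exE)
  have \<psi>: "\<psi> i \<in> mp_automorphisms M" and Zim: "Zi i \<in> events"
    and orb: "\<forall>y\<in>space M. \<exists>x\<in>space M. \<exists>t u. y = (U ^^ t) x \<and> \<psi> i y = (U ^^ u) x"
    and Zip: "prob (Zi i) \<le> \<delta> * (1 + k * 2)" if "i \<in> I" for i
    using bspec[OF gp that] unfolding good_pair_def by simp_all
  have match: "\<Phi> x \<in> A \<longleftrightarrow> \<Phi> (\<psi> i (V i x)) \<in> b i ` A" if "i \<in> I" "x \<in> space M - Zi i" "A \<in> \<A>" for i x A
    using bspec[OF gp that(1)] that(2,3) unfolding good_pair_def by blast
  define Z where "Z = (E0 \<union> (U -` E0 \<inter> space M) \<union> Z0) \<union> (\<Union>i\<in>I. Zi i \<union> ((\<psi> i \<circ> V i) -` E0 \<inter> space M))"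
  have UE0: "U -` E0 \<inter> space M \<in> events" "prob (U -` E0 \<inter> space M) = prob E0"
    using measurable_sets[OF mp_aut_measurable[OF U] E0m] mp_aut_vimage_measure[OF U E0m] by auto
  have \<psi>V: "\<psi> i \<circ> V i \<in> mp_automorphisms M" if "i \<in> I" for i by (rule mp_aut_comp(1)[OF \<psi>[OF that] V[OF that]])
  have \<psi>E0: "(\<psi> i \<circ> V i) -` E0 \<inter> space M \<in> events" "prob ((\<psi> i \<circ> V i) -` E0 \<inter> space M) = prob E0" if "i \<in> I" for i
    by (rule measurable_sets[OF mp_aut_measurable[OF \<psi>V[OF that]] E0m], rule mp_aut_vimage_measure[OF \<psi>V[OF that] E0m])
  have Zm: "Z \<in> events" unfolding Z_def using E0m UE0(1) Z0(1) Zim \<psi>E0(1) I by (intro sets.Un sets.finite_UN) auto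
  have "prob Z \<le> prob (E0 \<union> (U -` E0 \<inter> space M) \<union> Z0) + prob (\<Union>i\<in>I. Zi i \<union> ((\<psi> i \<circ> V i) -` E0 \<inter> space M))"
    unfolding Z_def by (rule measure_Un_le) (use E0m UE0(1) Z0(1) Zim \<psi>E0(1) I in auto)
  also have "prob (E0 \<union> (U -` E0 \<inter> space M) \<union> Z0) \<le> (prob E0 + prob E0) + prob Z0"
    by (rule order_trans[OF measure_Un_le add_right_mono[OF order_trans[OF measure_Un_le]]])
      (use E0m UE0 Z0(1) in auto)
  also have "prob (\<Union>i\<in>I. Zi i \<union> ((\<psi> i \<circ> V i) -` E0 \<inter> space M)) \<le> (\<Sum>i\<in>I. prob (Zi i \<union> ((\<psi> i \<circ> V i) -` E0 \<inter> space M)))"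
    by (rule finite_measure_subadditive_finite) (use I Zim \<psi>E0(1) in auto)
  also have "\<dots> \<le> (\<Sum>i\<in>I. \<delta> * (1 + k * 2) + \<delta> * (n * (n * 2)))"
  proof (rule sum_mono)
    fix i assume i: "i \<in> I"
    have "prob (Zi i \<union> ((\<psi> i \<circ> V i) -` E0 \<inter> space M)) \<le> prob (Zi i) + prob ((\<psi> i \<circ> V i) -` E0 \<inter> space M)"
      by (rule measure_Un_le[OF Zim[OF i] \<psi>E0(1)[OF i]])
    then show "prob (Zi i \<union> ((\<psi> i \<circ> V i) -` E0 \<inter> space M)) \<le> \<delta> * (1 + k * 2) + \<delta> * (n * (n * 2))"
      using Zip[OF i] \<psi>E0(2)[OF i] E0p by linarith
  qed
  finally have "prob Z \<le> (prob E0 + prob E0) + prob Z0 + m * (\<delta> * (1 + k * 2) + \<delta> * (n * (n * 2)))"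
    by (simp add: m_def)
  also have "\<dots> \<le> (\<delta> * (n * (n * 2)) + \<delta> * (n * (n * 2))) + \<delta> + m * (\<delta> * (1 + k * 2) + \<delta> * (n * (n * 2)))"
    using E0p Z0(2) by (intro add_right_mono add_mono) auto
  also have "\<dots> = \<delta> * K" by (simp add: K_def algebra_simps)
  finally have Zp: "prob Z < \<epsilon>" using \<delta>K by linarith
  have good: "(T x \<in> A \<longleftrightarrow> T (U x) \<in> b0 ` A) \<and> (\<forall>i\<in>I. T x \<in> A \<longleftrightarrow> T (\<psi> i (V i x)) \<in> b i ` A)"
    if x: "x \<in> space M - Z" and A: "A \<in> \<A>" for x A
  proof
    have xs: "x \<in> space M" "x \<notin> E0" using x by (auto simp: Z_def)
    have AD: "A \<in> \<D>0" "b0 ` A \<in> \<D>0" using A by (auto simp: \<D>0_def)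
    have Ux: "U x \<in> space M" "U x \<notin> E0" using x mp_aut_space[OF U] by (auto simp: Z_def)
    have "T (U x) \<in> b0 ` A \<longleftrightarrow> \<Phi> (U x) \<in> b0 ` A" using E0D[OF Ux AD(2)] by simp
    also have "\<Phi> (U x) = b0 (\<Phi> x)" using eqv x by (auto simp: Z_def)
    also have "b0 (\<Phi> x) \<in> b0 ` A \<longleftrightarrow> \<Phi> x \<in> A"
      using mp_aut_inj[OF b0 \<Phi>sp[OF xs(1)]] sets.sets_into_space[OF Am[OF A]] by (auto simp: image_iff subset_iff)
    also have "\<dots> \<longleftrightarrow> T x \<in> A" by (rule E0D[OF xs AD(1)])
    finally show "T x \<in> A \<longleftrightarrow> T (U x) \<in> b0 ` A" by blast
    show "\<forall>i\<in>I. T x \<in> A \<longleftrightarrow> T (\<psi> i (V i x)) \<in> b i ` A"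
    proof
      fix i assume i: "i \<in> I"
      have y: "\<psi> i (V i x) \<in> space M" "\<psi> i (V i x) \<notin> E0"
        using x i xs(1) mp_aut_space[OF \<psi>V[OF i] xs(1)] by (auto simp: Z_def)
      have bA: "b i ` A \<in> \<D>0" using i A unfolding \<D>0_def by blast
      have "x \<in> space M - Zi i" using x i by (auto simp: Z_def)
      then show "T x \<in> A \<longleftrightarrow> T (\<psi> i (V i x)) \<in> b i ` A"
        using match[OF i _ A] E0D[OF xs AD(1)] E0D[OF y bA] by blast
    qed
  qed
  have "\<forall>i\<in>I. \<psi> i \<in> mp_automorphisms M \<and>
        (\<forall>y\<in>space M. \<exists>x\<in>space M. \<exists>t u. y = (U ^^ t) x \<and> \<psi> i y = (U ^^ u) x)"
    using \<psi> orb by blast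
  moreover have "\<forall>x\<in>space M - Z. \<forall>A\<in>\<A>. (T x \<in> A \<longleftrightarrow> T (U x) \<in> b0 ` A) \<and>
        (\<forall>i\<in>I. T x \<in> A \<longleftrightarrow> T (\<psi> i (V i x)) \<in> b i ` A)"
    by (intro ballI good)
  ultimately show ?thesis
    by (intro bexI[OF _ T] exI[of _ \<psi>] conjI bexI[OF _ Zm] Zp)
qed

end

section \<open>Classes of automorphisms, words and actions of free groups\<close>

definition aut_class :: "'a measure \<Rightarrow> ('a \<Rightarrow> 'a) \<Rightarrow> ('a \<Rightarrow> 'a) set" where
  "aut_class M T = aut_rel M `` {T}"

lemma equiv_aut_rel: "equiv (mp_automorphisms M) (aut_rel M)"
proof -
  have "trans (aut_rel M)"
  proof (rule transI)
    fix R S T assume "(R, S) \<in> aut_rel M" "(S, T) \<in> aut_rel M"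
    then show "(R, T) \<in> aut_rel M" unfolding aut_rel_def by (auto elim: eventually_elim2)
  qed
  moreover have "sym (aut_rel M)" unfolding sym_def aut_rel_def by (auto elim: eventually_mono)
  moreover have "refl_on (mp_automorphisms M) (aut_rel M)" by (auto simp: refl_on_def aut_rel_def)
  moreover have "aut_rel M \<subseteq> mp_automorphisms M \<times> mp_automorphisms M" by (auto simp: aut_rel_def)
  ultimately show ?thesis unfolding Equiv_Relations.equiv_def by blast
qed

lemma aut_class_eq:
  assumes "S \<in> mp_automorphisms M" "T \<in> mp_automorphisms M"
  shows "aut_class M S = aut_class M T \<longleftrightarrow> (AE x in M. S x = T x)"
proof -
  have "aut_class M S = aut_class M T \<longleftrightarrow> (S, T) \<in> aut_rel M"
    unfolding aut_class_def by (rule eq_equiv_class_iff[OF equiv_aut_rel assms])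
  also have "\<dots> \<longleftrightarrow> (AE x in M. S x = T x)" using assms by (simp add: aut_rel_def)
  finally show ?thesis .
qed

lemma aut_class_carrier: "T \<in> mp_automorphisms M \<Longrightarrow> aut_class M T \<in> carrier (Aut M)"
  by (auto simp: Aut_def aut_class_def intro: quotientI)

lemma aut_rep_carrier:
  assumes "c \<in> carrier (Aut M)"
  shows "aut_rep c \<in> mp_automorphisms M" "aut_class M (aut_rep c) = c"
proof -
  obtain T where T: "T \<in> mp_automorphisms M" "c = aut_rel M `` {T}"
    using assms by (auto simp: Aut_def elim: quotientE)
  have "T \<in> c" using T by (auto simp: aut_rel_def)
  then have r: "aut_rep c \<in> c" unfolding aut_rep_def by (rule someI[of "\<lambda>T. T \<in> c"])
  then show m: "aut_rep c \<in> mp_automorphisms M" using T by (auto simp: aut_rel_def)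
  have "(T, aut_rep c) \<in> aut_rel M" using r T by auto
  then show "aut_class M (aut_rep c) = c"
    unfolding T(2) aut_class_def using equiv_class_eq[OF equiv_aut_rel] by metis
qed

lemma aut_rep_class:
  assumes "T \<in> mp_automorphisms M"
  shows "aut_rep (aut_class M T) \<in> mp_automorphisms M" "AE x in M. aut_rep (aut_class M T) x = T x"
  using aut_rep_carrier[OF aut_class_carrier[OF assms]] aut_class_eq[OF _ assms] by auto

lemma Aut_mult: "c \<otimes>\<^bsub>Aut M\<^esub> d = aut_class M (aut_rep c \<circ> aut_rep d)"
  by (simp add: Aut_def aut_class_def)

lemma AE_minv_cong:
  assumes S: "S \<in> mp_automorphisms M" and T: "T \<in> mp_automorphisms M" and e: "AE x in M. S x = T x"
  shows "AE y in M. minv M S y = minv M T y"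
proof -
  have "AE y in M. S (minv M T y) = T (minv M T y)" by (rule AE_mp_aut[OF mp_aut_minv[OF T] e])
  then show ?thesis using AE_space
  proof eventually_elim
    case (elim y)
    then have "S (minv M T y) = y" using minv_right[OF T] by simp
    then show ?case using minv_left[OF S minv_space[OF T elim(2)]] by simp
  qed
qed

text \<open>
  Words act through genuine bijections of the space, so orbits can be compared point by point. The
  passage to classes modulo null sets costs one null set for each of the countably many words.
\<close>

definition letter_act :: "'a measure \<Rightarrow> ('s \<Rightarrow> 'a \<Rightarrow> 'a) \<Rightarrow> 's \<times> bool \<Rightarrow> 'a \<Rightarrow> 'a" where
  "letter_act M f l = (if snd l then f (fst l) else minv M (f (fst l)))"

definition word_act :: "'a measure \<Rightarrow> ('s \<Rightarrow> 'a \<Rightarrow> 'a) \<Rightarrow> ('s \<times> bool) list \<Rightarrow> 'a \<Rightarrow> 'a" where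
  "word_act M f w = foldr (letter_act M f) w"

definition word_orbit :: "'a measure \<Rightarrow> 's set \<Rightarrow> ('s \<Rightarrow> 'a \<Rightarrow> 'a) \<Rightarrow> 'a \<Rightarrow> 'a set" where
  "word_orbit M S f x = (\<lambda>w. word_act M f w x) ` lists (S \<times> UNIV)"

lemma word_act_simps [simp]:
  "word_act M f [] = id" "word_act M f (l # w) = letter_act M f l \<circ> word_act M f w"
  "word_act M f (u @ v) = word_act M f u \<circ> word_act M f v"
  by (auto simp: word_act_def)

lemma word_act_replicate: "word_act M f (replicate n (s, True)) = (f s ^^ n)"
  "word_act M f (replicate n (s, False)) = (minv M (f s) ^^ n)"
  by (induction n) (auto simp: letter_act_def)

definition flip :: "'s \<times> bool \<Rightarrow> 's \<times> bool" where "flip l = (fst l, \<not> snd l)"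

context
  fixes M :: "'a measure" and S :: "'s set" and f :: "'s \<Rightarrow> 'a \<Rightarrow> 'a"
  assumes f: "\<And>s. s \<in> S \<Longrightarrow> f s \<in> mp_automorphisms M"
begin

lemma letter_act_mp: "l \<in> S \<times> UNIV \<Longrightarrow> letter_act M f l \<in> mp_automorphisms M"
  using f mp_aut_minv[OF f] by (auto simp: letter_act_def)

lemma word_act_mp: "w \<in> lists (S \<times> UNIV) \<Longrightarrow> word_act M f w \<in> mp_automorphisms M"
proof (induction w)
  case (Cons l w)
  then have "letter_act M f l \<circ> word_act M f w \<in> mp_automorphisms M"
    by (intro mp_aut_comp(1) letter_act_mp) auto
  then show ?case by (simp only: word_act_simps)
qed (simp add: mp_aut_id(1))

lemma letter_act_flip:
  assumes "l \<in> S \<times> UNIV" "x \<in> space M"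
  shows "letter_act M f (flip l) (letter_act M f l x) = x"
  using assms f by (auto simp: letter_act_def flip_def minv_left minv_right)

lemma word_act_flip:
  "w \<in> lists (S \<times> UNIV) \<Longrightarrow> x \<in> space M \<Longrightarrow> word_act M f (rev (map flip w)) (word_act M f w x) = x"
proof (induction w)
  case (Cons l w)
  then have "letter_act M f (flip l) (letter_act M f l (word_act M f w x)) = word_act M f w x"
    using mp_aut_space[OF word_act_mp] by (intro letter_act_flip) auto
  then show ?case using Cons by simp
qed simp

lemma word_orbit_refl: "x \<in> word_orbit M S f x"
  unfolding word_orbit_def by (rule image_eqI[of _ _ "[]"]) auto

lemma word_orbit_sym: assumes "x \<in> space M" "y \<in> word_orbit M S f x" shows "x \<in> word_orbit M S f y"
proof -
  obtain w where w: "w \<in> lists (S \<times> UNIV)" "y = word_act M f w x" using assms by (auto simp: word_orbit_def)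
  have "rev (map flip w) \<in> lists (S \<times> UNIV)" using w(1) by (auto simp: flip_def in_lists_conv_set)
  moreover have "x = word_act M f (rev (map flip w)) y" using word_act_flip[OF w(1) assms(1)] w(2) by simp
  ultimately show ?thesis unfolding word_orbit_def by blast
qed

lemma word_orbit_trans:
  assumes "y \<in> word_orbit M S f x" "z \<in> word_orbit M S f y" shows "z \<in> word_orbit M S f x"
proof -
  obtain u v where "u \<in> lists (S \<times> UNIV)" "y = word_act M f u x" "v \<in> lists (S \<times> UNIV)" "z = word_act M f v y"
    using assms by (auto simp: word_orbit_def)
  then have "v @ u \<in> lists (S \<times> UNIV)" "z = word_act M f (v @ u) x" by auto
  then show ?thesis unfolding word_orbit_def by blast
qed

lemma word_orbit_gen: "s \<in> S \<Longrightarrow> f s x \<in> word_orbit M S f x"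
  unfolding word_orbit_def by (rule image_eqI[of _ _ "[(s, True)]"]) (auto simp: letter_act_def)

lemma word_orbit_funpow: "s \<in> S \<Longrightarrow> (f s ^^ n) x \<in> word_orbit M S f x"
  unfolding word_orbit_def by (rule image_eqI[of _ _ "replicate n (s, True)"]) (auto simp: word_act_replicate in_lists_conv_set)

end

text \<open>
  Orbits are classes of an equivalence relation, so closure under the generators implies closure
  under their inverses.
\<close>

lemma word_orbit_subset:
  assumes f: "\<And>s. s \<in> S \<Longrightarrow> f s \<in> mp_automorphisms M" and h: "\<And>s. s \<in> S \<Longrightarrow> h s \<in> mp_automorphisms M"
    and sub: "\<And>s y. s \<in> S \<Longrightarrow> y \<in> space M \<Longrightarrow> h s y \<in> word_orbit M S f y" and x: "x \<in> space M"
  shows "word_orbit M S h x \<subseteq> word_orbit M S f x"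
proof -
  have l: "letter_act M h l y \<in> word_orbit M S f y" if l: "l \<in> S \<times> UNIV" and y: "y \<in> space M" for l y
  proof (cases "snd l")
    case True then show ?thesis using sub l y by (auto simp: letter_act_def)
  next
    case False
    have s: "fst l \<in> S" using l by auto
    let ?z = "minv M (h (fst l)) y"
    have z: "?z \<in> space M" by (rule minv_space[OF h[OF s] y])
    have "y \<in> word_orbit M S f ?z" using sub[OF s z] minv_right[OF h[OF s] y] by simp
    then show ?thesis using word_orbit_sym[where f = f, OF f z] False by (simp add: letter_act_def)
  qed
  have "word_act M h w x \<in> word_orbit M S f x" if "w \<in> lists (S \<times> UNIV)" for w
    using that
  proof (induction w)
    case Nil then show ?case using word_orbit_refl[of S f M] f by simp
  next
    case (Cons k w)
    then have 1: "word_act M h w x \<in> word_orbit M S f x" by simp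
    have "letter_act M h k (word_act M h w x) \<in> word_orbit M S f (word_act M h w x)"
    proof (rule l)
      show "k \<in> S \<times> UNIV" using Cons by simp
      have "w \<in> lists (S \<times> UNIV)" using Cons by simp
      then show "word_act M h w x \<in> space M"
        using mp_aut_space[OF word_act_mp[where f = h, OF h] x] by blast
    qed
    then show ?case using word_orbit_trans[where f = f, OF f 1] by simp
  qed
  then show ?thesis by (auto simp: word_orbit_def[of M S h])
qed

text \<open>
  The point \<open>h s y\<close> is on the \<open>f r\<close>-orbit of \<open>f s y\<close>, and
  \<open>f r = h r\<close> belongs to both families; so each family can undo the change made by the
  other.
\<close>

lemma word_orbit_full_group:
  assumes f: "\<And>s. s \<in> S \<Longrightarrow> f s \<in> mp_automorphisms M" and h: "\<And>s. s \<in> S \<Longrightarrow> h s \<in> mp_automorphisms M"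
    and r: "r \<in> S" "h r = f r"
    and hf: "\<And>s y. s \<in> S \<Longrightarrow> y \<in> space M \<Longrightarrow>
        \<exists>x\<in>space M. \<exists>t u. f s y = (f r ^^ t) x \<and> h s y = (f r ^^ u) x"
    and x: "x \<in> space M"
  shows "word_orbit M S h x = word_orbit M S f x"
proof
  show "word_orbit M S h x \<subseteq> word_orbit M S f x"
  proof (rule word_orbit_subset[OF f h _ x])
    fix s y assume s: "s \<in> S" "y \<in> space M"
    obtain z t u where z: "z \<in> space M" "f s y = (f r ^^ t) z" "h s y = (f r ^^ u) z" using hf[OF s] by blast
    have "z \<in> word_orbit M S f (f s y)"
      using word_orbit_sym[where f = f, OF f z(1) word_orbit_funpow[where f = f and n = t, OF f r(1)]] z(2) by simp
    then have "z \<in> word_orbit M S f y" using word_orbit_trans[where f = f, OF f word_orbit_gen[where f = f and x = y, OF f s(1)]] by blast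
    then show "h s y \<in> word_orbit M S f y" using word_orbit_trans[where f = f, OF f _ word_orbit_funpow[where f = f and n = u, OF f r(1)]] z(3) by metis
  qed
  show "word_orbit M S f x \<subseteq> word_orbit M S h x"
  proof (rule word_orbit_subset[OF h f _ x])
    fix s y assume s: "s \<in> S" "y \<in> space M"
    obtain z t u where z: "z \<in> space M" "f s y = (h r ^^ t) z" "h s y = (h r ^^ u) z" using hf[OF s] unfolding r(2) by blast
    have "z \<in> word_orbit M S h (h s y)"
      using word_orbit_sym[where f = h, OF h z(1) word_orbit_funpow[where f = h and n = u, OF h r(1)]] z(3) by simp
    then have "z \<in> word_orbit M S h y" using word_orbit_trans[where f = h, OF h word_orbit_gen[where f = h and x = y, OF h s(1)]] by blast
    then show "f s y \<in> word_orbit M S h y" using word_orbit_trans[where f = h, OF h _ word_orbit_funpow[where f = h and n = t, OF h r(1)]] z(2) by metis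
  qed
qed

lemma word_act_conjugate:
  assumes f: "\<And>s. s \<in> S \<Longrightarrow> f s \<in> mp_automorphisms M" and T: "T \<in> mp_automorphisms M"
    and w: "w \<in> lists (S \<times> UNIV)" and x: "x \<in> space M"
  shows "word_act M (\<lambda>s. T \<circ> f s \<circ> minv M T) w (T x) = T (word_act M f w x)"
  using w
proof (induction w)
  case (Cons l w)
  let ?y = "word_act M f w x"
  have y: "?y \<in> space M" using mp_aut_space[OF word_act_mp[where f = f, OF f] x] Cons by auto
  have s: "fst l \<in> S" using Cons by auto
  note m = mp_aut_comp[OF mp_aut_comp(1)[OF T f[OF s]] mp_aut_minv[OF T]]
  have "letter_act M (\<lambda>s. T \<circ> f s \<circ> minv M T) l (T ?y) = T (letter_act M f l ?y)"
  proof (cases "snd l")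
    case True then show ?thesis using y minv_left[OF T y] by (simp add: letter_act_def)
  next
    case False
    have ty: "T ?y \<in> space M" by (rule mp_aut_space[OF T y])
    have i: "minv M (f (fst l)) ?y \<in> space M" by (rule minv_space[OF f[OF s] y])
    have "minv M (T \<circ> f (fst l) \<circ> minv M T) (T ?y) = minv M (minv M T) (minv M (T \<circ> f (fst l)) (T ?y))"
      by (rule m(2)[OF ty])
    also have "minv M (T \<circ> f (fst l)) (T ?y) = minv M (f (fst l)) ?y"
      using mp_aut_comp(2)[OF T f[OF s] ty] minv_left[OF T y] by simp
    also have "minv M (minv M T) (minv M (f (fst l)) ?y) = T (minv M (f (fst l)) ?y)"
      using minv_left[OF mp_aut_minv[OF T] mp_aut_space[OF T i]] minv_left[OF T i] by simp
    finally show ?thesis using False by (simp add: letter_act_def del: o_apply)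
  qed
  then show ?case using Cons by (simp add: comp_def)
qed simp

lemma word_value_simps:
  "word_value G [] = \<one>\<^bsub>G\<^esub>" "word_value G (l # w) = letter_value G l \<otimes>\<^bsub>G\<^esub> word_value G w"
  by (auto simp: word_value_def)

context group
begin

lemma letter_value_closed: "S \<subseteq> carrier G \<Longrightarrow> l \<in> S \<times> UNIV \<Longrightarrow> letter_value G l \<in> carrier G"
  by (auto simp: letter_value_def)

lemma word_value_closed: "S \<subseteq> carrier G \<Longrightarrow> w \<in> lists (S \<times> UNIV) \<Longrightarrow> word_value G w \<in> carrier G"
proof (induction w)
  case (Cons l w)
  then show ?case using letter_value_closed[of S l] by (simp add: word_value_simps)
qed (simp add: word_value_simps)

lemma word_value_append:
  assumes S: "S \<subseteq> carrier G" and u: "u \<in> lists (S \<times> UNIV)" and v: "v \<in> lists (S \<times> UNIV)"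
  shows "word_value G (u @ v) = word_value G u \<otimes> word_value G v"
  using u
proof (induction u)
  case Nil then show ?case using word_value_closed[OF S v] by (simp add: word_value_simps)
next
  case (Cons l u)
  then show ?case using letter_value_closed[OF S, of l] word_value_closed[OF S, of u] word_value_closed[OF S v]
    by (simp add: word_value_simps m_assoc)
qed

text \<open>
  Cancelling a letter against its inverse changes neither the value in the group nor the action on
  points. Together with uniqueness of reduced words this shows that the action of a word depends
  only on its value.
\<close>

lemma reduce_word:
  assumes S: "S \<subseteq> carrier G" and f: "\<And>s. s \<in> S \<Longrightarrow> f s \<in> mp_automorphisms M"
    and w: "w \<in> lists (S \<times> UNIV)"
  shows "\<exists>v\<in>reduced_words S. word_value G v = word_value G w \<and> (\<forall>x\<in>space M. word_act M f v x = word_act M f w x)"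
  using w
proof (induction w)
  case Nil then show ?case by (intro bexI[of _ "[]"]) (auto simp: reduced_words_def)
next
  case (Cons l w)
  then obtain v where v: "v \<in> reduced_words S" "word_value G v = word_value G w"
    "\<And>x. x \<in> space M \<Longrightarrow> word_act M f v x = word_act M f w x" by auto
  have l: "l \<in> S \<times> UNIV" using Cons by auto
  show ?case
  proof (cases "l # v \<in> reduced_words S")
    case True
    then show ?thesis using v by (intro bexI[of _ "l # v"]) (auto simp: word_value_simps)
  next
    case False
    then obtain k v' where k: "v = k # v'" "fst k = fst l" "snd k \<noteq> snd l"
      using v(1) l by (cases v) (auto simp: reduced_words_def successively_Cons)
    have kS: "k \<in> S \<times> UNIV" "v' \<in> lists (S \<times> UNIV)" using v(1) k(1) by (auto simp: reduced_words_def)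
    have fk: "l = flip k" using k by (cases l; cases k) (auto simp: flip_def)
    have "v' \<in> reduced_words S" using v(1) k(1) by (cases v') (auto simp: reduced_words_def successively_Cons)
    moreover have "word_value G v' = word_value G (l # w)"
    proof -
      have "letter_value G l \<otimes> (letter_value G k \<otimes> word_value G v') = word_value G v'"
        using kS word_value_closed[OF S kS(2)] S unfolding fk
        by (auto simp: letter_value_def flip_def m_assoc[symmetric])
      then show ?thesis using v(2) k(1) by (simp add: word_value_simps)
    qed
    moreover have "word_act M f v' x = word_act M f (l # w) x" if x: "x \<in> space M" for x
    proof -
      have "word_act M f (l # w) x = letter_act M f (flip k) (letter_act M f k (word_act M f v' x))"
        using v(3)[OF x] k(1) by (simp add: fk)
      also have "\<dots> = word_act M f v' x"
        by (rule letter_act_flip[OF f kS(1) mp_aut_space[OF word_act_mp[where f = f, OF f kS(2)] x]])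
      finally show ?thesis by simp
    qed
    ultimately show ?thesis by (intro bexI[of _ v']) auto
  qed
qed

end

lemma free_onD:
  assumes "free_on G S" shows "group G" "S \<subseteq> carrier G" "inj_on (word_value G) (reduced_words S)"
    "word_value G ` reduced_words S = carrier G"
  using assms by (auto simp: free_on_def bij_betw_def)

lemma reduced_words_lists: "w \<in> reduced_words S \<Longrightarrow> w \<in> lists (S \<times> UNIV)"
  by (auto simp: reduced_words_def)

lemma free_carrier:
  assumes "free_on G S" shows "carrier G = word_value G ` lists (S \<times> UNIV)"
proof -
  interpret group G by (rule free_onD(1)[OF assms])
  show ?thesis
    using free_onD(4)[OF assms] word_value_closed[OF free_onD(2)[OF assms]] reduced_words_lists by blast
qed

lemma countable_words: "countable S \<Longrightarrow> countable (lists (S \<times> (UNIV :: bool set)))"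
  by (intro countable_lists countable_SIGMA) auto

lemma actionsD:
  assumes a: "a \<in> actions G M" and g: "g \<in> carrier G"
  shows "a g \<in> carrier (Aut M)" "aut_rep (a g) \<in> mp_automorphisms M"
proof -
  show c: "a g \<in> carrier (Aut M)" using assms by (auto simp: actions_def hom_def)
  show "aut_rep (a g) \<in> mp_automorphisms M" by (rule aut_rep_carrier(1)[OF c])
qed

lemma action_mult:
  assumes a: "a \<in> actions G M" and g: "g \<in> carrier G" "h \<in> carrier G" and G: "group G"
  shows "AE x in M. aut_rep (a (g \<otimes>\<^bsub>G\<^esub> h)) x = aut_rep (a g) (aut_rep (a h) x)"
proof -
  have "a (g \<otimes>\<^bsub>G\<^esub> h) = aut_class M (aut_rep (a g) \<circ> aut_rep (a h))"
    using a g by (simp add: actions_def hom_def Aut_mult)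
  then show ?thesis
    using aut_rep_class(2)[OF mp_aut_comp(1)[OF actionsD(2)[OF a g(1)] actionsD(2)[OF a g(2)]]] by simp
qed

lemma action_one:
  assumes a: "a \<in> actions G M" and G: "group G"
  shows "AE x in M. aut_rep (a \<one>\<^bsub>G\<^esub>) x = x"
proof -
  interpret group G by (rule G)
  have m: "aut_rep (a \<one>\<^bsub>G\<^esub>) \<in> mp_automorphisms M" by (rule actionsD(2)[OF a]) simp
  have "AE x in M. aut_rep (a \<one>\<^bsub>G\<^esub>) x = aut_rep (a \<one>\<^bsub>G\<^esub>) (aut_rep (a \<one>\<^bsub>G\<^esub>) x)"
    using action_mult[OF a _ _ G, of "\<one>\<^bsub>G\<^esub>" "\<one>\<^bsub>G\<^esub>"] by simp
  then show ?thesis using AE_space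
  proof eventually_elim
    case (elim x)
    then show ?case using mp_aut_inj[OF m elim(2) mp_aut_space[OF m elim(2)]] by simp
  qed
qed

lemma action_word:
  assumes a: "a \<in> actions G M" and G: "group G" and S: "S \<subseteq> carrier G"
    and f: "\<And>s. s \<in> S \<Longrightarrow> f s \<in> mp_automorphisms M" and af: "\<And>s. s \<in> S \<Longrightarrow> AE x in M. aut_rep (a s) x = f s x"
    and w: "w \<in> lists (S \<times> UNIV)"
  shows "AE x in M. aut_rep (a (word_value G w)) x = word_act M f w x"
proof -
  interpret group G by (rule G)
  have letter: "AE x in M. aut_rep (a (letter_value G l)) x = letter_act M f l x" if l: "l \<in> S \<times> UNIV" for l
  proof (cases "snd l")
    case True then show ?thesis using af l by (auto simp: letter_value_def letter_act_def)
  next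
    case False
    define s where "s = fst l"
    have s: "s \<in> S" "s \<in> carrier G" using l S by (auto simp: s_def)
    have m: "aut_rep (a s) \<in> mp_automorphisms M" by (rule actionsD(2)[OF a s(2)])
    have "AE x in M. aut_rep (a (inv\<^bsub>G\<^esub> s)) (aut_rep (a s) x) = x"
      using action_mult[OF a inv_closed[OF s(2)] s(2) G] action_one[OF a G] s(2) by auto
    from AE_mp_aut[OF mp_aut_minv[OF m] this]
    have 1: "AE y in M. aut_rep (a (inv\<^bsub>G\<^esub> s)) (aut_rep (a s) (minv M (aut_rep (a s)) y)) = minv M (aut_rep (a s)) y" .
    have 2: "AE y in M. minv M (aut_rep (a s)) y = minv M (f s) y" by (rule AE_minv_cong[OF m f[OF s(1)] af[OF s(1)]])
    from 1 2 AE_space have "AE y in M. aut_rep (a (inv\<^bsub>G\<^esub> s)) y = minv M (f s) y"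
    proof eventually_elim
      case (elim y) then show ?case using minv_right[OF m elim(3)] by simp
    qed
    then show ?thesis using False by (simp add: letter_value_def letter_act_def s_def)
  qed
  show ?thesis using w
  proof (induction w)
    case Nil then show ?case using action_one[OF a G] by (simp add: word_value_simps)
  next
    case (Cons l w)
    then have l: "l \<in> S \<times> UNIV" and w: "w \<in> lists (S \<times> UNIV)"
      and IH: "AE x in M. aut_rep (a (word_value G w)) x = word_act M f w x" by auto
    have "AE x in M. aut_rep (a (letter_value G l)) (word_act M f w x) = letter_act M f l (word_act M f w x)"
      by (rule AE_mp_aut[OF word_act_mp[where f = f, OF f w] letter[OF l]])
    with action_mult[OF a letter_value_closed[OF S l] word_value_closed[OF S w] G] IH show ?case
      unfolding word_value_simps
    proof eventually_elim
      case (elim x) then show ?case by simp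
    qed
  qed
qed

lemma action_orbit_word_orbit:
  assumes a: "a \<in> actions G M" and free: "free_on G S" and S: "countable S"
    and f: "\<And>s. s \<in> S \<Longrightarrow> f s \<in> mp_automorphisms M" and af: "\<And>s. s \<in> S \<Longrightarrow> AE x in M. aut_rep (a s) x = f s x"
  shows "AE x in M. action_orbit G a x = word_orbit M S f x"
proof -
  have "AE x in M. \<forall>w\<in>lists (S \<times> UNIV). aut_rep (a (word_value G w)) x = word_act M f w x"
    unfolding AE_ball_countable[OF countable_words[OF S]]
    by (intro ballI action_word[OF a free_onD(1)[OF free] free_onD(2)[OF free] f af])
  then show ?thesis
  proof eventually_elim
    case (elim x)
    then show ?case unfolding action_orbit_def word_orbit_def free_carrier[OF free] image_image by (intro image_cong) auto
  qed
qed

text \<open>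
  The universal property of a free group: an element acts as its reduced word does.
\<close>

lemma free_action_exists:
  assumes free: "free_on G S" and f: "\<And>s. s \<in> S \<Longrightarrow> f s \<in> mp_automorphisms M"
  shows "\<exists>b\<in>actions G M. \<forall>s\<in>S. AE x in M. aut_rep (b s) x = f s x"
proof -
  interpret group G by (rule free_onD(1)[OF free])
  have S: "S \<subseteq> carrier G" by (rule free_onD(2)[OF free])
  define rw where "rw g = the_inv_into (reduced_words S) (word_value G) g" for g
  have rw: "rw g \<in> reduced_words S" "word_value G (rw g) = g" if "g \<in> carrier G" for g
    using that free_onD(3,4)[OF free] unfolding rw_def by (auto intro: the_inv_into_into f_the_inv_into_f)
  have rwl: "rw g \<in> lists (S \<times> UNIV)" if "g \<in> carrier G" for g by (rule reduced_words_lists[OF rw(1)[OF that]])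
  have act: "word_act M f w x = word_act M f (rw (word_value G w)) x" if w: "w \<in> lists (S \<times> UNIV)" and x: "x \<in> space M" for w x
  proof -
    obtain v where v: "v \<in> reduced_words S" "word_value G v = word_value G w" "word_act M f v x = word_act M f w x"
      using reduce_word[where f = f, OF S f w] x by blast
    have "v = rw (word_value G w)"
      using the_inv_into_f_f[OF free_onD(3)[OF free] v(1)] v(2) by (simp add: rw_def)
    then show ?thesis using v(3) by simp
  qed
  have m: "word_act M f (rw g) \<in> mp_automorphisms M" if "g \<in> carrier G" for g by (rule word_act_mp[where f = f, OF f rwl[OF that]])
  define b where "b = restrict (\<lambda>g. aut_class M (word_act M f (rw g))) (carrier G)"
  have b: "b g = aut_class M (word_act M f (rw g))" if "g \<in> carrier G" for g using that by (simp add: b_def)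
  have "b \<in> hom G (Aut M)"
  proof (rule homI)
    fix g assume g: "g \<in> carrier G"
    show "b g \<in> carrier (Aut M)" unfolding b[OF g] by (rule aut_class_carrier[OF m[OF g]])
    fix h assume h: "h \<in> carrier G"
    have gh: "g \<otimes>\<^bsub>G\<^esub> h \<in> carrier G" using g h by simp
    note rg = aut_rep_class[OF m[OF g]] and rh = aut_rep_class[OF m[OF h]]
    have "AE x in M. aut_rep (aut_class M (word_act M f (rw g))) (word_act M f (rw h) x) = word_act M f (rw g) (word_act M f (rw h) x)"
      by (rule AE_mp_aut[OF m[OF h] rg(2)])
    with rh(2) AE_space have "AE x in M. word_act M f (rw (g \<otimes>\<^bsub>G\<^esub> h)) x =
        (aut_rep (aut_class M (word_act M f (rw g))) \<circ> aut_rep (aut_class M (word_act M f (rw h)))) x"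
    proof eventually_elim
      case (elim x)
      have "rw g @ rw h \<in> lists (S \<times> UNIV)" using rwl[OF g] rwl[OF h] by simp
      from act[OF this elim(2)] word_value_append[OF S rwl[OF g] rwl[OF h]]
      have "word_act M f (rw (g \<otimes>\<^bsub>G\<^esub> h)) x = word_act M f (rw g) (word_act M f (rw h) x)"
        using rw(2)[OF g] rw(2)[OF h] by simp
      then show ?case using elim by simp
    qed
    then show "b (g \<otimes>\<^bsub>G\<^esub> h) = b g \<otimes>\<^bsub>Aut M\<^esub> b h"
      unfolding b[OF g] b[OF h] b[OF gh] Aut_mult
      by (subst aut_class_eq[OF m[OF gh] mp_aut_comp(1)[OF rg(1) rh(1)]])
  qed
  then have "b \<in> actions G M" by (auto simp: actions_def b_def)
  moreover have "AE x in M. aut_rep (b s) x = f s x" if s: "s \<in> S" for s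
  proof -
    have sc: "s \<in> carrier G" using s S by auto
    have "[(s, True)] \<in> reduced_words S" using s by (simp add: reduced_words_def)
    moreover have "word_value G [(s, True)] = s" using sc by (simp add: word_value_simps letter_value_def)
    ultimately have "rw s = [(s, True)]" using the_inv_into_f_f[OF free_onD(3)[OF free], of "[(s, True)]"] by (simp add: rw_def)
    then show ?thesis using aut_rep_class(2)[OF m[OF sc]] b[OF sc] by (simp add: letter_act_def)
  qed
  ultimately show ?thesis by blast
qed

section \<open>Orbit equivalence and approximation on generators\<close>

text \<open>
  Up to null sets the orbits of \<open>a\<close> are the word orbits of \<open>f\<close>, which are
  those of \<open>h\<close>, and \<open>T\<close> carries the latter to those of \<open>c\<close>.
\<close>

lemma oe_classI:
  assumes free: "free_on G S" and S: "countable S" and a: "a \<in> actions G M" and c: "c \<in> actions G M"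
    and T: "T \<in> mp_automorphisms M"
    and f: "\<And>s. s \<in> S \<Longrightarrow> f s \<in> mp_automorphisms M" and af: "\<And>s. s \<in> S \<Longrightarrow> AE x in M. aut_rep (a s) x = f s x"
    and h: "\<And>s. s \<in> S \<Longrightarrow> h s \<in> mp_automorphisms M"
    and ch: "\<And>s. s \<in> S \<Longrightarrow> AE x in M. aut_rep (c s) x = (T \<circ> h s \<circ> minv M T) x"
    and orb: "\<And>x. x \<in> space M \<Longrightarrow> word_orbit M S h x = word_orbit M S f x"
  shows "c \<in> oe_class G M a"
proof -
  let ?R = "aut_rep (aut_class M T)"
  have conj: "T \<circ> h s \<circ> minv M T \<in> mp_automorphisms M" if "s \<in> S" for s
    by (intro mp_aut_comp(1) T h that mp_aut_minv)
  have 1: "AE x in M. action_orbit G a x = word_orbit M S f x"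
    by (rule action_orbit_word_orbit[OF a free S f af])
  have "AE x in M. action_orbit G c x = word_orbit M S (\<lambda>s. T \<circ> h s \<circ> minv M T) x"
    by (rule action_orbit_word_orbit[where f = "\<lambda>s. T \<circ> h s \<circ> minv M T", OF c free S conj ch])
  from AE_mp_aut[OF T this]
  have 2: "AE x in M. action_orbit G c (T x) = word_orbit M S (\<lambda>s. T \<circ> h s \<circ> minv M T) (T x)" .
  have 3: "AE x in M. ?R x = T x" by (rule aut_rep_class(2)[OF T])
  have 4: "AE x in M. \<forall>w\<in>lists (S \<times> UNIV). ?R (word_act M f w x) = T (word_act M f w x)"
    unfolding AE_ball_countable[OF countable_words[OF S]]
    by (intro ballI AE_mp_aut[OF word_act_mp[where f = f, OF f] 3])
  have "AE x in M. ?R ` action_orbit G a x = action_orbit G c (?R x)"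
    using 1 2 3 4 AE_space
  proof eventually_elim
    case (elim x)
    have "?R ` action_orbit G a x = (\<lambda>w. T (word_act M f w x)) ` lists (S \<times> UNIV)"
      unfolding elim(1) word_orbit_def image_image by (intro image_cong refl) (use elim(4) in blast)
    also have "\<dots> = T ` word_orbit M S f x" by (simp add: word_orbit_def image_image)
    also have "\<dots> = T ` word_orbit M S h x" using orb[OF elim(5)] by simp
    also have "\<dots> = (\<lambda>w. word_act M (\<lambda>s. T \<circ> h s \<circ> minv M T) w (T x)) ` lists (S \<times> UNIV)"
      unfolding word_orbit_def image_image
      by (intro image_cong refl) (rule word_act_conjugate[where f = h, OF h T _ elim(5), symmetric])
    also have "\<dots> = action_orbit G c (?R x)" unfolding elim(3) elim(2) word_orbit_def ..
    finally show ?case .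
  qed
  then show ?thesis
    using c aut_class_carrier[OF T] unfolding oe_class_def orbit_equivalent_def by blast
qed

text \<open>
  A nonempty reduced word has a nontrivial value, since the empty word is the only reduced word of
  value 1.
\<close>

lemma free_action_words:
  assumes free: "free_on G S" and S: "countable S" and a: "a \<in> actions G M" and ef: "essentially_free G M a"
    and f: "\<And>s. s \<in> S \<Longrightarrow> f s \<in> mp_automorphisms M" and af: "\<And>s. s \<in> S \<Longrightarrow> AE x in M. aut_rep (a s) x = f s x"
  shows "AE x in M. \<forall>w\<in>reduced_words S. w \<noteq> [] \<longrightarrow> word_act M f w x \<noteq> x"
proof -
  have "AE x in M. \<forall>w\<in>lists (S \<times> UNIV). aut_rep (a (word_value G w)) x = word_act M f w x"
    unfolding AE_ball_countable[OF countable_words[OF S]]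
    by (intro ballI action_word[OF a free_onD(1)[OF free] free_onD(2)[OF free] f af])
  with ef[unfolded essentially_free_def] show ?thesis
  proof eventually_elim
    case (elim x)
    show ?case
    proof (intro ballI impI notI)
      fix w assume w: "w \<in> reduced_words S" "w \<noteq> []" and e: "word_act M f w x = x"
      have wl: "w \<in> lists (S \<times> UNIV)" by (rule reduced_words_lists[OF w(1)])
      have "word_value G w \<in> carrier G" using free_onD(4)[OF free] w(1) by blast
      moreover have "aut_rep (a (word_value G w)) x = x" using elim(2) wl e by metis
      ultimately have "word_value G w \<in> {g \<in> carrier G. aut_rep (a g) x = x}" by simp
      then have "word_value G w = \<one>\<^bsub>G\<^esub>" unfolding elim(1) by simp
      then have "word_value G w = word_value G []" by (simp add: word_value_simps)
      moreover have "[] \<in> reduced_words S" by (simp add: reduced_words_def)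
      ultimately have "w = []" using free_onD(3)[OF free] w(1) by (auto simp: inj_on_def)
      then show False using w by simp
    qed
  qed
qed

lemma successively_replicate:
  assumes "P l l" "ys \<noteq> [] \<Longrightarrow> P l (hd ys)" "successively P ys"
  shows "successively P (replicate n l @ ys)"
proof (induction n)
  case (Suc n) then show ?case using assms by (cases n) (auto simp: successively_Cons)
qed (use assms in simp)

lemma successively_Cons_replicate:
  assumes "P k l" "P l l" "ys \<noteq> [] \<Longrightarrow> P l (hd ys)" "successively P ys" "n > 0"
  shows "successively P (k # replicate n l @ ys)"
  using successively_replicate[OF assms(2-4), of n] assms(1,5) by (cases n) auto

context
  fixes M :: "'a measure" and S :: "'s set" and f :: "'s \<Rightarrow> 'a \<Rightarrow> 'a"
  assumes f: "\<And>s. s \<in> S \<Longrightarrow> f s \<in> mp_automorphisms M"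
    and fw: "AE x in M. \<forall>w\<in>reduced_words S. w \<noteq> [] \<longrightarrow> word_act M f w x \<noteq> x"
begin

lemma generator_aperiodic:
  assumes r: "r \<in> S" shows "AE x in M. \<forall>k>0. (f r ^^ k) x \<noteq> x"
  using fw
proof eventually_elim
  case (elim x)
  show ?case
  proof (intro allI impI)
    fix k :: nat assume "k > 0"
    moreover have "replicate k (r, True) \<in> reduced_words S"
      using r successively_replicate[of "\<lambda>k l. fst k = fst l \<longrightarrow> snd k = snd l" "(r, True)" "[]" k]
      by (auto simp: reduced_words_def in_lists_conv_set)
    ultimately show "(f r ^^ k) x \<noteq> x" using elim word_act_replicate(1)[of M f k r] by fastforce
  qed
qed

text \<open>
  If the two points coincided, a nonempty reduced word of the form \<open>s r\<^sup>n inv s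
  r\<^sup>d\<close> or \<open>(inv r)\<^sup>d s r\<^sup>n inv s\<close>, or for \<open>n = 0\<close>
  a positive power of \<open>r\<close>, would fix a point of the orbit.
\<close>

lemma generator_separation:
  assumes r: "r \<in> S" and s: "s \<in> S" and ne: "r \<noteq> s"
  shows "AE x in M. \<forall>t t' p q. t \<noteq> t' \<longrightarrow>
      (f r ^^ q) (minv M (f s) ((f r ^^ t) x)) \<noteq> (f r ^^ p) (minv M (f s) ((f r ^^ t') x))"
proof -
  let ?U = "f r" and ?V = "f s" and ?Vi = "minv M (f s)"
  let ?P = "\<lambda>(k :: 's \<times> bool) l. fst k = fst l \<longrightarrow> snd k = snd l"
  have Um: "(?U ^^ n) \<in> mp_automorphisms M" for n by (rule mp_aut_funpow[OF f[OF r]])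
  have Usp: "x \<in> space M \<Longrightarrow> (?U ^^ n) x \<in> space M" for n x by (rule mp_aut_space[OF Um])
  have Visp: "x \<in> space M \<Longrightarrow> ?Vi x \<in> space M" for x by (rule minv_space[OF f[OF s]])
  have VVi: "x \<in> space M \<Longrightarrow> ?V (?Vi x) = x" for x by (rule minv_right[OF f[OF s]])
  have Ui: "(minv M ?U ^^ n) ((?U ^^ n) x) = x" if "x \<in> space M" for n x
  proof (induction n)
    case (Suc n)
    have "(minv M ?U ^^ Suc n) ((?U ^^ Suc n) x) = (minv M ?U ^^ n) (minv M ?U (?U ((?U ^^ n) x)))"
      by (simp add: funpow_swap1)
    also have "\<dots> = (minv M ?U ^^ n) ((?U ^^ n) x)" using minv_left[OF f[OF r] Usp[OF that, of n]] by simp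
    finally show ?case using Suc by simp
  qed simp
  have Uadd: "(?U ^^ i) ((?U ^^ k) x) = (?U ^^ (i + k)) x" for i k x by (simp add: funpow_add)
  have "AE x in M. \<forall>t. \<forall>w\<in>reduced_words S. w \<noteq> [] \<longrightarrow> word_act M f w ((?U ^^ t) x) \<noteq> (?U ^^ t) x"
    unfolding AE_all_countable using AE_mp_aut[OF Um fw] by blast
  with AE_space show ?thesis
  proof eventually_elim
    case (elim x)
    have free: "word_act M f w ((?U ^^ t) x) \<noteq> (?U ^^ t) x" if "w \<in> reduced_words S" "w \<noteq> []" for w t
      using elim(2) that by blast
    have lt: False if tt: "t < t'" and e: "(?U ^^ q) (?Vi ((?U ^^ t) x)) = (?U ^^ p) (?Vi ((?U ^^ t') x))" for t t' p q
    proof -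
      define y where "y = (?U ^^ t) x"
      define d where "d = t' - t"
      have d: "d > 0" and y': "(?U ^^ t') x = (?U ^^ d) y" using tt by (auto simp: d_def y_def Uadd)
      have ysp: "y \<in> space M" unfolding y_def by (rule Usp[OF elim(1)])
      have fy: "word_act M f w y \<noteq> y" if "w \<in> reduced_words S" "w \<noteq> []" for w
        unfolding y_def by (rule free[OF that])
      have e: "(?U ^^ q) (?Vi y) = (?U ^^ p) (?Vi ((?U ^^ d) y))" using e unfolding y' y_def[symmetric] .
      have dw: "(?U ^^ d) y \<noteq> y"
        using fy[of "replicate d (r, True)"] r d successively_replicate[of ?P "(r, True)" "[]" d]
        by (auto simp: word_act_replicate reduced_words_def in_lists_conv_set)
      show False
      proof (cases "q \<le> p")
        case True
        define n where "n = p - q"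
        have "(?U ^^ q) (?Vi y) = (?U ^^ q) ((?U ^^ n) (?Vi ((?U ^^ d) y)))" using e True by (simp add: Uadd n_def)
        then have "?Vi y = (?U ^^ n) (?Vi ((?U ^^ d) y))"
          using mp_aut_inj[OF Um Visp[OF ysp] Usp[OF Visp[OF Usp[OF ysp]]]] by blast
        then have y: "?V ((?U ^^ n) (?Vi ((?U ^^ d) y))) = y" using VVi[OF ysp] by metis
        show False
        proof (cases n)
          case 0 then show False using y VVi[OF Usp[OF ysp]] dw by simp
        next
          case (Suc n')
          let ?w = "(s, True) # replicate n (r, True) @ [(s, False)] @ replicate d (r, True)"
          have "successively ?P ?w"
            using ne d Suc successively_Cons_replicate[of ?P "(s, False)" "(r, True)" "[]" d]
            by (intro successively_Cons_replicate) auto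
          then have "?w \<in> reduced_words S"
            using r s unfolding reduced_words_def by (auto simp: in_lists_conv_set)
          then have "word_act M f ?w y \<noteq> y" by (intro fy) auto
          then show False using y by (simp add: word_act_replicate letter_act_def)
        qed
      next
        case False
        define n where "n = q - p"
        have "(?U ^^ p) ((?U ^^ n) (?Vi y)) = (?U ^^ p) (?Vi ((?U ^^ d) y))" using e False by (simp add: Uadd n_def)
        then have "(?U ^^ n) (?Vi y) = ?Vi ((?U ^^ d) y)"
          using mp_aut_inj[OF Um Usp[OF Visp[OF ysp]] Visp[OF Usp[OF ysp]]] by blast
        then have "?V ((?U ^^ n) (?Vi y)) = (?U ^^ d) y" using VVi[OF Usp[OF ysp]] by metis
        then have y: "(minv M ?U ^^ d) (?V ((?U ^^ n) (?Vi y))) = y" using Ui[OF ysp] by metis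
        obtain n' where n': "n = Suc n'" using False by (cases n) (auto simp: n_def)
        let ?w = "replicate d (r, False) @ [(s, True)] @ replicate n (r, True) @ [(s, False)]"
        have "successively ?P ?w"
          using ne n' successively_Cons_replicate[of ?P "(s, True)" "(r, True)" "[(s, False)]" n]
          by (intro successively_replicate) auto
        then have "?w \<in> reduced_words S"
          using r s unfolding reduced_words_def by (auto simp: in_lists_conv_set)
        then have "word_act M f ?w y \<noteq> y" by (intro fy) auto
        then show False using y by (simp add: word_act_replicate letter_act_def)
      qed
    qed
    show ?case
    proof (intro allI impI notI)
      fix t t' p q :: nat
      assume "t \<noteq> t'" and e: "(?U ^^ q) (?Vi ((?U ^^ t) x)) = (?U ^^ p) (?Vi ((?U ^^ t') x))"
      then consider "t < t'" | "t' < t" by linarith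
      then show False using lt[OF _ e] lt[OF _ e[symmetric]] by cases auto
    qed
  qed
qed

end

lemma image_AE_cong:
  assumes S: "S \<in> mp_automorphisms M" and T: "T \<in> mp_automorphisms M" and e: "AE x in M. S x = T x" and A: "A \<in> sets M"
  shows "AE y in M. y \<in> S ` A \<longleftrightarrow> y \<in> T ` A"
  using AE_minv_cong[OF S T e] AE_space
proof eventually_elim
  case (elim y)
  have "A \<subseteq> space M" by (rule sets.sets_into_space[OF A])
  then show ?case using elim by (simp add: mp_aut_image[OF S] mp_aut_image[OF T])
qed

lemma sym_diff_image_cong:
  assumes S: "S \<in> mp_automorphisms M" and T: "T \<in> mp_automorphisms M" and e: "AE x in M. S x = T x"
    and A: "A \<in> sets M" and C: "C \<in> sets M"
  shows "measure M (sym_diff (S ` A) C) = measure M (sym_diff (T ` A) C)"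
  by (rule measure_eq_AE)
    (use image_AE_cong[OF S T e A] mp_aut_image_sets(1)[OF S A] mp_aut_image_sets(1)[OF T A] C in auto)

text \<open>
  A point of the symmetric difference is the image under \<open>T \<circ> F\<close> of a point
  \<open>x\<close> for which \<open>T x \<in> A\<close> and \<open>T (F x) \<in> B\<close> are not
  equivalent.
\<close>

lemma conjugate_image:
  assumes T: "T \<in> mp_automorphisms M" and F: "F \<in> mp_automorphisms M" and A: "A \<in> sets M"
    and Z: "Z \<in> sets M" and B: "B \<in> sets M" and pM: "prob_space M"
    and z: "\<And>x. x \<in> space M - Z \<Longrightarrow> T x \<in> A \<longleftrightarrow> T (F x) \<in> B"
  shows "measure M (sym_diff ((T \<circ> F \<circ> minv M T) ` A) B) \<le> measure M Z"
proof -
  interpret prob_space M by (rule pM)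
  have TF: "T \<circ> F \<in> mp_automorphisms M" by (rule mp_aut_comp(1)[OF T F])
  have C: "T \<circ> F \<circ> minv M T \<in> mp_automorphisms M" by (rule mp_aut_comp(1)[OF TF mp_aut_minv[OF T]])
  have Asp: "A \<subseteq> space M" and base_space: "B \<subseteq> space M" using A B sets.sets_into_space by auto
  have "sym_diff ((T \<circ> F \<circ> minv M T) ` A) B \<subseteq> (T \<circ> F) ` Z"
  proof
    fix y assume y: "y \<in> sym_diff ((T \<circ> F \<circ> minv M T) ` A) B"
    then have ys: "y \<in> space M" using base_space mp_aut_space[OF C] Asp by blast
    define x where "x = minv M (T \<circ> F) y"
    have x: "x \<in> space M" "T (F x) = y" using minv_space[OF TF ys] minv_right[OF TF ys] by (auto simp: x_def)
    have "minv M (T \<circ> F \<circ> minv M T) y = T x"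
    proof -
      have "(T \<circ> F \<circ> minv M T) (T x) = y" using minv_left[OF T x(1)] x(2) by simp
      then show ?thesis using minv_left[OF C mp_aut_space[OF T x(1)]] by simp
    qed
    then have "y \<in> (T \<circ> F \<circ> minv M T) ` A \<longleftrightarrow> T x \<in> A"
      unfolding mp_aut_image[OF C Asp] using ys by simp
    then have "x \<in> Z" using y z[of x] x by auto
    then show "y \<in> (T \<circ> F) ` Z" using x by auto
  qed
  then have "prob (sym_diff ((T \<circ> F \<circ> minv M T) ` A) B) \<le> prob ((T \<circ> F) ` Z)"
    by (rule finite_measure_mono) (rule mp_aut_image_sets(1)[OF TF Z])
  then show ?thesis unfolding mp_aut_image_sets(2)[OF TF Z] .
qed

text \<open>
  One generator \<open>r\<close> keeps its action; the finitely many others that matter are modified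
  inside its full group. If there are no generators, the action \<open>a\<close> itself satisfies
  the claim.
\<close>

lemma oe_approximation:
  assumes pM: "prob_space M" and std: "standard_borel M" and na: "non_atomic M"
    and free: "free_on G S" and S: "countable S" and a: "a \<in> actions G M" and ef: "essentially_free G M a"
    and b: "b \<in> actions G M" and S0: "finite S0" "S0 \<subseteq> S" and \<A>: "finite \<A>" "\<A> \<subseteq> sets M" and e: "\<epsilon> > 0"
  shows "\<exists>c\<in>oe_class G M a. \<forall>s\<in>S0. \<forall>A\<in>\<A>. measure M (sym_diff (aut_rep (c s) ` A) (aut_rep (b s) ` A)) < \<epsilon>"
proof -
  interpret prob_space M by (rule pM)
  have Sc: "S \<subseteq> carrier G" by (rule free_onD(2)[OF free])
  define f where "f s = aut_rep (a s)" for s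
  have f: "f s \<in> mp_automorphisms M" if "s \<in> S" for s unfolding f_def using actionsD(2)[OF a] that Sc by blast
  have bm: "aut_rep (b s) \<in> mp_automorphisms M" if "s \<in> S" for s using actionsD(2)[OF b] that Sc by blast
  have af: "AE x in M. aut_rep (a s) x = f s x" for s by (simp add: f_def)
  show ?thesis
  proof (cases "S = {}")
    case True
    have "a \<in> oe_class G M a"
      by (rule oe_classI[where f = f and h = f and T = id, OF free S a a mp_aut_id(1)]) (use True in auto)
    then show ?thesis using True S0 by auto
  next
    case False
    then obtain r where r: "r \<in> S" by blast
    define I where "I = S0 - {r}"
    have I: "finite I" "\<And>i. i \<in> I \<Longrightarrow> i \<in> S" "\<And>i. i \<in> I \<Longrightarrow> r \<noteq> i" using S0 by (auto simp: I_def)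
    have fw: "AE x in M. \<forall>w\<in>reduced_words S. w \<noteq> [] \<longrightarrow> word_act M f w x \<noteq> x"
      by (rule free_action_words[where f = f, OF free S a ef f af])
    have ap: "AE x in M. \<forall>k>0. (f r ^^ k) x \<noteq> x" by (rule generator_aperiodic[where f = f, OF f fw r])
    have sep: "AE x in M. \<forall>t t' p q. t \<noteq> t' \<longrightarrow>
      (f r ^^ q) (minv M (f i) ((f r ^^ t) x)) \<noteq> (f r ^^ p) (minv M (f i) ((f r ^^ t') x))" if "i \<in> I" for i
      by (rule generator_separation[where f = f, OF f fw r I(2)[OF that] I(3)[OF that]])
    have fI: "f i \<in> mp_automorphisms M" and bI: "aut_rep (b i) \<in> mp_automorphisms M" if "i \<in> I" for i
      using f bm I(2)[OF that] by auto
    have "\<exists>T\<in>mp_automorphisms M. \<exists>\<psi>.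
       (\<forall>i\<in>I. \<psi> i \<in> mp_automorphisms M \<and>
        (\<forall>y\<in>space M. \<exists>x\<in>space M. \<exists>t u. y = (f r ^^ t) x \<and> \<psi> i y = (f r ^^ u) x)) \<and>
       (\<exists>Z\<in>events. prob Z < \<epsilon> \<and> (\<forall>x\<in>space M - Z. \<forall>A\<in>\<A>. (T x \<in> A \<longleftrightarrow> T (f r x) \<in> aut_rep (b r) ` A) \<and>
        (\<forall>i\<in>I. T x \<in> A \<longleftrightarrow> T (\<psi> i (f i x)) \<in> aut_rep (b i) ` A)))"
      by (rule full_group_approximation[where V = f and b = "\<lambda>i. aut_rep (b i)",
          OF std na f[OF r] ap bm[OF r] I(1) fI bI sep \<A> e])
    then obtain T \<psi> Z where T: "T \<in> mp_automorphisms M"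
      and \<psi>: "\<forall>i\<in>I. \<psi> i \<in> mp_automorphisms M \<and>
        (\<forall>y\<in>space M. \<exists>x\<in>space M. \<exists>t u. y = (f r ^^ t) x \<and> \<psi> i y = (f r ^^ u) x)"
      and Z: "Z \<in> events" "prob Z < \<epsilon>"
      and good: "\<forall>x\<in>space M - Z. \<forall>A\<in>\<A>. (T x \<in> A \<longleftrightarrow> T (f r x) \<in> aut_rep (b r) ` A) \<and>
        (\<forall>i\<in>I. T x \<in> A \<longleftrightarrow> T (\<psi> i (f i x)) \<in> aut_rep (b i) ` A)"
      by (elim bexE exE conjE)
    define h where "h s = (if s \<in> I then \<psi> s \<circ> f s else f s)" for s
    have h: "h s \<in> mp_automorphisms M" if "s \<in> S" for s
      using \<psi> f[OF that] mp_aut_comp(1)[of "\<psi> s" M "f s"] by (simp add: h_def)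
    have orb: "word_orbit M S h x = word_orbit M S f x" if x: "x \<in> space M" for x
    proof (rule word_orbit_full_group[where f = f and h = h, OF f h r _ _ x])
      show "h r = f r" using I(3) by (auto simp: h_def)
      fix s y assume s: "s \<in> S" and y: "y \<in> space M"
      have fy: "f s y \<in> space M" by (rule mp_aut_space[OF f[OF s] y])
      show "\<exists>x\<in>space M. \<exists>t u. f s y = (f r ^^ t) x \<and> h s y = (f r ^^ u) x"
      proof (cases "s \<in> I")
        case True
        then show ?thesis using \<psi> fy by (simp add: h_def)
      next
        case False
        then show ?thesis by (intro bexI[OF _ fy] exI[of _ 0]) (simp add: h_def)
      qed
    qed
    have conj: "T \<circ> h s \<circ> minv M T \<in> mp_automorphisms M" if "s \<in> S" for s
      by (intro mp_aut_comp(1) T h that mp_aut_minv)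
    obtain c where c: "c \<in> actions G M" "\<forall>s\<in>S. AE x in M. aut_rep (c s) x = (T \<circ> h s \<circ> minv M T) x"
      using free_action_exists[where f = "\<lambda>s. T \<circ> h s \<circ> minv M T", OF free conj] by blast
    have coe: "c \<in> oe_class G M a"
      by (rule oe_classI[where f = f and h = h, OF free S a c(1) T f af h _ orb]) (use c(2) in blast)+
    have "measure M (sym_diff (aut_rep (c s) ` A) (aut_rep (b s) ` A)) < \<epsilon>" if s: "s \<in> S0" and A: "A \<in> \<A>" for s A
    proof -
      have sS: "s \<in> S" and Am: "A \<in> events" using s S0 A \<A> by auto
      have cm: "aut_rep (c s) \<in> mp_automorphisms M" using actionsD(2)[OF c(1)] sS Sc by blast
      have bA: "aut_rep (b s) ` A \<in> events" by (rule mp_aut_image_sets(1)[OF bm[OF sS] Am])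
      have "measure M (sym_diff (aut_rep (c s) ` A) (aut_rep (b s) ` A)) =
          measure M (sym_diff ((T \<circ> h s \<circ> minv M T) ` A) (aut_rep (b s) ` A))"
        by (rule sym_diff_image_cong[OF cm conj[OF sS] _ Am bA]) (use c(2) sS in blast)
      also have "\<dots> \<le> prob Z"
      proof (rule conjugate_image[OF T h[OF sS] Am Z(1) bA pM])
        fix x assume x: "x \<in> space M - Z"
        show "T x \<in> A \<longleftrightarrow> T (h s x) \<in> aut_rep (b s) ` A"
        proof (cases "s \<in> I")
          case True
          have "T x \<in> A \<longleftrightarrow> T (\<psi> s (f s x)) \<in> aut_rep (b s) ` A" using good x A True by blast
          then show ?thesis using True by (simp add: h_def)
        next
          case False
          then have "s = r" using s by (auto simp: I_def)
          moreover have "T x \<in> A \<longleftrightarrow> T (f r x) \<in> aut_rep (b r) ` A" using good x A by blast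
          ultimately show ?thesis using False by (simp add: h_def)
        qed
      qed
      finally show ?thesis using Z(2) by linarith
    qed
    then show ?thesis using coe by blast
  qed
qed

section \<open>The weak topology and density\<close>

lemma (in prob_space) prob_sym_diff_triangle:
  assumes "A \<in> events" "B \<in> events" "C \<in> events"
  shows "prob (sym_diff A C) \<le> prob (sym_diff A B) + prob (sym_diff B C)"
proof -
  have "prob (sym_diff A C) \<le> prob (sym_diff A B \<union> sym_diff B C)"
    by (rule finite_measure_mono) (use assms in auto)
  also have "\<dots> \<le> prob (sym_diff A B) + prob (sym_diff B C)"
    by (rule measure_Un_le) (use assms in auto)
  finally show ?thesis .
qed

lemma mp_aut_image_sym_diff:
  assumes T: "T \<in> mp_automorphisms M" and A: "A \<in> sets M" and B: "B \<in> sets M"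
  shows "measure M (sym_diff (T ` A) (T ` B)) = measure M (sym_diff A B)"
proof -
  have i: "inj_on T (space M)" using mp_aut_bij[OF T] by (auto simp: bij_betw_def)
  have AB: "A \<subseteq> space M" "B \<subseteq> space M" using A B sets.sets_into_space by auto
  have "sym_diff (T ` A) (T ` B) = T ` sym_diff A B"
    using inj_on_image_set_diff[OF i _ AB(2), of A] inj_on_image_set_diff[OF i _ AB(1), of B] AB
    by (auto simp: image_Un)
  then show ?thesis using mp_aut_image_sets(2)[OF T, of "sym_diff A B"] A B by simp
qed

text \<open>
  The sets \<open>{x. g x \<le> q}\<close> for rational \<open>q\<close> separate almost all points,
  where \<open>g\<close> is the code of \<open>standard_borel_coding\<close>.
\<close>

lemma (in prob_space) images_determine_automorphism:
  assumes std: "standard_borel M" and S: "S \<in> mp_automorphisms M" and T: "T \<in> mp_automorphisms M"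
    and z: "\<And>B. B \<in> events \<Longrightarrow> prob (sym_diff (S ` B) (T ` B)) = 0"
  shows "AE x in M. S x = T x"
proof -
  obtain g j where g [measurable]: "g \<in> borel_measurable M" and g0: "\<And>x. 0 \<le> g x" and g1: "\<And>x. g x < (1::real)"
    and j: "j \<in> measurable borel M"
    and jg: "AE x in M. j (g x) = x" by (rule standard_borel_coding[OF prob_space_axioms std], rule that)
  have "AE y in M. \<forall>q\<in>\<rat>. g (minv M S y) \<le> q \<longleftrightarrow> g (minv M T y) \<le> q"
    unfolding AE_ball_countable[OF countable_rat]
  proof
    fix q :: real
    let ?B = "{x\<in>space M. g x \<le> q}"
    have B: "?B \<in> events" by measurable
    have "AE y in M. y \<notin> sym_diff (S ` ?B) (T ` ?B)"
      using z[OF B] mp_aut_image_sets(1)[OF S B] mp_aut_image_sets(1)[OF T B] by (subst (asm) prob_eq_0) auto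
    then show "AE y in M. g (minv M S y) \<le> q \<longleftrightarrow> g (minv M T y) \<le> q"
      using AE_space
    proof eventually_elim
      case (elim y)
      have "y \<in> S ` ?B \<longleftrightarrow> y \<in> T ` ?B" using elim(1) by blast
      moreover have "?B \<subseteq> space M" by auto
      ultimately show ?case
        using elim(2) minv_space[OF S elim(2)] minv_space[OF T elim(2)]
        by (simp add: mp_aut_image[OF S] mp_aut_image[OF T])
    qed
  qed
  moreover have "AE y in M. j (g (minv M S y)) = minv M S y" by (rule AE_mp_aut[OF mp_aut_minv[OF S] jg])
  moreover have "AE y in M. j (g (minv M T y)) = minv M T y" by (rule AE_mp_aut[OF mp_aut_minv[OF T] jg])
  ultimately have "AE y in M. minv M S y = minv M T y"
  proof eventually_elim
    case (elim y)
    have "g (minv M S y) = g (minv M T y)"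
    proof (rule ccontr)
      assume "g (minv M S y) \<noteq> g (minv M T y)"
      then obtain q where "q \<in> \<rat>" "g (minv M S y) < q \<and> q < g (minv M T y) \<or> g (minv M T y) < q \<and> q < g (minv M S y)"
        by (metis Rats_dense_in_real linorder_neqE_linordered_idom)
      then show False using elim(1) by force
    qed
    then show ?case using elim(2,3) by metis
  qed
  from AE_mp_aut[OF S this] have "AE x in M. minv M S (S x) = minv M T (S x)" .
  then show ?thesis using AE_space
  proof eventually_elim
    case (elim x)
    then have "minv M T (S x) = x" using minv_left[OF S] by simp
    then show ?case using minv_right[OF T mp_aut_space[OF S elim(2)]] by simp
  qed
qed

context
  fixes M :: "'a measure" and A :: "nat \<Rightarrow> 'a set"
  assumes pM: "prob_space M" and std: "standard_borel M" and dA: "dense_sequence M A"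
begin

lemma dense_sequence_sets: "A i \<in> sets M"
  using dA by (auto simp: dense_sequence_def)

lemma weak_dist_summable:
  "summable (\<lambda>i. (1/2) ^ Suc i * measure M (sym_diff (aut_rep c ` A i) (aut_rep d ` A i)))"
proof -
  interpret prob_space M by (rule pM)
  show ?thesis
  proof (rule summable_comparison_test'[where g = "\<lambda>i. (1/2) ^ Suc i"])
    show "summable (\<lambda>i. (1/2) ^ Suc i :: real)" using sums_summable[OF power_half_series] .
    fix i
    show "norm ((1/2) ^ Suc i * prob (sym_diff (aut_rep c ` A i) (aut_rep d ` A i))) \<le> (1/2) ^ Suc i"
      using prob_le_1 by (simp add: mult_left_le)
  qed
qed

text \<open>
  Distance zero forces equal images of every \<open>A i\<close> and, by density, of every measurable
  set; these images determine the class.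
\<close>

lemma weak_dist_metric: "Metric_space (carrier (Aut M)) (weak_dist M A)"
proof -
  interpret prob_space M by (rule pM)
  have im: "aut_rep c ` B \<in> events" if "c \<in> carrier (Aut M)" "B \<in> events" for c B
    by (rule mp_aut_image_sets(1)[OF aut_rep_carrier(1)[OF that(1)] that(2)])
  show ?thesis
  proof
    show "0 \<le> weak_dist M A c d" for c d
      unfolding weak_dist_def by (rule suminf_nonneg[OF weak_dist_summable]) auto
    show "weak_dist M A c d = weak_dist M A d c" for c d
      unfolding weak_dist_def by (simp add: Un_commute)
    show "weak_dist M A c e \<le> weak_dist M A c d + weak_dist M A d e"
      if c: "c \<in> carrier (Aut M)" and d: "d \<in> carrier (Aut M)" and e: "e \<in> carrier (Aut M)" for c d e
    proof -
      have "weak_dist M A c e \<le> (\<Sum>i. (1/2) ^ Suc i * prob (sym_diff (aut_rep c ` A i) (aut_rep d ` A i)) +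
          (1/2) ^ Suc i * prob (sym_diff (aut_rep d ` A i) (aut_rep e ` A i)))"
        unfolding weak_dist_def
      proof (rule suminf_le[OF _ weak_dist_summable summable_add[OF weak_dist_summable weak_dist_summable]])
        fix i
        have "prob (sym_diff (aut_rep c ` A i) (aut_rep e ` A i)) \<le>
          prob (sym_diff (aut_rep c ` A i) (aut_rep d ` A i)) + prob (sym_diff (aut_rep d ` A i) (aut_rep e ` A i))"
          by (rule prob_sym_diff_triangle[OF im[OF c dense_sequence_sets] im[OF d dense_sequence_sets] im[OF e dense_sequence_sets]])
        from mult_left_mono[OF this, of "(1/2) ^ Suc i"]
        show "(1/2) ^ Suc i * prob (sym_diff (aut_rep c ` A i) (aut_rep e ` A i)) \<le>
          (1/2) ^ Suc i * prob (sym_diff (aut_rep c ` A i) (aut_rep d ` A i)) +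
          (1/2) ^ Suc i * prob (sym_diff (aut_rep d ` A i) (aut_rep e ` A i))" by (simp add: distrib_left)
      qed
      also have "\<dots> = weak_dist M A c d + weak_dist M A d e"
        unfolding weak_dist_def by (rule suminf_add[OF weak_dist_summable weak_dist_summable, symmetric])
      finally show ?thesis .
    qed
    show "weak_dist M A c d = 0 \<longleftrightarrow> c = d" if c: "c \<in> carrier (Aut M)" and d: "d \<in> carrier (Aut M)" for c d
    proof
      assume "c = d" then show "weak_dist M A c d = 0" by (simp add: weak_dist_def)
    next
      assume "weak_dist M A c d = 0"
      then have "\<forall>i. (1/2) ^ Suc i * prob (sym_diff (aut_rep c ` A i) (aut_rep d ` A i)) = 0"
        unfolding weak_dist_def by (subst (asm) suminf_eq_zero_iff[OF weak_dist_summable]) auto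
      then have Ai: "prob (sym_diff (aut_rep c ` A i) (aut_rep d ` A i)) = 0" for i by simp
      note cm = aut_rep_carrier(1)[OF c] and dm = aut_rep_carrier(1)[OF d]
      have "AE x in M. aut_rep c x = aut_rep d x"
      proof (rule images_determine_automorphism[OF std cm dm])
        fix B assume B: "B \<in> events"
        have "prob (sym_diff (aut_rep c ` B) (aut_rep d ` B)) \<le> e" if ep: "e > 0" for e
        proof -
          have "e / 2 > 0" using ep by simp
          then obtain i where i: "prob (sym_diff (A i) B) < e / 2"
            using dA B unfolding dense_sequence_def by blast
          have "prob (sym_diff (aut_rep c ` B) (aut_rep d ` B)) \<le>
              prob (sym_diff (aut_rep c ` B) (aut_rep c ` A i)) + prob (sym_diff (aut_rep c ` A i) (aut_rep d ` B))"
            by (rule prob_sym_diff_triangle[OF im[OF c B] im[OF c dense_sequence_sets] im[OF d B]])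
          also have "prob (sym_diff (aut_rep c ` A i) (aut_rep d ` B)) \<le>
              prob (sym_diff (aut_rep c ` A i) (aut_rep d ` A i)) + prob (sym_diff (aut_rep d ` A i) (aut_rep d ` B))"
            by (rule prob_sym_diff_triangle[OF im[OF c dense_sequence_sets] im[OF d dense_sequence_sets] im[OF d B]])
          also have "prob (sym_diff (aut_rep c ` B) (aut_rep c ` A i)) = prob (sym_diff (A i) B)"
            by (simp add: mp_aut_image_sym_diff[OF cm B dense_sequence_sets] Un_commute)
          also have "prob (sym_diff (aut_rep d ` A i) (aut_rep d ` B)) = prob (sym_diff (A i) B)"
            by (rule mp_aut_image_sym_diff[OF dm dense_sequence_sets B])
          finally show ?thesis using i Ai[of i] by linarith
        qed
        then have "prob (sym_diff (aut_rep c ` B) (aut_rep d ` B)) \<le> 0" by (rule field_le_epsilon[where y = 0, simplified])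
        then show "prob (sym_diff (aut_rep c ` B) (aut_rep d ` B)) = 0" using measure_nonneg order_antisym by blast
      qed
      then have "aut_class M (aut_rep c) = aut_class M (aut_rep d)" by (simp add: aut_class_eq[OF cm dm])
      then show "c = d" using aut_rep_carrier(2)[OF c] aut_rep_carrier(2)[OF d] by simp
    qed
  qed
qed

text \<open>
  All terms of the series with index at least \<open>n\<close> together are at most \<open>(1/2) ^
  n\<close>.
\<close>

lemma weak_dist_small:
  assumes e: "e > 0"
  shows "\<exists>n. \<forall>c d. (\<forall>i<n. measure M (sym_diff (aut_rep c ` A i) (aut_rep d ` A i)) < e / 2) \<longrightarrow> weak_dist M A c d < e"
proof -
  interpret prob_space M by (rule pM)
  obtain n where n: "(1/2) ^ n < e / 2" using real_arch_pow_inv[of "e/2" "1/2"] e by auto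
  have "weak_dist M A c d < e"
    if s: "\<forall>i<n. prob (sym_diff (aut_rep c ` A i) (aut_rep d ` A i)) < e / 2" for c d
  proof -
    define u where "u i = prob (sym_diff (aut_rep c ` A i) (aut_rep d ` A i))" for i
    have half: "(\<lambda>i. (1/2) ^ Suc i :: real) sums 1" by (rule power_half_series)
    have sm: "summable (\<lambda>i. (1/2) ^ Suc i * u i)" unfolding u_def by (rule weak_dist_summable)
    have "weak_dist M A c d = (\<Sum>i. (1/2) ^ Suc (i + n) * u (i + n)) + (\<Sum>i<n. (1/2) ^ Suc i * u i)"
      unfolding weak_dist_def u_def[symmetric] by (rule suminf_split_initial_segment[OF sm])
    also have "(\<Sum>i<n. (1/2) ^ Suc i * u i) \<le> (\<Sum>i<n. (1/2) ^ Suc i * (e / 2))"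
      using s by (intro sum_mono mult_left_mono) (auto simp: u_def less_imp_le)
    also have "\<dots> \<le> 1 * (e / 2)"
      unfolding sum_distrib_right[symmetric]
      using sum_le_suminf[OF sums_summable[OF half], of "{..<n}"] sums_unique[OF half] e
      by (intro mult_right_mono) auto
    also have "(\<Sum>i. (1/2) ^ Suc (i + n) * u (i + n)) \<le> (\<Sum>i. (1/2) ^ n * (1/2) ^ Suc i)"
    proof (rule suminf_le)
      show "summable (\<lambda>i. (1/2) ^ Suc (i + n) * u (i + n))"
        using sm by (subst summable_iff_shift[of "\<lambda>i. (1/2) ^ Suc i * u i"])
      show "summable (\<lambda>i. (1/2) ^ n * (1/2) ^ Suc i :: real)"
        by (rule summable_mult[OF sums_summable[OF half]])
      fix i
      have "u (i + n) \<le> 1" unfolding u_def by (rule prob_le_1)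
      then have "(1/2) ^ Suc (i + n) * u (i + n) \<le> (1/2) ^ Suc (i + n) * 1" by (intro mult_left_mono) auto
      then show "(1/2) ^ Suc (i + n) * u (i + n) \<le> (1/2) ^ n * (1/2) ^ Suc i" by (simp add: power_add mult.commute)
    qed
    also have "\<dots> = (1/2) ^ n"
      using sums_unique[OF sums_mult[OF half, of "(1/2) ^ n"]] by simp
    finally show ?thesis using n by simp
  qed
  then show ?thesis by blast
qed

end

text \<open>
  Continuity of multiplication and inversion in the weak topology, in the form needed for words:
  finitely many test sets for the generators control one test set for the word.
\<close>

lemma word_act_continuous:
  assumes pM: "prob_space M" and f: "\<And>s. s \<in> S \<Longrightarrow> f s \<in> mp_automorphisms M"
    and w: "w \<in> lists (S \<times> UNIV)" and D: "D \<in> sets M" and e: "e > 0"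
  shows "\<exists>P \<delta>. finite P \<and> P \<subseteq> S \<times> sets M \<and> \<delta> > 0 \<and> (\<forall>h. (\<forall>s\<in>S. h s \<in> mp_automorphisms M) \<longrightarrow>
     (\<forall>p\<in>P. measure M (sym_diff (h (fst p) ` snd p) (f (fst p) ` snd p)) < \<delta>) \<longrightarrow>
     measure M (sym_diff (word_act M h w ` D) (word_act M f w ` D)) < e)"
  using w e
proof (induction w arbitrary: e rule: list.induct)
  case Nil
  then show ?case by (intro exI[of _ "{}"] exI[of _ 1]) auto
next
  case (Cons l w)
  interpret prob_space M by (rule pM)
  have l: "fst l \<in> S" and w: "w \<in> lists (S \<times> UNIV)" using Cons.prems by auto
  obtain P \<delta> where P: "finite P" "P \<subseteq> S \<times> events" "\<delta> > 0"
    and IH: "\<And>h. (\<forall>s\<in>S. h s \<in> mp_automorphisms M) \<Longrightarrow>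
     (\<forall>p\<in>P. prob (sym_diff (h (fst p) ` snd p) (f (fst p) ` snd p)) < \<delta>) \<Longrightarrow>
     prob (sym_diff (word_act M h w ` D) (word_act M f w ` D)) < e / 2"
    using Cons.IH[OF w, of "e / 2"] Cons.prems(2) by auto
  define E where "E = word_act M f w ` D"
  have E: "E \<in> events" unfolding E_def by (rule mp_aut_image_sets(1)[OF word_act_mp[where f = f, OF f w] D])
  \<comment> \<open>For an inverse letter the test set is pulled back, since \<open>h\<close> and \<open>f\<close> are compared and not their inverses.\<close>
  define E' where "E' = (if snd l then E else minv M (f (fst l)) ` E)"
  have E': "E' \<in> events" using E mp_aut_image_sets(1)[OF mp_aut_minv[OF f[OF l]] E] by (simp add: E'_def)
  have step: "prob (sym_diff (word_act M h (l # w) ` D) (word_act M f (l # w) ` D)) < e"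
    if h: "\<forall>s\<in>S. h s \<in> mp_automorphisms M"
      and c: "\<forall>p\<in>insert (fst l, E') P. prob (sym_diff (h (fst p) ` snd p) (f (fst p) ` snd p)) < min \<delta> (e / 2)" for h
  proof -
    have h': "\<And>s. s \<in> S \<Longrightarrow> h s \<in> mp_automorphisms M" using h by blast
    have lS: "l \<in> S \<times> UNIV" using l by (cases l) auto
    note lh = letter_act_mp[where f = h, OF h' lS] and lf = letter_act_mp[where f = f, OF f lS]
    define F where "F = word_act M h w ` D"
    have F: "F \<in> events" unfolding F_def by (rule mp_aut_image_sets(1)[OF word_act_mp[where f = h, OF h' w] D])
    have "prob (sym_diff F E) < e / 2" unfolding F_def E_def by (rule IH[OF h]) (use c in auto)
    moreover have "prob (sym_diff (letter_act M h l ` E) (letter_act M f l ` E)) < e / 2"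
    proof (cases "snd l")
      case True
      then show ?thesis using c by (simp add: letter_act_def E'_def)
    next
      case False
      let ?h = "h (fst l)" and ?f = "f (fst l)"
      note hm = h'[OF l] and fm = f[OF l]
      have Esp: "E \<subseteq> space M" by (rule sets.sets_into_space[OF E])
      have hE: "minv M ?h ` E \<in> events" and fE: "minv M ?f ` E \<in> events"
        using mp_aut_image_sets(1)[OF mp_aut_minv[OF hm] E] mp_aut_image_sets(1)[OF mp_aut_minv[OF fm] E] by auto
      have r: "?h ` (minv M ?h ` E) = E" "?f ` (minv M ?f ` E) = E"
        using Esp minv_right[OF hm] minv_right[OF fm] by (force simp: image_image subset_iff)+
      have "prob (sym_diff (minv M ?h ` E) (minv M ?f ` E)) = prob (sym_diff (?h ` (minv M ?h ` E)) (?h ` (minv M ?f ` E)))"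
        by (rule mp_aut_image_sym_diff[OF hm hE fE, symmetric])
      also have "\<dots> = prob (sym_diff (?h ` E') (?f ` E'))"
        using False r by (simp add: E'_def Un_commute)
      also have "\<dots> < e / 2" using c by simp
      finally show ?thesis using False by (simp add: letter_act_def)
    qed
    moreover have "prob (sym_diff (letter_act M h l ` F) (letter_act M f l ` E)) \<le>
        prob (sym_diff (letter_act M h l ` F) (letter_act M h l ` E)) + prob (sym_diff (letter_act M h l ` E) (letter_act M f l ` E))"
      by (rule prob_sym_diff_triangle[OF mp_aut_image_sets(1)[OF lh F] mp_aut_image_sets(1)[OF lh E] mp_aut_image_sets(1)[OF lf E]])
    moreover have "prob (sym_diff (letter_act M h l ` F) (letter_act M h l ` E)) = prob (sym_diff F E)"
      by (rule mp_aut_image_sym_diff[OF lh F E])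
    moreover have "word_act M h (l # w) ` D = letter_act M h l ` F" "word_act M f (l # w) ` D = letter_act M f l ` E"
      by (simp_all add: F_def E_def image_image)
    ultimately show ?thesis by simp
  qed
  show ?case
    by (rule exI[of _ "insert (fst l, E') P"], rule exI[of _ "min \<delta> (e / 2)"])
      (use P l E' Cons.prems(2) step in auto)
qed

lemma oe_approximation_group:
  assumes pM: "prob_space M" and std: "standard_borel M" and na: "non_atomic M"
    and free: "free_on G S" and S: "countable S" and a: "a \<in> actions G M" and ef: "essentially_free G M a"
    and b: "b \<in> actions G M" and F: "finite F" "F \<subseteq> carrier G" and \<A>: "finite \<A>" "\<A> \<subseteq> sets M" and e: "e > 0"
  shows "\<exists>c\<in>oe_class G M a. \<forall>g\<in>F. \<forall>A\<in>\<A>. measure M (sym_diff (aut_rep (c g) ` A) (aut_rep (b g) ` A)) < e"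
proof -
  interpret prob_space M by (rule pM)
  have Sc: "S \<subseteq> carrier G" by (rule free_onD(2)[OF free])
  define f where "f s = aut_rep (b s)" for s
  have f: "f s \<in> mp_automorphisms M" if "s \<in> S" for s unfolding f_def using actionsD(2)[OF b] that Sc by blast
  have "\<forall>g\<in>carrier G. \<exists>w. w \<in> lists (S \<times> UNIV) \<and> g = word_value G w"
    unfolding free_carrier[OF free] by blast
  from bchoice[OF this] obtain W where W: "\<And>g. g \<in> carrier G \<Longrightarrow> W g \<in> lists (S \<times> UNIV) \<and> g = word_value G (W g)" by blast
  define controls where "controls p P \<delta> \<longleftrightarrow> finite P \<and> P \<subseteq> S \<times> events \<and> \<delta> > 0 \<and> (\<forall>h. (\<forall>s\<in>S. h s \<in> mp_automorphisms M) \<longrightarrow>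
     (\<forall>p\<in>P. prob (sym_diff (h (fst p) ` snd p) (f (fst p) ` snd p)) < \<delta>) \<longrightarrow>
     prob (sym_diff (word_act M h (W (fst p)) ` snd p) (word_act M f (W (fst p)) ` snd p)) < e)" for p P and \<delta> :: real
  have "\<exists>P \<delta>. controls p P \<delta>" if p: "p \<in> F \<times> \<A>" for p
  proof -
    have "fst p \<in> carrier G" "snd p \<in> events" using p F \<A> by auto
    then show ?thesis
      unfolding controls_def using W by (intro word_act_continuous[where f = f, OF pM f _ _ e]) blast+
  qed
  then have "\<forall>p\<in>F \<times> \<A>. \<exists>P \<delta>. controls p P \<delta>" by (intro ballI)
  from bchoice[OF this] obtain P where "\<forall>p\<in>F \<times> \<A>. \<exists>\<delta>. controls p (P p) \<delta>" by (elim exE)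
  from bchoice[OF this] obtain \<delta> where ctl: "\<forall>p\<in>F \<times> \<A>. controls p (P p) (\<delta> p)" by (elim exE)
  define PP where "PP = (\<Union>p\<in>F \<times> \<A>. P p)"
  define dd where "dd = Min (insert 1 (\<delta> ` (F \<times> \<A>)))"
  have finFA: "finite (F \<times> \<A>)" using F \<A> by simp
  have PP: "finite PP" "PP \<subseteq> S \<times> events" unfolding PP_def using finFA ctl by (auto simp: controls_def)
  have dd: "dd > 0" unfolding dd_def using finFA ctl by (subst Min_gr_iff) (auto simp: controls_def)
  have ddle: "dd \<le> \<delta> p" if "p \<in> F \<times> \<A>" for p unfolding dd_def using finFA that by (intro Min_le) auto
  obtain c where c: "c \<in> oe_class G M a"
    and close: "\<forall>s\<in>fst ` PP. \<forall>A\<in>snd ` PP. prob (sym_diff (aut_rep (c s) ` A) (aut_rep (b s) ` A)) < dd"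
    using oe_approximation[OF pM std na free S a ef b, of "fst ` PP" "snd ` PP" dd] PP dd by fastforce
  have ca: "c \<in> actions G M" using c by (simp add: oe_class_def)
  define h where "h s = aut_rep (c s)" for s
  have h: "h s \<in> mp_automorphisms M" if "s \<in> S" for s unfolding h_def using actionsD(2)[OF ca] that Sc by blast
  have "prob (sym_diff (aut_rep (c g) ` A) (aut_rep (b g) ` A)) < e" if g: "g \<in> F" and A: "A \<in> \<A>" for g A
  proof -
    have gc: "g \<in> carrier G" and Am: "A \<in> events" using g F A \<A> by auto
    have w: "W g \<in> lists (S \<times> UNIV)" "word_value G (W g) = g" using W[OF gc] by auto
    note cm = actionsD(2)[OF ca gc] and bm = actionsD(2)[OF b gc]
    note wh = word_act_mp[where f = h, OF h w(1)] and wf = word_act_mp[where f = f, OF f w(1)]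
    have 1: "AE x in M. aut_rep (c g) x = word_act M h (W g) x"
      using action_word[where f = h, OF ca free_onD(1)[OF free] Sc h _ w(1)] by (simp add: h_def w(2))
    have 2: "AE x in M. aut_rep (b g) x = word_act M f (W g) x"
      using action_word[where f = f, OF b free_onD(1)[OF free] Sc f _ w(1)] by (simp add: f_def w(2))
    have "prob (sym_diff (aut_rep (c g) ` A) (aut_rep (b g) ` A)) = prob (sym_diff (word_act M h (W g) ` A) (aut_rep (b g) ` A))"
      by (rule sym_diff_image_cong[OF cm wh 1 Am mp_aut_image_sets(1)[OF bm Am]])
    also have "\<dots> = prob (sym_diff (aut_rep (b g) ` A) (word_act M h (W g) ` A))" by (simp add: Un_commute)
    also have "\<dots> = prob (sym_diff (word_act M f (W g) ` A) (word_act M h (W g) ` A))"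
      by (rule sym_diff_image_cong[OF bm wf 2 Am mp_aut_image_sets(1)[OF wh Am]])
    also have "\<dots> = prob (sym_diff (word_act M h (W g) ` A) (word_act M f (W g) ` A))" by (simp add: Un_commute)
    also have "\<dots> < e"
    proof -
      have gA: "(g, A) \<in> F \<times> \<A>" using g A by simp
      have "prob (sym_diff (h (fst p) ` snd p) (f (fst p) ` snd p)) < \<delta> (g, A)" if "p \<in> P (g, A)" for p
      proof -
        have "p \<in> PP" using that gA unfolding PP_def by blast
        then have "prob (sym_diff (h (fst p) ` snd p) (f (fst p) ` snd p)) < dd"
          using close unfolding h_def f_def by blast
        then show ?thesis using ddle[OF gA] by linarith
      qed
      then show ?thesis using bspec[OF ctl gA] h unfolding controls_def by simp
    qed
    finally show ?thesis .
  qed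
  then show ?thesis using c by blast
qed

theorem theorem1p1:
  fixes M :: "'a measure" and A :: "nat \<Rightarrow> 'a set"
    and G :: "('g, 'm) monoid_scheme" and S :: "'g set"
    and a :: "'g \<Rightarrow> ('a \<Rightarrow> 'a) set"
  assumes "prob_space M" and "standard_borel M" and "non_atomic M"
    and "dense_sequence M A"
    and "free_on G S" and "countable S"
    and "a \<in> actions G M" and "essentially_free G M a"
  shows "action_topology G M A closure_of oe_class G M a = topspace (action_topology G M A)"
proof -
  interpret W: Metric_space "carrier (Aut M)" "weak_dist M A" by (rule weak_dist_metric[OF assms(1,2,4)])
  let ?W = "weak_topology M A" and ?X = "action_topology G M A"
  have W: "?W = W.mtopology" by (simp add: weak_topology_def)
  have top: "topspace ?X = actions G M"
    unfolding action_topology_def W by (auto simp: actions_def hom_def PiE_def extensional_def Pi_def)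
  have "b \<in> ?X closure_of oe_class G M a" if b: "b \<in> actions G M" for b
    unfolding in_closure_of
  proof (intro conjI allI impI)
    show "b \<in> topspace ?X" using b top by simp
    fix Y assume Y: "b \<in> Y \<and> openin ?X Y"
    then obtain Y' where Y': "openin (product_topology (\<lambda>_. ?W) (carrier G)) Y'" "Y = Y' \<inter> actions G M"
      unfolding action_topology_def openin_subtopology by blast
    have bY': "b \<in> Y'" using Y Y' by blast
    from bspec[OF Y'(1)[unfolded openin_product_topology_alt] bY'] obtain V where V: "finite {g\<in>carrier G. V g \<noteq> topspace ?W}" "\<forall>g\<in>carrier G. openin ?W (V g)"
      "b \<in> Pi\<^sub>E (carrier G) V" "Pi\<^sub>E (carrier G) V \<subseteq> Y'"
      by (elim exE conjE)
    define F where "F = {g\<in>carrier G. V g \<noteq> topspace ?W}"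
    have F: "finite F" "F \<subseteq> carrier G" using V(1) by (auto simp: F_def)
    have "\<forall>g\<in>F. \<exists>r>0. W.mball (b g) r \<subseteq> V g"
    proof
      fix g assume g: "g \<in> F"
      then have "openin W.mtopology (V g)" "b g \<in> V g" using V(2,3) F by (auto simp: W PiE_def Pi_def)
      then show "\<exists>r>0. W.mball (b g) r \<subseteq> V g" unfolding W.openin_mtopology by blast
    qed
    from bchoice[OF this] obtain r where r: "\<forall>g\<in>F. r g > 0 \<and> W.mball (b g) (r g) \<subseteq> V g" by blast
    define e where "e = Min (insert 1 (r ` F))"
    have e: "e > 0" unfolding e_def using F r by (subst Min_gr_iff) auto
    have er: "e \<le> r g" if "g \<in> F" for g unfolding e_def using F that by (intro Min_le) auto
    obtain n where n: "\<And>c d. (\<forall>i<n. measure M (sym_diff (aut_rep c ` A i) (aut_rep d ` A i)) < e / 2) \<Longrightarrow> weak_dist M A c d < e"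
      using weak_dist_small[OF assms(1,2,4) e] by blast
    have A: "A ` {..<n} \<subseteq> sets M" using assms(4) by (auto simp: dense_sequence_def)
    obtain c where c: "c \<in> oe_class G M a"
      and close: "\<forall>g\<in>F. \<forall>B\<in>A ` {..<n}. measure M (sym_diff (aut_rep (c g) ` B) (aut_rep (b g) ` B)) < e / 2"
      using oe_approximation_group[OF assms(1-3,5-8) b F _ A, of "e / 2"] e by auto
    have ca: "c \<in> actions G M" using c by (simp add: oe_class_def)
    have "c g \<in> V g" if g: "g \<in> carrier G" for g
    proof (cases "g \<in> F")
      case True
      have "weak_dist M A (c g) (b g) < e" by (rule n) (use close True in auto)
      then have "weak_dist M A (b g) (c g) < r g" using er[OF True] by (simp add: W.commute)
      then have "c g \<in> W.mball (b g) (r g)" using actionsD(1)[OF ca g] actionsD(1)[OF b g] by simp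
      then show ?thesis using r True by blast
    next
      case False
      then have "V g = carrier (Aut M)" using g by (simp add: F_def W)
      then show ?thesis using actionsD(1)[OF ca g] by simp
    qed
    then have "c \<in> Pi\<^sub>E (carrier G) V" using ca by (auto simp: PiE_def Pi_def actions_def)
    then have "c \<in> Y" using V(4) Y'(2) ca by blast
    then show "\<exists>y. y \<in> oe_class G M a \<and> y \<in> Y" using c by blast
  qed
  then show ?thesis using closure_of_subset_topspace[of ?X "oe_class G M a"] top by blast
qed

end
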